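(* Let $n\ge1$ and let $A,F,f$ (with the associated data $\beta_k,F_k,m_*,\gamma_k,p_k,p_0,\xi_0$) satisfy the standing assumptions (1)–(4) listed in the context. Let $\mu_k$, $n_k$, $\zeta_*$, the re-indexed functions $p_k$ (so that $f(t)\sim\sum_{k=1}^\infty p_k(\widehat{\mathcal L}_{n_k}(t))$ with $p_k\in\mathscr P_{m_*}(n_k,-\mu_k,\mathbb C^n,\mathbb R^n)$), and the recursively defined functions $q_k$ be as constructed in the context. Then $$q_k\in\widehat{\mathscr P}_{m_*}(n_k,-\mu_k,\mathbb C^n,\mathbb R^n)\quad\text{for all }k\in\mathbb N,$$ and every solution $y\in C^1([T_0,\infty),\mathbb R^n)$ of $$y'+Ay=F(y)+f(t)\quad\text{on }(T_0,\infty)$$ (for some $T_0>0$, $T_0\ge T$) with $\lim_{t\to\infty}y(t)=0$ satisfies the asymptotic expansion $$y(t)\sim\sum_{k=1}^\infty q_k(\Xi_{n_k}(t)),\qquad \Xi_k(t)=\big(\widehat{\mathcal L}_k(t),\zeta_*(\widehat{\mathcal L}_{n_1}(t))\big),$$ that is, for each $N\in\mathbb N$ there is $\mu>\mu_N$ such that $\big|y(t)-\sum_{k=1}^N q_k(\Xi_{n_k}(t))\big|=\mathcal O(L_{m_*}(t)^{-\mu})$ as $t\to\infty$.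
   Context: Conventions: $\mathbb N=\{1,2,\dots\}$, $\mathbb Z_+=\mathbb N\cup\{0\}$; $\mathcal O(\cdot)$ in $t$ means as $t\to\infty$; $t^w=e^{w\ln t}$ for $t>0$, $w\in\mathbb C$. $\mathcal H_\beta(\mathbb R^n)$ is the set of $G:\mathbb R^n\to\mathbb R^n$ with $G(tx)=t^\beta G(x)$ for all $x\in\mathbb R^n$, $t>0$. Iterated functions: $E_0(t)=t$, $E_{m+1}(t)=e^{E_m(t)}$; $L_{-1}(t)=e^t$, $L_0(t)=t$, $L_{m+1}(t)=\ln L_m(t)$ for $t>E_m(0)$. $\widehat{\mathcal L}_k(t)=(L_{-1}(t),L_0(t),\dots,L_k(t))$. Classes of functions: for $z=(z_{-1},\dots,z_k)\in(0,\infty)^{k+2}$, $\alpha\in\mathbb C^{k+2}$, $z^\alpha=\prod_{j=-1}^kz_j^{\alpha_j}$. For $k\ge m\ge-1$, $\mu\in\mathbb R$, $\mathcal E_{\mathbb C}(m,k,\mu)$ is the set of $\alpha\in\mathbb C^{k+2}$ with $\operatorname{Re}\alpha_j=0$ for $-1\le j<m$, $\operatorname{Re}\alpha_m=\mu$. $\widehat{\mathscr P}(k,\mathbb C^d,\mathbb R^d)$: functions $p(z,\zeta)=\sum_{(\alpha,\beta)\in S}z^\alpha\zeta^\beta\xi_{\alpha,\beta}$ on $(0,\infty)^{k+2}\times(0,\infty)$ with $S\subset\mathbb C^{k+2}\times\mathbb R$ finite and closed under conjugation, $\xi_{\alpha,\beta}\in\mathbb C^d$, $\xi_{\bar\alpha,\beta}=\overline{\xi_{\alpha,\beta}}$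 (hence $\mathbb R^d$-valued). $\widehat{\mathscr P}_m(k,\mu,\mathbb C^d,\mathbb R^d)$: those with $\alpha\in\mathcal E_{\mathbb C}(m,k,\mu)$ for all $(\alpha,\beta)\in S$. $\mathscr P(k,\mathbb C^d,\mathbb R^d)$, $\mathscr P_m(k,\mu,\mathbb C^d,\mathbb R^d)$: same without $\zeta,\beta$; such functions are also viewed as functions of $(z,\zeta)$. Functions of $(z_{-1},\dots,z_k)$ are also viewed as functions of $(z_{-1},\dots,z_{k'})$ for $k'>k$. $\mathscr P^+_m(k)$: functions $p\in\mathscr P_m(k,0,\mathbb C,\mathbb R)$ all of whose power vectors have $\alpha_{-1}=0$ and with $p(z)=c\,z^{\alpha_{\max}}+q(z)$, $\alpha_{\max}\in\mathbb R^{k+2}$, $c>0$, $q\in\mathscr P(k,\mathbb C,\mathbb R)$ a finite sum of terms $z^\alpha\xi_\alpha$ with $\operatorname{Re}(\alpha)<\alpha_{\max}$ lexicographically. (Then $p(\widehat{\mathcal L}_k(t))>0$ for large $t$.) Standing assumptions. (1) $A$ is a real $n\times n$ matrix all of whose eigenvalues have positive real parts. (2) $F:\mathbb R^n\to\mathbb R^n$ is locally Lipschitz, $F(0)=0$, and either (H1): there are $\beta_k\in(1,\infty)$, $k\in\mathbb N$, strictly increasing to infinity and $F_k\in\mathcal H_{\beta_k}(\mathbb R^n)\cap C^\infty(\mathbb R^n\setminus\{0\})$ such that for every $N\in\mathbb N$, $|F(x)-\sum_{k=1}^NF_k(x)|=\mathcal O(|x|^\beta)$ as $x\to0$ for some $\beta>\beta_N$;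 or (H2): there are $N_*\in\mathbb N$, $1<\beta_1<\dots<\beta_{N_*}$ and $F_k\in\mathcal H_{\beta_k}(\mathbb R^n)\cap C^\infty(\mathbb R^n\setminus\{0\})$, $1\le k\le N_*$, with $|F(x)-\sum_{k=1}^{N_*}F_k(x)|=\mathcal O(|x|^\beta)$ as $x\to0$ for all $\beta>\beta_{N_*}$. (3) $f\in C([T,\infty),\mathbb R^n)$, $T\ge0$, $m_*\in\mathbb Z_+$, and either (f1): there are positive, strictly increasing, divergent $(\gamma_k)_{k\ge1}$, integers $\widetilde n_k\in\mathbb N\cap[m_*,\infty)$ and $p_k\in\mathscr P_{m_*}(\widetilde n_k,-\gamma_k,\mathbb C^n,\mathbb R^n)$ such that for every $N$ there is $\mu>\gamma_N$ with $|f(t)-\sum_{k=1}^Np_k(\widehat{\mathcal L}_{\widetilde n_k}(t))|=\mathcal O(L_{m_*}(t)^{-\mu})$; or (f2): there are $K\in\mathbb N$, $0<\gamma_1<\dots<\gamma_K$, $n_*\in\mathbb N\cap[m_*,\infty)$ and $p_k\in\mathscr P_{m_*}(n_*,-\gamma_k,\mathbb C^n,\mathbb R^n)$, $1\le k\le K$, with $|f(t)-\sum_{k=1}^Kp_k(\widehat{\mathcal L}_{n_*}(t))|=\mathcal O(L_{m_*}(t)^{-\mu})$ for all $\mu>\gamma_K$. (4) With $n_k=\max\{\widetilde n_j:1\le j\le k\}$ in case (f1) and $n_k=n_*$ in case (f2) ($k\in\mathbb N$), $p_1(z)=p_0(z)z_{m_*}^{-\gamma_1}\xi_0$ with $p_0\in\mathscr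 P^+_{m_*}(n_1)$, $\xi_0\in\mathbb R^n\setminus\{0\}$. Exponents: $\widetilde\beta_j=\beta_j-1$. $\widetilde{\mathcal S}$ is the set of all numbers $\sum_k m_k(\gamma_k-\gamma_1)+\sum_j\ell_j\widetilde\beta_j\gamma_1+(1-\operatorname{sgn}(m_* ))\kappa$ with $m_k,\ell_j,\kappa\in\mathbb Z_+$, only finitely many $m_k,\ell_j$ nonzero, where $k$ ranges over $\mathbb N$ in case (f1) and over $1,\dots,K$ in case (f2), and $j$ ranges over $\mathbb N$ in case (H1) and over $1,\dots,N_*$ in case (H2). Arrange $\widetilde{\mathcal S}$ as a strictly increasing sequence $(\widetilde\mu_k)_{k\ge1}$ (so $\widetilde\mu_1=0$) and set $\mu_k=\widetilde\mu_k+\gamma_1$ (so $\mu_1=\gamma_1$, and every $\gamma_\ell$ is some $\mu_k$). Re-indexing of the forcing: from now on $p_k$ denotes the original $p_\ell$ if $\mu_k=\gamma_\ell$ for some $\ell$, and $p_k=0$ otherwise; thus $p_k\in\mathscr P_{m_*}(n_k,-\mu_k,\mathbb C^n,\mathbb R^n)$ and $f(t)\sim\sum_{k=1}^\infty p_k(\widehat{\mathcal L}_{n_k}(t))$ (for each $N$ there is $\mu>\mu_N$ such that the error of the $N$-th partial sum is $\mathcal O(L_{m_*}(t)^{-\mu})$); $p_1$ is unchanged. Operators, for $p(z,\zeta)=\sum_{(\alpha,\beta)\in S}z^\alpha\zeta^\beta\xi_{\alpha,\beta}$: $\mathcal M_jp=\sum\alpha_jz^\alpha\zeta^\beta\xi_{\alpha,\beta}$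 ($-1\le j\le k$); $\mathcal Rp=\sum_{j=0}^kz_0^{-1}z_1^{-1}\cdots z_j^{-1}\mathcal M_jp$; and, when $\operatorname{Re}\alpha_{-1}=0$ for all $(\alpha,\beta)\in S$, $\mathcal Z_Ap=\sum z^\alpha\zeta^\beta(A+\alpha_{-1}I_n)^{-1}\xi_{\alpha,\beta}$. They apply likewise to functions of $z$ only. Construction: $\zeta_*=p_0$, $\xi_*=A^{-1}\xi_0\neq0$. For $r\ge1$ let $\mathcal F_{r,0}=F_r(\xi_* )$ and, for $m\ge1$, $\mathcal F_{r,m}=\frac1{m!}D^mF_r(\xi_* )$, an $m$-linear map $(\mathbb R^n)^m\to\mathbb R^n$. Let $q_1(z,\zeta)=\zeta_*(z)z_{m_*}^{-\gamma_1}\xi_*$ and $\chi_1=0$. For $k\ge2$, given $q_1,\dots,q_{k-1}$: if $m_*\ge1$, $\chi_k=0$; if $m_*=0$, $\chi_k=\mathcal Rq_\lambda+(\mathcal R\zeta_* )\,\partial q_\lambda/\partial\zeta$ if there is $\lambda\le k-1$ with $\mu_\lambda+1=\mu_k$, and $\chi_k=0$ otherwise. Set $$\mathcal Q_k(z,\zeta)=\sum_{r}\sum_{m=0}^\infty\ \sum_{\substack{k_1,\dots,k_m\ge2\\ \sum_{j=1}^m\mu_{k_j}+(\beta_r-m)\mu_1=\mu_k}}(z_{m_*}^{-\mu_1}\zeta)^{\beta_r-m}\,\mathcal F_{r,m}(q_{k_1}(z,\zeta),\dots,q_{k_m}(z,\zeta)),$$ with $r$ ranging over $\mathbb N$ in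 case (H1) and $1\le r\le N_*$ in case (H2) (the $m=0$ term is $(z_{m_*}^{-\mu_1}\zeta)^{\beta_r}F_r(\xi_* )$ if $\beta_r\mu_1=\mu_k$ and absent otherwise; only finitely many terms occur and they involve only $k_j\le k-1$), and $$q_k=\mathcal Z_A(\mathcal Q_k+p_k-\chi_k).$$ *)

theory Defs
  imports "HOL-Analysis.Analysis" "HOL-Library.Landau_Symbols"
begin

section \<open>Real data and their complexification\<close>

definition cvec :: "real^'d \<Rightarrow> complex^'d"
  where "cvec v = (\<chi> i. complex_of_real (v $ i))"

definition cmat :: "real^'c^'d \<Rightarrow> complex^'c^'d"
  where "cmat A = (\<chi> i j. complex_of_real (A $ i $ j))"

definition Revec :: "complex^'d \<Rightarrow> real^'d"
  where "Revec v = (\<chi> i. Re (v $ i))"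

definition cnjvec :: "complex^'d \<Rightarrow> complex^'d"
  where "cnjvec v = (\<chi> i. cnj (v $ i))"

definition complex_eigenvalue :: "real^'n^'n \<Rightarrow> complex \<Rightarrow> bool"
  where "complex_eigenvalue A c \<longleftrightarrow> (\<exists>v. v \<noteq> 0 \<and> cmat A *v v = c *s v)"


section \<open>Iterated logarithms\<close>

definition L :: "int \<Rightarrow> real \<Rightarrow> real"
  where "L j t = (if j < 0 then exp t else (ln ^^ nat j) t)"

text \<open>A tuple indexed by \<open>-1, \<dots>, k\<close> is a function on \<^typ>\<open>int\<close>; positions outside
  \<open>{-1..k}\<close> are irrelevant for \<open>z\<close> and hold \<open>0\<close> for exponent vectors.  This makes a function of
  \<open>(z\<^sub>-\<^sub>1, \<dots>, z\<^sub>k)\<close> literally also a function of longer tuples.\<close>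

definition Lhat :: "int \<Rightarrow> real \<Rightarrow> int \<Rightarrow> real"
  where "Lhat k t = (\<lambda>j. if -1 \<le> j \<and> j \<le> k then L j t else 1)"

definition posdom :: "int \<Rightarrow> (int \<Rightarrow> real) set"
  where "posdom k = {z. \<forall>j\<in>{-1..k}. 0 < z j}"


section \<open>Classes of power sums\<close>

type_synonym pexp = "(int \<Rightarrow> complex) \<times> real"

definition zpow :: "int \<Rightarrow> (int \<Rightarrow> real) \<Rightarrow> (int \<Rightarrow> complex) \<Rightarrow> complex"
  where "zpow k z \<alpha> = (\<Prod>j\<in>{-1..k}. complex_of_real (z j) powr \<alpha> j)"

definition power_sum ::
  "int \<Rightarrow> pexp set \<Rightarrow> (pexp \<Rightarrow> complex^'d) \<Rightarrow> (int \<Rightarrow> real) \<Rightarrow> real \<Rightarrow> complex^'d"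
  where "power_sum k S \<xi> z \<zeta> =
    (\<Sum>(\<alpha>, \<beta>)\<in>S. (zpow k z \<alpha> * complex_of_real (\<zeta> powr \<beta>)) *s \<xi> (\<alpha>, \<beta>))"

definition power_rep ::
  "int \<Rightarrow> pexp set \<Rightarrow> (pexp \<Rightarrow> complex^'d) \<Rightarrow> ((int \<Rightarrow> real) \<Rightarrow> real \<Rightarrow> real^'d) \<Rightarrow> bool"
  where "power_rep k S \<xi> p \<longleftrightarrow>
    finite S \<and>
    (\<forall>(\<alpha>, \<beta>)\<in>S. \<forall>j. j \<notin> {-1..k} \<longrightarrow> \<alpha> j = 0) \<and>
    (\<forall>(\<alpha>, \<beta>)\<in>S. (cnj \<circ> \<alpha>, \<beta>) \<in> S \<and> \<xi> (cnj \<circ> \<alpha>, \<beta>) = cnjvec (\<xi> (\<alpha>, \<beta>))) \<and>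
    (\<forall>z\<in>posdom k. \<forall>\<zeta>>0. cvec (p z \<zeta>) = power_sum k S \<xi> z \<zeta>)"

definition EC :: "int \<Rightarrow> int \<Rightarrow> real \<Rightarrow> (int \<Rightarrow> complex) set"
  where "EC m k \<mu> = {\<alpha>. (\<forall>j. j \<notin> {-1..k} \<longrightarrow> \<alpha> j = 0) \<and>
    (\<forall>j. -1 \<le> j \<and> j < m \<longrightarrow> Re (\<alpha> j) = 0) \<and> Re (\<alpha> m) = \<mu>}"

definition Phat_m :: "int \<Rightarrow> int \<Rightarrow> real \<Rightarrow> ((int \<Rightarrow> real) \<Rightarrow> real \<Rightarrow> real^'d) set"
  where "Phat_m m k \<mu> = {p. \<exists>S \<xi>. power_rep k S \<xi> p \<and> (\<forall>(\<alpha>, \<beta>)\<in>S. \<alpha> \<in> EC m k \<mu>)}"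

definition P_m :: "int \<Rightarrow> int \<Rightarrow> real \<Rightarrow> ((int \<Rightarrow> real) \<Rightarrow> real^'d) set"
  where "P_m m k \<mu> = {p. \<exists>S \<xi>. power_rep k S \<xi> (\<lambda>z \<zeta>. p z) \<and>
    (\<forall>(\<alpha>, \<beta>)\<in>S. \<alpha> \<in> EC m k \<mu> \<and> \<beta> = 0)}"

definition lex_less :: "int \<Rightarrow> (int \<Rightarrow> real) \<Rightarrow> (int \<Rightarrow> real) \<Rightarrow> bool"
  where "lex_less k a b \<longleftrightarrow> (\<exists>i\<in>{-1..k}. a i < b i \<and> (\<forall>j\<in>{-1..<i}. a j = b j))"

text \<open>A scalar function is treated as a function with values in \<^typ>\<open>real^1\<close>.\<close>

definition lift1 :: "((int \<Rightarrow> real) \<Rightarrow> real) \<Rightarrow> (int \<Rightarrow> real) \<Rightarrow> real \<Rightarrow> real^1"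
  where "lift1 p = (\<lambda>z \<zeta>. vec (p z))"

definition P_plus :: "int \<Rightarrow> int \<Rightarrow> ((int \<Rightarrow> real) \<Rightarrow> real) set"
  where "P_plus m k = {p.
    (\<exists>S \<xi>. power_rep k S \<xi> (lift1 p) \<and>
       (\<forall>(\<alpha>, \<beta>)\<in>S. \<alpha> \<in> EC m k 0 \<and> \<alpha> (-1) = 0 \<and> \<beta> = 0)) \<and>
    (\<exists>c \<alpha>max q S \<xi>. 0 < c \<and> (\<forall>j. j \<notin> {-1..k} \<longrightarrow> \<alpha>max j = 0) \<and>
       power_rep k S \<xi> (lift1 q) \<and>
       (\<forall>(\<alpha>, \<beta>)\<in>S. lex_less k (Re \<circ> \<alpha>) \<alpha>max \<and> \<beta> = 0) \<and>
       (\<forall>z\<in>posdom k. p z = c * (\<Prod>j\<in>{-1..k}. z j powr \<alpha>max j) + q z))}"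


section \<open>Operators on power sums\<close>

text \<open>The nonzero coefficients of a representation are determined by the function, since the
  functions \<open>z\<^sup>\<alpha> \<zeta>\<^sup>\<beta>\<close> are linearly independent; hence it does not matter which representation
  is chosen.  By conjugation symmetry the results of the operators below are real on the domain.\<close>

definition coeff_map ::
  "int \<Rightarrow> ((int \<Rightarrow> complex) \<Rightarrow> complex^'d \<Rightarrow> complex^'d) \<Rightarrow>
   ((int \<Rightarrow> real) \<Rightarrow> real \<Rightarrow> real^'d) \<Rightarrow> (int \<Rightarrow> real) \<Rightarrow> real \<Rightarrow> real^'d"
  where "coeff_map k \<Phi> p = (case (SOME (S, \<xi>). power_rep k S \<xi> p) of (S, \<xi>) \<Rightarrow>
    (\<lambda>z \<zeta>. Revec (power_sum k S (\<lambda>(\<alpha>, \<beta>). \<Phi> \<alpha> (\<xi> (\<alpha>, \<beta>))) z \<zeta>)))"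

definition opM ::
  "int \<Rightarrow> int \<Rightarrow> ((int \<Rightarrow> real) \<Rightarrow> real \<Rightarrow> real^'d) \<Rightarrow> (int \<Rightarrow> real) \<Rightarrow> real \<Rightarrow> real^'d"
  where "opM k j p = coeff_map k (\<lambda>\<alpha> v. \<alpha> j *s v) p"

definition opR ::
  "int \<Rightarrow> ((int \<Rightarrow> real) \<Rightarrow> real \<Rightarrow> real^'d) \<Rightarrow> (int \<Rightarrow> real) \<Rightarrow> real \<Rightarrow> real^'d"
  where "opR k p z \<zeta> = (\<Sum>j\<in>{0..k}. (\<Prod>i\<in>{0..j}. inverse (z i)) *\<^sub>R opM k j p z \<zeta>)"

definition opZ ::
  "real^'n^'n \<Rightarrow> int \<Rightarrow> ((int \<Rightarrow> real) \<Rightarrow> real \<Rightarrow> real^'n) \<Rightarrow> (int \<Rightarrow> real) \<Rightarrow> real \<Rightarrow> real^'n"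
  where "opZ A k p = coeff_map k (\<lambda>\<alpha> v. matrix_inv (cmat A + mat (\<alpha> (-1))) *v v) p"


section \<open>The nonlinearity\<close>

definition locally_lipschitz :: "('a::metric_space \<Rightarrow> 'b::metric_space) \<Rightarrow> bool"
  where "locally_lipschitz F \<longleftrightarrow> (\<forall>x. \<exists>r>0. \<exists>C. C-lipschitz_on (ball x r) F)"

definition pos_homogeneous :: "real \<Rightarrow> ('a::real_vector \<Rightarrow> 'b::real_vector) \<Rightarrow> bool"
  where "pos_homogeneous b G \<longleftrightarrow> (\<forall>x. \<forall>t>0. G (t *\<^sub>R x) = (t powr b) *\<^sub>R G x)"

primrec Ck_on :: "nat \<Rightarrow> 'a::real_normed_vector set \<Rightarrow> ('a \<Rightarrow> 'b::real_normed_vector) \<Rightarrow> bool"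
  where
    "Ck_on 0 U G \<longleftrightarrow> continuous_on U G"
  | "Ck_on (Suc k) U G \<longleftrightarrow> (\<forall>x\<in>U. G differentiable (at x)) \<and>
       (\<forall>v. Ck_on k U (\<lambda>x. frechet_derivative G (at x) v))"

definition smooth_on :: "'a::real_normed_vector set \<Rightarrow> ('a \<Rightarrow> 'b::real_normed_vector) \<Rightarrow> bool"
  where "smooth_on U G \<longleftrightarrow> (\<forall>k. Ck_on k U G)"

text \<open>\<open>Dm G [v\<^sub>1, \<dots>, v\<^sub>m] x = D\<^sup>mG(x)(v\<^sub>1, \<dots>, v\<^sub>m)\<close>\<close>

primrec Dm :: "('a::real_normed_vector \<Rightarrow> 'b::real_normed_vector) \<Rightarrow> 'a list \<Rightarrow> 'a \<Rightarrow> 'b"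
  where
    "Dm G [] x = G x"
  | "Dm G (v # vs) x = frechet_derivative (Dm G vs) (at x) v"

definition F_term :: "real \<Rightarrow> (real^'n \<Rightarrow> real^'n) \<Rightarrow> bool"
  where "F_term b G \<longleftrightarrow> pos_homogeneous b G \<and> smooth_on (UNIV - {0}) G"

text \<open>\<open>J\<close> is the index set of the homogeneous terms.\<close>

definition F_H1 ::
  "(real^'n \<Rightarrow> real^'n) \<Rightarrow> nat set \<Rightarrow> (nat \<Rightarrow> real) \<Rightarrow> (nat \<Rightarrow> real^'n \<Rightarrow> real^'n) \<Rightarrow> bool"
  where "F_H1 F J \<beta> Fs \<longleftrightarrow>
    J = {1..} \<and> (\<forall>k\<in>J. 1 < \<beta> k \<and> F_term (\<beta> k) (Fs k)) \<and>
    strict_mono_on J \<beta> \<and> filterlim \<beta> at_top sequentially \<and>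
    (\<forall>N\<in>J. \<exists>b>\<beta> N.
      (\<lambda>x. norm (F x - (\<Sum>k=1..N. Fs k x))) \<in> O[at 0](\<lambda>x. norm x powr b))"

definition F_H2 ::
  "(real^'n \<Rightarrow> real^'n) \<Rightarrow> nat set \<Rightarrow> (nat \<Rightarrow> real) \<Rightarrow> (nat \<Rightarrow> real^'n \<Rightarrow> real^'n) \<Rightarrow> bool"
  where "F_H2 F J \<beta> Fs \<longleftrightarrow> (\<exists>Ns\<ge>1.
    J = {1..Ns} \<and> (\<forall>k\<in>J. 1 < \<beta> k \<and> F_term (\<beta> k) (Fs k)) \<and> strict_mono_on J \<beta> \<and>
    (\<forall>b>\<beta> Ns.
      (\<lambda>x. norm (F x - (\<Sum>k=1..Ns. Fs k x))) \<in> O[at 0](\<lambda>x. norm x powr b)))"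


section \<open>The forcing\<close>

text \<open>\<open>I\<close> is the index set of the expansion of the forcing and \<open>n\<close> the sequence of depths \<open>n\<^sub>k\<close>
  (only \<open>k \<ge> 1\<close> matters).\<close>

definition f_f1 ::
  "(real \<Rightarrow> real^'n) \<Rightarrow> nat \<Rightarrow> nat set \<Rightarrow> (nat \<Rightarrow> real) \<Rightarrow> (nat \<Rightarrow> nat) \<Rightarrow>
   (nat \<Rightarrow> (int \<Rightarrow> real) \<Rightarrow> real^'n) \<Rightarrow> bool"
  where "f_f1 f m I \<gamma> n p \<longleftrightarrow> (\<exists>nt :: nat \<Rightarrow> nat.
    I = {1..} \<and> (\<forall>k\<in>I. 0 < \<gamma> k) \<and> strict_mono_on I \<gamma> \<and> filterlim \<gamma> at_top sequentially \<and>
    (\<forall>k\<in>I. 1 \<le> nt k \<and> m \<le> nt k \<and> p k \<in> P_m m (nt k) (- \<gamma> k)) \<and>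
    (\<forall>N\<in>I. \<exists>\<mu>>\<gamma> N.
      (\<lambda>t. norm (f t - (\<Sum>k=1..N. p k (Lhat (nt k) t)))) \<in> O(\<lambda>t. L m t powr - \<mu>)) \<and>
    (\<forall>k\<in>I. n k = Max (nt ` {1..k})))"

definition f_f2 ::
  "(real \<Rightarrow> real^'n) \<Rightarrow> nat \<Rightarrow> nat set \<Rightarrow> (nat \<Rightarrow> real) \<Rightarrow> (nat \<Rightarrow> nat) \<Rightarrow>
   (nat \<Rightarrow> (int \<Rightarrow> real) \<Rightarrow> real^'n) \<Rightarrow> bool"
  where "f_f2 f m I \<gamma> n p \<longleftrightarrow> (\<exists>(K::nat)\<ge>1. \<exists>ns :: nat.
    I = {1..K} \<and> (\<forall>k\<in>I. 0 < \<gamma> k) \<and> strict_mono_on I \<gamma> \<and> 1 \<le> ns \<and> m \<le> ns \<and>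
    (\<forall>k\<in>I. p k \<in> P_m m ns (- \<gamma> k)) \<and>
    (\<forall>\<mu>>\<gamma> K.
      (\<lambda>t. norm (f t - (\<Sum>k=1..K. p k (Lhat ns t)))) \<in> O(\<lambda>t. L m t powr - \<mu>)) \<and>
    (\<forall>k\<ge>1. n k = ns))"


section \<open>Exponents and re-indexing\<close>

definition Stilde ::
  "nat \<Rightarrow> nat set \<Rightarrow> (nat \<Rightarrow> real) \<Rightarrow> nat set \<Rightarrow> (nat \<Rightarrow> real) \<Rightarrow> real set"
  where "Stilde m J \<beta> I \<gamma> = {s. \<exists>(a :: nat \<Rightarrow> nat) (b :: nat \<Rightarrow> nat) (\<kappa> :: nat).
    finite {k. a k \<noteq> 0} \<and> {k. a k \<noteq> 0} \<subseteq> I \<and> finite {j. b j \<noteq> 0} \<and> {j. b j \<noteq> 0} \<subseteq> J \<and>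
    s = (\<Sum>k | a k \<noteq> 0. real (a k) * (\<gamma> k - \<gamma> 1))
      + (\<Sum>j | b j \<noteq> 0. real (b j) * (\<beta> j - 1) * \<gamma> 1)
      + (1 - sgn (real m)) * real \<kappa>}"

definition increasing_enum :: "real set \<Rightarrow> nat \<Rightarrow> real"
  where "increasing_enum S = (SOME s. strict_mono_on {1..} s \<and> s ` {1..} = S)"

definition mu ::
  "nat \<Rightarrow> nat set \<Rightarrow> (nat \<Rightarrow> real) \<Rightarrow> nat set \<Rightarrow> (nat \<Rightarrow> real) \<Rightarrow> nat \<Rightarrow> real"
  where "mu m J \<beta> I \<gamma> k = increasing_enum (Stilde m J \<beta> I \<gamma>) k + \<gamma> 1"

definition reindex ::
  "nat set \<Rightarrow> (nat \<Rightarrow> real) \<Rightarrow> (nat \<Rightarrow> real) \<Rightarrow> (nat \<Rightarrow> (int \<Rightarrow> real) \<Rightarrow> real^'n) \<Rightarrow>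
   nat \<Rightarrow> (int \<Rightarrow> real) \<Rightarrow> real^'n"
  where "reindex I \<gamma> \<mu> p k =
    (if \<exists>l\<in>I. \<mu> k = \<gamma> l then p (THE l. l \<in> I \<and> \<mu> k = \<gamma> l) else (\<lambda>z. 0))"


section \<open>The construction\<close>

definition calF :: "(real^'n \<Rightarrow> real^'n) \<Rightarrow> real^'n \<Rightarrow> (real^'n) list \<Rightarrow> real^'n"
  where "calF G x vs = (1 / fact (length vs)) *\<^sub>R Dm G vs x"

definition chi ::
  "nat \<Rightarrow> (nat \<Rightarrow> nat) \<Rightarrow> (nat \<Rightarrow> real) \<Rightarrow> ((int \<Rightarrow> real) \<Rightarrow> real) \<Rightarrow>
   (nat \<Rightarrow> (int \<Rightarrow> real) \<Rightarrow> real \<Rightarrow> real^'n) \<Rightarrow> nat \<Rightarrow> (int \<Rightarrow> real) \<Rightarrow> real \<Rightarrow> real^'n"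
  where "chi m n \<mu> zs q k z \<zeta> =
    (if m = 0 \<and> (\<exists>l\<in>{1..k-1}. \<mu> l + 1 = \<mu> k) then
       (let l = (THE l. l \<in> {1..k-1} \<and> \<mu> l + 1 = \<mu> k) in
         opR (n l) (q l) z \<zeta> +
         (opR (n 1) (lift1 zs) z \<zeta> $ 1) *\<^sub>R vector_derivative (\<lambda>s. q l z s) (at \<zeta>))
     else 0)"

text \<open>The tuples \<open>(k\<^sub>1, \<dots>, k\<^sub>m)\<close>, \<open>m \<ge> 0\<close>, are lists.\<close>

definition calQ ::
  "nat \<Rightarrow> (nat \<Rightarrow> real) \<Rightarrow> nat set \<Rightarrow> (nat \<Rightarrow> real) \<Rightarrow> (nat \<Rightarrow> real^'n \<Rightarrow> real^'n) \<Rightarrow> real^'n \<Rightarrow>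
   (nat \<Rightarrow> (int \<Rightarrow> real) \<Rightarrow> real \<Rightarrow> real^'n) \<Rightarrow> nat \<Rightarrow> (int \<Rightarrow> real) \<Rightarrow> real \<Rightarrow> real^'n"
  where "calQ m \<mu> J \<beta> Fs \<xi>s q k z \<zeta> =
    (\<Sum>(r, ks) \<in> {(r, ks). r \<in> J \<and> (\<forall>j\<in>set ks. 2 \<le> j) \<and>
        sum_list (map \<mu> ks) + (\<beta> r - real (length ks)) * \<mu> 1 = \<mu> k}.
      ((z (int m) powr (- \<mu> 1) * \<zeta>) powr (\<beta> r - real (length ks))) *\<^sub>R
        calF (Fs r) \<xi>s (map (\<lambda>j. q j z \<zeta>) ks))"

text \<open>In step \<open>k\<close> only \<open>q\<^sub>j\<close> with \<open>j < k\<close> occur, because \<open>\<mu>\<close> is strictly increasing,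
  \<open>\<mu> 1 > 0\<close> and all \<open>\<beta> r > 1\<close>; so cutting off the family at \<open>k\<close> changes nothing.
  The exponent \<open>- \<mu> 1\<close> in \<open>q\<^sub>1\<close> is \<open>- \<gamma> 1\<close>.\<close>

function qfun ::
  "real^'n^'n \<Rightarrow> nat \<Rightarrow> (nat \<Rightarrow> nat) \<Rightarrow> (nat \<Rightarrow> real) \<Rightarrow> nat set \<Rightarrow> (nat \<Rightarrow> real) \<Rightarrow>
   (nat \<Rightarrow> real^'n \<Rightarrow> real^'n) \<Rightarrow> (nat \<Rightarrow> (int \<Rightarrow> real) \<Rightarrow> real^'n) \<Rightarrow>
   ((int \<Rightarrow> real) \<Rightarrow> real) \<Rightarrow> real^'n \<Rightarrow> nat \<Rightarrow> (int \<Rightarrow> real) \<Rightarrow> real \<Rightarrow> real^'n"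
  where "qfun A m n \<mu> J \<beta> Fs p p0 \<xi>0 k =
    (let \<xi>s = matrix_inv A *v \<xi>0 in
     if k \<le> 1 then (\<lambda>z \<zeta>. (p0 z * z (int m) powr (- \<mu> 1)) *\<^sub>R \<xi>s)
     else
       (let q = (\<lambda>j. if j < k then qfun A m n \<mu> J \<beta> Fs p p0 \<xi>0 j else (\<lambda>z \<zeta>. 0)) in
        opZ A (n k) (\<lambda>z \<zeta>. calQ m \<mu> J \<beta> Fs \<xi>s q k z \<zeta> + p k z - chi m n \<mu> p0 q k z \<zeta>)))"
  by auto
termination by (relation "Wellfounded.measure (\<lambda>(A, m, n, \<mu>, J, \<beta>, Fs, p, p0, \<xi>0, k). k)") auto

declare qfun.simps [simp del]

definition Xi :: "(nat \<Rightarrow> nat) \<Rightarrow> ((int \<Rightarrow> real) \<Rightarrow> real) \<Rightarrow> int \<Rightarrow> real \<Rightarrow> (int \<Rightarrow> real) \<times> real"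
  where "Xi n zs k t = (Lhat k t, zs (Lhat (n 1) t))"


section \<open>The differential equation\<close>

definition C1_solution ::
  "real^'n^'n \<Rightarrow> (real^'n \<Rightarrow> real^'n) \<Rightarrow> (real \<Rightarrow> real^'n) \<Rightarrow> real \<Rightarrow> (real \<Rightarrow> real^'n) \<Rightarrow> bool"
  where "C1_solution A F f T0 y \<longleftrightarrow> (\<exists>y'.
    continuous_on {T0..} y' \<and>
    (\<forall>t\<ge>T0. (y has_vector_derivative y' t) (at t within {T0..})) \<and>
    (\<forall>t>T0. y' t + A *v y t = F (y t) + f t))"

end

theory Submission
  imports Defs "HOL-Computational_Algebra.Fundamental_Theorem_Algebra" "HOL-Real_Asymp.Real_Asymp"
begin

text \<open>The partial sum \<open>y\<^sub>N\<close> of the expansion solves the equation up to errors of order beyond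
  \<open>\<mu>\<^sub>N\<close> once \<open>F(y)\<close> is known to that order, and the linear equation \<open>w' = - A w + g\<close> transfers the
  decay of \<open>g\<close> to \<open>w = y - y\<^sub>N\<close>.  The latter needs no matrix exponential: \<open>\<Prod>(A - c) = 0\<close> for a
  list of eigenvalues \<open>c\<close>, and peeling off one factor at a time leaves scalar equations
  \<open>w' = - c w + h\<close>.  Conversely, writing \<open>y = \<rho> (\<xi>\<^sub>* + \<eta>)\<close> with \<open>\<rho> = \<zeta>\<^sub>* L\<^sub>m\<^bsup>-\<mu>\<^sub>1\<^esup>\<close>, homogeneity
  and Taylor's formula at \<open>\<xi>\<^sub>* \<noteq> 0\<close> turn the expansion of \<open>y\<close> up to \<open>\<mu>\<^sub>N\<close> into that of \<open>F(y)\<close> up to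
  \<open>\<mu>\<^bsub>N+1\<^esub>\<close>, because every \<open>F\<^sub>r\<close> has degree greater than one.  That the operators act on power sums independently
  of the chosen representation is the linear independence of characters.\<close>

section \<open>Linear equations with slowly varying forcing\<close>

text \<open>Two obstacles shape the argument. A term of order \<mu>_k is in general bounded by
  L_m^(-\<nu>) only for \<nu> < \<mu>_k, because of the deeper logarithms and of \<zeta>. So every
  estimate has to end strictly beyond \<mu>_N, and each step may spend part of the surplus of the
  previous one. The surplus is regained from the exponents: up to the shift by \<gamma>_1 they form
  a discrete additive semigroup, so an order above \<mu>_N that is itself an exponent is at least
  \<mu>_(N+1). The other obstacle is the time derivative of q_k along the logarithms. Its z_(-1)
  part has the same order as q_k and is inverted together with A, which is possible because the
  exponents at z_(-1) are imaginary. The rest carries a factor 1/t: for m = 0 this shifts the order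
  by one and is compensated by \<chi>, for m > 0 it is smaller than every power of L_m. The linear
  equation loses nothing in the exponent because the logarithmic derivative of L_m^(-\<nu>) tends to
  zero, hence falls below any spectral gap.\<close>

lemma norm_vector_smult: "norm (c *s v) = norm c * norm v" for c :: complex and v :: "complex^'n"
  by (simp add: norm_vec_def norm_mult L2_set_right_distrib)

lemma bounded_bilinear_vector_smult: "bounded_bilinear ((*s) :: complex \<Rightarrow> complex^'n \<Rightarrow> complex^'n)"
proof (rule bounded_bilinear.intro)
  show "\<exists>K. \<forall>a (b :: complex^'n). norm (a *s b) \<le> norm a * norm b * K"
    by (rule exI[of _ 1]) (simp add: norm_vector_smult)
qed (simp_all add: vec_eq_iff algebra_simps)

section \<open>Annihilating products of linear factors\<close>

primrec char_prod :: "complex^'n^'n \<Rightarrow> complex list \<Rightarrow> complex^'n \<Rightarrow> complex^'n"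
  where
    "char_prod M [] v = v"
  | "char_prod M (c # cs) v = char_prod M cs (M *v v - c *s v)"

lemma char_prod_linear:
  "char_prod M cs (v + w) = char_prod M cs v + char_prod M cs w"
  "char_prod M cs (c *s v) = c *s char_prod M cs v"
  "char_prod M cs (v - w) = char_prod M cs v - char_prod M cs w"
proof -
  have *: "M *v (v + w) - c *s (v + w) = (M *v v - c *s v) + (M *v w - c *s w)"
    "M *v (v - w) - c *s (v - w) = (M *v v - c *s v) - (M *v w - c *s w)" for v w c
    by (simp_all add: matrix_vector_right_distrib matrix_vector_mult_diff_distrib
        vector_add_ldistrib vector_ssub_ldistrib)
  show "char_prod M cs (v + w) = char_prod M cs v + char_prod M cs w"
    by (induction cs arbitrary: v w) (simp_all only: char_prod.simps *)
  show "char_prod M cs (v - w) = char_prod M cs v - char_prod M cs w"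
    by (induction cs arbitrary: v w) (simp_all only: char_prod.simps *)
  have "M *v (c *s v) - d *s (c *s v) = c *s (M *v v - d *s v)" for v d
    by (simp add: vector_scalar_commute vector_ssub_ldistrib vector_smult_assoc mult.commute)
  then show "char_prod M cs (c *s v) = c *s char_prod M cs v"
    by (induction cs arbitrary: v) (simp_all only: char_prod.simps)
qed

lemma char_prod_mult: "char_prod M cs (M *v v) = M *v char_prod M cs v"
proof (induction cs arbitrary: v)
  case (Cons c cs)
  have "M *v (M *v v) - c *s (M *v v) = M *v (M *v v - c *s v)"
    by (simp add: matrix_vector_mult_diff_distrib vector_scalar_commute)
  then show ?case using Cons by simp
qed simp

definition poly_apply :: "complex^'n^'n \<Rightarrow> complex poly \<Rightarrow> complex^'n \<Rightarrow> complex^'n"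
  where "poly_apply M p v = (\<Sum>i\<le>degree p. coeff p i *s (((*v) M) ^^ i) v)"

lemma poly_apply_eq:
  assumes "degree p \<le> N"
  shows "poly_apply M p v = (\<Sum>i\<le>N. coeff p i *s (((*v) M) ^^ i) v)"
  unfolding poly_apply_def
  by (rule sum.mono_neutral_left) (use assms in \<open>auto simp: coeff_eq_0\<close>)

lemma mult_funpow_linear:
  "(((*v) M) ^^ i) (v - w) = (((*v) M) ^^ i) v - (((*v) M) ^^ i) w"
  "(((*v) M) ^^ i) (c *s v) = c *s (((*v) M) ^^ i) v" for M :: "complex^'n^'n"
  by (induction i) (simp_all add: matrix_vector_mult_diff_distrib vector_scalar_commute)

lemma poly_apply_root_factor:
  "poly_apply M ([:- c, 1:] * q) v = poly_apply M q (M *v v - c *s v)"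
proof -
  define N where "N = degree q"
  define P where "P i = (((*v) M) ^^ i) v" for i
  have deg: "degree ([:- c, 1:] * q) \<le> Suc N"
    using degree_mult_le[of "[:- c, 1:]" q] by (simp add: N_def)
  have "poly_apply M ([:- c, 1:] * q) v = (\<Sum>i\<le>Suc N. coeff ([:- c, 1:] * q) i *s P i)"
    by (simp only: poly_apply_eq[OF deg] P_def)
  also have "\<dots> = (\<Sum>i\<le>Suc N. (- c * coeff q i) *s P i)
      + (\<Sum>i\<le>Suc N. (case i of 0 \<Rightarrow> 0 | Suc j \<Rightarrow> coeff q j) *s P i)"
    unfolding sum.distrib[symmetric]
    by (rule sum.cong) (auto simp: coeff_pCons vec_eq_iff algebra_simps split: nat.split)
  also have "(\<Sum>i\<le>Suc N. (case i of 0 \<Rightarrow> 0 | Suc j \<Rightarrow> coeff q j) *s P i)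
      = (\<Sum>i\<le>N. coeff q i *s P (Suc i))"
    by (subst sum.atMost_Suc_shift) simp
  also have "(\<Sum>i\<le>Suc N. (- c * coeff q i) *s P i) = (\<Sum>i\<le>N. (- c * coeff q i) *s P i)"
    by (simp add: N_def coeff_eq_0)
  also have "\<dots> + (\<Sum>i\<le>N. coeff q i *s P (Suc i)) =
      (\<Sum>i\<le>N. coeff q i *s (((*v) M) ^^ i) (M *v v - c *s v))"
    unfolding sum.distrib[symmetric]
    by (rule sum.cong) (simp_all add: P_def mult_funpow_linear funpow_swap1[of "(*v) M"]
        vector_ssub_ldistrib vector_smult_assoc vec_eq_iff algebra_simps)
  also have "\<dots> = poly_apply M q (M *v v - c *s v)"
    by (simp add: poly_apply_def N_def)
  finally show ?thesis .
qed

lemma poly_apply_char_prod: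
  assumes "p \<noteq> 0"
  shows "\<exists>cs a. a \<noteq> 0 \<and> (\<forall>v. poly_apply M p v = a *s char_prod M cs v)"
  using assms
proof (induction "degree p" arbitrary: p)
  case 0
  then obtain a where "p = [:a:]" "a \<noteq> 0"
    by (metis degree_eq_zeroE pCons_eq_0_iff)
  then have "\<forall>v. poly_apply M p v = a *s char_prod M [] v"
    by (simp add: poly_apply_def)
  with \<open>a \<noteq> 0\<close> show ?case by blast
next
  case (Suc d)
  have "\<not> constant (poly p)"
    using Suc.hyps(2) by (simp add: constant_degree)
  then obtain c where "poly p c = 0"
    using fundamental_theorem_of_algebra by blast
  then obtain q where q: "p = [:- c, 1:] * q"
    using poly_eq_0_iff_dvd by (metis dvdE)
  with Suc.prems have "q \<noteq> 0" by auto
  moreover have "degree p = Suc (degree q)"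
    using \<open>q \<noteq> 0\<close> unfolding q by (subst degree_mult_eq) auto
  ultimately obtain cs a where "a \<noteq> 0" "\<forall>v. poly_apply M q v = a *s char_prod M cs v"
    using Suc.hyps(1)[of q] Suc.hyps(2) by auto
  then have "\<forall>v. poly_apply M p v = a *s char_prod M (c # cs) v"
    by (simp only: q poly_apply_root_factor char_prod.simps) simp
  with \<open>a \<noteq> 0\<close> show ?case by blast
qed

text \<open>More vectors than the dimension are dependent. A repetition has to be treated apart,
  because dependence of the image set does not see it.\<close>

lemma real_dependence_sequence:
  fixes f :: "nat \<Rightarrow> 'a::euclidean_space"
  shows "\<exists>a N. (\<exists>i\<le>N. a i \<noteq> (0::real)) \<and> (\<Sum>i\<le>N. a i *\<^sub>R f i) = 0"
proof (cases "inj_on f {..DIM('a)}")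
  case True
  let ?D = "DIM('a)"
  have "dependent (f ` {..?D})"
    by (rule dependent_biggerset) (simp add: card_image[OF True])
  then obtain u where u: "\<exists>v\<in>f ` {..?D}. u v \<noteq> 0" "(\<Sum>v\<in>f ` {..?D}. u v *\<^sub>R v) = 0"
    by (auto simp: real_vector.dependent_finite)
  have "(\<Sum>i\<le>?D. u (f i) *\<^sub>R f i) = 0"
    using u(2) by (simp add: sum.reindex[OF True] o_def)
  with u(1) show ?thesis by (intro exI[of _ "\<lambda>i. u (f i)"] exI[of _ ?D]) auto
next
  case False
  then obtain i j where ij: "i \<noteq> j" "f i = f j" by (auto simp: inj_on_def)
  define a where "a k = (if k = i then 1 else if k = j then -1 else (0::real))" for k
  have "(\<Sum>k\<le>max i j. a k *\<^sub>R f k) = (\<Sum>k\<in>{i, j}. a k *\<^sub>R f k)"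
    by (rule sum.mono_neutral_right) (auto simp: a_def)
  also have "\<dots> = 0" using ij by (simp add: a_def)
  finally show ?thesis
    by (intro exI[of _ a] exI[of _ "max i j"] conjI) (auto simp: a_def intro: exI[of _ i])
qed

text \<open>The powers of M lie in a space of finite real dimension, so a nonzero polynomial
  annihilates M; over the complex numbers it splits into linear factors. Its roots need not be
  eigenvalues yet.\<close>

lemma annihilating_list: "\<exists>cs. \<forall>v. char_prod (M :: complex^'n^'n) cs v = 0"
proof -
  define P where "P i = ((\<lambda>X. M ** X) ^^ i) (mat 1)" for i
  have P: "P i *v v = (((*v) M) ^^ i) v" for i v
    by (induction i) (simp_all add: P_def matrix_vector_mul_assoc[symmetric])
  obtain a :: "nat \<Rightarrow> real" and N where a: "\<exists>i\<le>N. a i \<noteq> 0" "(\<Sum>i\<le>N. a i *\<^sub>R P i) = 0"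
    using real_dependence_sequence[of P] by blast
  define p where "p = (\<Sum>i\<le>N. monom (complex_of_real (a i)) i)"
  have cp: "coeff p i = (if i \<le> N then of_real (a i) else 0)" for i
    by (simp add: p_def coeff_sum)
  then have "p \<noteq> 0" using a(1) by (metis coeff_0 of_real_eq_0_iff)
  have "degree p \<le> N" by (rule degree_le) (simp add: cp)
  have "poly_apply M p v = 0" for v
  proof -
    have "poly_apply M p v = (\<Sum>i\<le>N. complex_of_real (a i) *s (P i *v v))"
      by (simp add: poly_apply_eq[OF \<open>degree p \<le> N\<close>] cp P)
    also have "\<dots> = (\<Sum>i\<le>N. a i *\<^sub>R P i) *v v"
    proof (subst vec_eq_iff, intro allI)
      fix l
      have "(\<Sum>i\<le>N. complex_of_real (a i) *s (P i *v v)) $ l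
          = (\<Sum>i\<le>N. \<Sum>j\<in>UNIV. complex_of_real (a i) * (P i $ l $ j * v $ j))"
        by (simp add: matrix_vector_mult_def sum_distrib_left)
      also have "\<dots> = (\<Sum>j\<in>UNIV. \<Sum>i\<le>N. complex_of_real (a i) * (P i $ l $ j * v $ j))"
        by (rule sum.swap)
      also have "\<dots> = ((\<Sum>i\<le>N. a i *\<^sub>R P i) *v v) $ l"
        unfolding matrix_vector_mult_def
        by (simp add: sum_distrib_right) (simp add: scaleR_conv_of_real mult.assoc)
      finally show "(\<Sum>i\<le>N. complex_of_real (a i) *s (P i *v v)) $ l
          = ((\<Sum>i\<le>N. a i *\<^sub>R P i) *v v) $ l" .
    qed
    finally show ?thesis by (simp add: a(2))
  qed
  moreover obtain cs b where "b \<noteq> 0" "\<forall>v. poly_apply M p v = b *s char_prod M cs v"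
    using poly_apply_char_prod[OF \<open>p \<noteq> 0\<close>] by blast
  ultimately show ?thesis by (metis vector_mul_eq_0)
qed

lemma annihilating_eigenvalue_list:
  "\<exists>cs. (\<forall>c\<in>set cs. \<exists>v. v \<noteq> 0 \<and> M *v v = c *s v) \<and> (\<forall>v. char_prod (M :: complex^'n^'n) cs v = 0)"
proof -
  let ?E = "\<lambda>c. \<exists>v. v \<noteq> 0 \<and> M *v v = c *s v"
  have "char_prod M cs v = 0 \<Longrightarrow> char_prod M (filter ?E cs) v = 0" for cs v
  proof (induction cs arbitrary: v)
    case (Cons c cs)
    show ?case
    proof (cases "?E c")
      case True
      with Cons show ?thesis by simp
    next
      case False
      have "M *v char_prod M cs v = c *s char_prod M cs v"
        using Cons.prems by (simp add: char_prod_linear char_prod_mult)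
      with False have "char_prod M cs v = 0" by blast
      from Cons.IH[OF this] show ?thesis by (simp only: filter.simps False if_False)
    qed
  qed simp
  moreover obtain cs where "\<forall>v. char_prod M cs v = 0"
    using annihilating_list by blast
  ultimately have "\<forall>v. char_prod M (filter ?E cs) v = 0" by blast
  moreover have "\<forall>c\<in>set (filter ?E cs). ?E c" by simp
  ultimately show ?thesis by blast
qed

section \<open>Weighted bounds for linear equations\<close>

lemma smult_ode_bound:
  fixes w h :: "real \<Rightarrow> complex^'n"
  assumes le: "t0 \<le> t1" and eta: "0 < \<eta>" "2 * \<eta> \<le> Re c" and K: "0 \<le> K"
    and phi: "\<And>s. s \<in> {t0..t1} \<Longrightarrow> 0 < \<phi> s"
    and dphi: "\<And>s. s \<in> {t0..t1} \<Longrightarrow> (\<phi> has_real_derivative \<phi>' s) (at s)"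
    and slow: "\<And>s. s \<in> {t0..t1} \<Longrightarrow> - \<eta> * \<phi> s \<le> \<phi>' s"
    and w: "continuous_on {t0..t1} w"
    and dw: "\<And>s. t0 < s \<Longrightarrow> s < t1 \<Longrightarrow> (w has_vector_derivative (h s - c *s w s)) (at s)"
    and h: "\<And>s. t0 < s \<Longrightarrow> s < t1 \<Longrightarrow> norm (h s) \<le> K * \<phi> s"
  shows "norm (w t1) \<le> (norm (w t0) / \<phi> t0 + K / \<eta>) * \<phi> t1"
proof (cases "t0 = t1")
  case True
  with phi[of t1] eta K show ?thesis by (simp add: field_simps)
next
  case False
  with le have lt: "t0 < t1" by simp
  define d where "d = Re c"
  \<comment> \<open>For v the equation reads v' = e^(cs) h. The derivative of the majorant \<psi> is
    at least K e^(ds) \<phi>: of the two \<eta> contained in Re c, one pays for the decrease of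
    \<phi>, the other cancels the denominator of \<open>K / \<eta>\<close>.\<close>
  define v where "v s = exp (c * of_real s) *s w s" for s
  define \<psi> where "\<psi> s = K / \<eta> * (exp (d * s) * \<phi> s)" for s
  have norm_exp: "norm (exp (c * of_real s)) = exp (d * s)" for s
    by (simp add: d_def)
  have dexp: "((\<lambda>s. exp (c * of_real s)) has_vector_derivative c * exp (c * of_real s)) (at s within X)" for s X
    by (rule has_vector_derivative_real_field) (auto intro!: derivative_eq_intros)
  have dv: "(v has_vector_derivative exp (c * of_real s) *s h s) (at s)" if "t0 < s" "s < t1" for s
  proof -
    have "(v has_vector_derivative (exp (c * of_real s) *s (h s - c *s w s)
        + (c * exp (c * of_real s)) *s w s)) (at s)"
      unfolding v_def
      by (rule bounded_bilinear.has_vector_derivative[OF bounded_bilinear_vector_smult dexp dw[OF that]])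
    then show ?thesis
      by (simp add: vector_ssub_ldistrib vector_smult_assoc mult.commute)
  qed
  have dpsi: "(\<psi> has_real_derivative K / \<eta> * (exp (d * s) * (d * \<phi> s + \<phi>' s))) (at s)"
    if "s \<in> {t0..t1}" for s
    unfolding \<psi>_def
    by (rule derivative_eq_intros dphi[OF that] refl | simp)+ (simp add: algebra_simps)
  have mono: "exp (d * t0) * \<phi> t0 \<le> exp (d * t1) * \<phi> t1"
  proof (rule DERIV_nonneg_imp_nondecreasing[OF le])
    fix s assume s: "t0 \<le> s" "s \<le> t1"
    have "((\<lambda>s. exp (d * s) * \<phi> s) has_real_derivative (exp (d * s) * (d * \<phi> s + \<phi>' s))) (at s)"
      by (rule derivative_eq_intros dphi refl | simp add: s)+ (simp add: algebra_simps)
    moreover have "0 \<le> d * \<phi> s + \<phi>' s"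
    proof -
      have "\<eta> * \<phi> s \<le> d * \<phi> s"
        using phi[of s] s eta by (intro mult_right_mono) (auto simp: d_def)
      with slow[of s] s show ?thesis by simp
    qed
    ultimately show "\<exists>y. ((\<lambda>s. exp (d * s) * \<phi> s) has_real_derivative y) (at s) \<and> 0 \<le> y"
      by (intro exI[of _ "exp (d * s) * (d * \<phi> s + \<phi>' s)"] conjI) simp_all
  qed
  have "norm (v t1 - v t0) \<le> \<psi> t1 - \<psi> t0"
  proof (rule differentiable_bound_general[OF lt])
    show "continuous_on {t0..t1} v"
      unfolding v_def
      by (intro bounded_bilinear.continuous_on[OF bounded_bilinear_vector_smult] w continuous_intros)
    show "continuous_on {t0..t1} \<psi>"
      by (rule DERIV_continuous_on, rule DERIV_subset[OF dpsi]) auto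
    fix s assume s: "t0 < s" "s < t1"
    show "(v has_vector_derivative exp (c * of_real s) *s h s) (at s)" by (rule dv[OF s])
    show "(\<psi> has_vector_derivative K / \<eta> * (exp (d * s) * (d * \<phi> s + \<phi>' s))) (at s)"
      using dpsi[of s] s by (simp add: has_real_derivative_iff_has_vector_derivative)
    have "\<eta> * \<phi> s \<le> d * \<phi> s + \<phi>' s"
    proof -
      have "2 * \<eta> * \<phi> s \<le> d * \<phi> s"
        using phi[of s] s eta by (intro mult_right_mono) (auto simp: d_def)
      with slow[of s] s show ?thesis by simp
    qed
    then have "K / \<eta> * (\<eta> * \<phi> s) \<le> K / \<eta> * (d * \<phi> s + \<phi>' s)"
      using K eta by (intro mult_left_mono) auto
    then have "norm (h s) \<le> K / \<eta> * (d * \<phi> s + \<phi>' s)"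
      using h[OF s] eta by simp
    then have "exp (d * s) * norm (h s) \<le> exp (d * s) * (K / \<eta> * (d * \<phi> s + \<phi>' s))"
      by (intro mult_left_mono) auto
    then show "norm (exp (c * of_real s) *s h s) \<le> K / \<eta> * (exp (d * s) * (d * \<phi> s + \<phi>' s))"
      by (simp add: norm_vector_smult d_def mult.left_commute)
  qed
  moreover have "0 \<le> \<psi> t0" using K eta phi[of t0] le by (simp add: \<psi>_def)
  ultimately have "norm (v t1) \<le> norm (v t0) + \<psi> t1"
    using norm_triangle_ineq2[of "v t1" "v t0"] by linarith
  moreover have "norm (v s) = exp (d * s) * norm (w s)" for s
    by (simp only: v_def norm_vector_smult norm_exp)
  ultimately have "exp (d * t1) * norm (w t1) \<le> exp (d * t0) * norm (w t0) + \<psi> t1" by simp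
  also have "exp (d * t0) * norm (w t0) = exp (d * t0) * \<phi> t0 * (norm (w t0) / \<phi> t0)"
    using phi[of t0] le by simp
  also have "\<dots> \<le> exp (d * t1) * \<phi> t1 * (norm (w t0) / \<phi> t0)"
    using phi[of t0] le by (intro mult_right_mono mono) auto
  also have "exp (d * t1) * \<phi> t1 * (norm (w t0) / \<phi> t0) + \<psi> t1
      = exp (d * t1) * ((norm (w t0) / \<phi> t0 + K / \<eta>) * \<phi> t1)"
    by (simp add: \<psi>_def algebra_simps)
  finally show ?thesis by simp
qed

text \<open>C is uniform in the interval, the weight, the solution and K. This matters later, when K
  itself contains a multiple of the weighted supremum of the solution.\<close>

definition factored_ode_bound :: "real \<Rightarrow> complex^'n^'n \<Rightarrow> complex list \<Rightarrow> real \<Rightarrow> bool"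
  where "factored_ode_bound \<eta> M cs C \<longleftrightarrow> (\<forall>t0 t1 \<phi> \<phi>' w g K. t0 \<le> t1 \<longrightarrow> 0 \<le> K \<longrightarrow>
    (\<forall>s\<in>{t0..t1}. 0 < \<phi> s \<and> (\<phi> has_real_derivative \<phi>' s) (at s) \<and> - \<eta> * \<phi> s \<le> \<phi>' s) \<longrightarrow>
    continuous_on {t0..t1} w \<longrightarrow>
    (\<forall>s. t0 < s \<and> s < t1 \<longrightarrow> (w has_vector_derivative (g s - M *v w s)) (at s)
        \<and> norm (g s) \<le> K * \<phi> s) \<longrightarrow>
    (\<forall>s\<in>{t0..t1}. char_prod M cs (w s) = 0) \<longrightarrow>
    (\<forall>s\<in>{t0..t1}. norm (w s) \<le> C * (norm (w t0) / \<phi> t0 + K) * \<phi> s))"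

text \<open>\<open>(M - c) w\<close> solves the same equation with forcing \<open>(M - c) g\<close>
  and is annihilated by the shorter list, so it is bounded by induction. Then w satisfies w' = - c w
  + (g - (M - c) w), to which the scalar estimate applies. For the empty list the annihilation
  hypothesis says w = 0.\<close>

lemma char_prod_ode_bound:
  fixes M :: "complex^'n^'n"
  assumes eta: "0 < \<eta>" and "\<forall>c\<in>set cs. 2 * \<eta> \<le> Re c"
  shows "\<exists>C\<ge>0. factored_ode_bound \<eta> M cs C"
  using assms(2)
proof (induction cs)
  case Nil
  show ?case unfolding factored_ode_bound_def by (rule exI[of _ 0]) auto
next
  case (Cons c cs)
  then have "\<forall>c\<in>set cs. 2 * \<eta> \<le> Re c" by simp
  from Cons.IH[OF this] obtain C where C: "0 \<le> C" and C1: "factored_ode_bound \<eta> M cs C"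
    by (elim exE conjE)
  have IH: "\<And>t0 t1 \<phi> \<phi>' w g K s. \<lbrakk>t0 \<le> t1; 0 \<le> K;
    \<forall>s\<in>{t0..t1}. 0 < \<phi> s \<and> (\<phi> has_real_derivative \<phi>' s) (at s) \<and> - \<eta> * \<phi> s \<le> \<phi>' s;
    continuous_on {t0..t1} w;
    \<forall>s. t0 < s \<and> s < t1 \<longrightarrow> (w has_vector_derivative (g s - M *v w s)) (at s) \<and> norm (g s) \<le> K * \<phi> s;
    \<forall>s\<in>{t0..t1}. char_prod M cs (w s) = 0; s \<in> {t0..t1}\<rbrakk> \<Longrightarrow>
    norm (w s) \<le> C * (norm (w t0) / \<phi> t0 + K) * \<phi> s"
    subgoal for t0 t1 \<phi> \<phi>' w g K s
      using C1[unfolded factored_ode_bound_def, THEN spec, of t0, THEN spec, of t1, THEN spec, of \<phi>, THEN spec, of \<phi>',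
        THEN spec, of w, THEN spec, of g, THEN spec, of K] by blast
    done
  define T where "T = (\<lambda>v. M *v v - c *s v)"
  have T: "bounded_linear T"
    unfolding T_def
    by (intro bounded_linear_sub matrix_vector_mul_bounded_linear
        bounded_bilinear.bounded_linear_right[OF bounded_bilinear_vector_smult])
  obtain B where B: "0 < B" "\<And>v. norm (T v) \<le> norm v * B"
    using bounded_linear.pos_bounded[OF T] by blast
  \<comment> \<open>The scalar estimate is applied with \<open>C * B * (W + K) + K\<close> in place
    of K, where W is the weighted initial value; C' collects the factor of
    \<open>W + K\<close>.\<close>
  define C' where "C' = 1 + (C * B + 1) / \<eta>"
  show ?case
    unfolding factored_ode_bound_def
  proof (intro exI[of _ C'] conjI allI impI)
    show "0 \<le> C'" using C B eta by (simp add: C'_def)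
    fix t0 t1 :: real and \<phi> \<phi>' w g K
    assume le: "t0 \<le> t1" and K: "0 \<le> K"
      and phi: "\<forall>s\<in>{t0..t1}. 0 < \<phi> s \<and> (\<phi> has_real_derivative \<phi>' s) (at s) \<and> - \<eta> * \<phi> s \<le> \<phi>' s"
      and w: "continuous_on {t0..t1} w"
      and dw: "\<forall>s. t0 < s \<and> s < t1 \<longrightarrow> (w has_vector_derivative (g s - M *v w s)) (at s)
        \<and> norm (g s) \<le> K * \<phi> s"
      and cp: "\<forall>s\<in>{t0..t1}. char_prod M (c # cs) (w s) = 0"
    have T_comm: "T (M *v v) = M *v T v" for v
      by (simp add: T_def matrix_vector_mult_diff_distrib vector_scalar_commute)
    have Tw: "norm (T (w s)) \<le> C * (norm (T (w t0)) / \<phi> t0 + K * B) * \<phi> s" if "s \<in> {t0..t1}" for s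
    proof (rule IH[of t0 t1 _ \<phi> \<phi>' _ "\<lambda>s. T (g s)"])
      show "continuous_on {t0..t1} (\<lambda>s. T (w s))"
        by (rule bounded_linear.continuous_on[OF T w])
      show "\<forall>s. t0 < s \<and> s < t1 \<longrightarrow> ((\<lambda>s. T (w s)) has_vector_derivative T (g s) - M *v T (w s)) (at s)
          \<and> norm (T (g s)) \<le> K * B * \<phi> s"
      proof (intro allI impI conjI)
        fix s assume s: "t0 < s \<and> s < t1"
        then have "(w has_vector_derivative (g s - M *v w s)) (at s)" using dw by blast
        from bounded_linear.has_vector_derivative[OF T this]
        show "((\<lambda>s. T (w s)) has_vector_derivative T (g s) - M *v T (w s)) (at s)"
          by (simp add: linear_diff[OF bounded_linear.linear[OF T]] T_comm)
        have "norm (T (g s)) \<le> norm (g s) * B" by (rule B)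
        also have "\<dots> \<le> K * \<phi> s * B" using s dw B by (intro mult_right_mono) auto
        finally show "norm (T (g s)) \<le> K * B * \<phi> s" by (simp add: mult_ac)
      qed
      show "\<forall>s\<in>{t0..t1}. char_prod M cs (T (w s)) = 0" using cp by (simp add: T_def)
    qed (use le K B phi that in auto)
    define W where "W = norm (w t0) / \<phi> t0"
    have phi0: "0 < \<phi> t0" using phi le by auto
    have W: "0 \<le> W" using phi0 by (simp add: W_def)
    have Tw': "norm (T (w s)) \<le> C * B * (W + K) * \<phi> s" if s: "s \<in> {t0..t1}" for s
    proof -
      have "norm (T (w t0)) / \<phi> t0 \<le> B * W"
        using B(2)[of "w t0"] phi0 by (simp add: W_def divide_right_mono mult.commute)
      then have "C * (norm (T (w t0)) / \<phi> t0 + K * B) \<le> C * (B * W + K * B)"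
        using C by (intro mult_left_mono) auto
      then have "C * (norm (T (w t0)) / \<phi> t0 + K * B) * \<phi> s \<le> C * (B * W + K * B) * \<phi> s"
        using phi s by (intro mult_right_mono) (auto simp: less_imp_le)
      with Tw[OF s] show ?thesis by (simp add: algebra_simps)
    qed
    have "norm (w s) \<le> (norm (w t0) / \<phi> t0 + (C * B * (W + K) + K) / \<eta>) * \<phi> s"
      if s: "s \<in> {t0..t1}" for s
    proof (rule smult_ode_bound[where h="\<lambda>s. g s - T (w s)" and c=c and \<phi>'=\<phi>'])
      show "0 \<le> C * B * (W + K) + K" using C B W K by auto
      show "continuous_on {t0..s} w" by (rule continuous_on_subset[OF w]) (use s in auto)
      fix r assume r: "t0 < r" "r < s"
      with s dw have "(w has_vector_derivative (g r - M *v w r)) (at r)" by auto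
      then show "(w has_vector_derivative (g r - T (w r) - c *s w r)) (at r)"
        by (simp add: T_def)
      have "norm (g r - T (w r)) \<le> norm (g r) + norm (T (w r))" by (rule norm_triangle_ineq4)
      also have "\<dots> \<le> K * \<phi> r + C * B * (W + K) * \<phi> r"
        using Tw'[of r] r s dw by (intro add_mono) auto
      finally show "norm (g r - T (w r)) \<le> (C * B * (W + K) + K) * \<phi> r"
        by (simp add: algebra_simps)
    qed (use s phi eta Cons.prems in auto)
    moreover have "W + (C * B * (W + K) + K) / \<eta> \<le> C' * (W + K)"
      using eta W K by (simp add: C'_def field_simps)
    ultimately show "\<forall>s\<in>{t0..t1}. norm (w s) \<le> C' * (norm (w t0) / \<phi> t0 + K) * \<phi> s"
      unfolding W_def[symmetric] using phi
      by (intro ballI order_trans[OF _ mult_right_mono[of "W + (C * B * (W + K) + K) / \<eta>" "C' * (W + K)"]])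
        (auto simp: less_imp_le)
  qed
qed

lemma cvec_linear: "bounded_linear (cvec :: real^'n \<Rightarrow> complex^'n)"
proof (rule bounded_linear_intro[where K=1])
  show "norm (cvec v) \<le> norm v * 1" for v :: "real^'n"
    by (simp add: cvec_def norm_vec_def)
qed (simp_all add: cvec_def vec_eq_iff scaleR_conv_of_real[where 'a=complex])

lemma norm_cvec [simp]: "norm (cvec v) = norm v"
  by (simp add: cvec_def norm_vec_def)

lemma cmat_mult_cvec: "cmat A *v cvec v = cvec (A *v v)"
  by (simp add: cvec_def cmat_def matrix_vector_mult_def vec_eq_iff)

definition ode_bound :: "real \<Rightarrow> real^'n^'n \<Rightarrow> real \<Rightarrow> bool"
  where "ode_bound \<eta> A C \<longleftrightarrow> (\<forall>t0 t1 \<phi> \<phi>' w g K. t0 \<le> t1 \<longrightarrow> 0 \<le> K \<longrightarrow>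
    (\<forall>s\<in>{t0..t1}. 0 < \<phi> s \<and> (\<phi> has_real_derivative \<phi>' s) (at s) \<and> - \<eta> * \<phi> s \<le> \<phi>' s) \<longrightarrow>
    (\<forall>s\<in>{t0..t1}. (w has_vector_derivative (g s - A *v w s)) (at s) \<and> norm (g s) \<le> K * \<phi> s) \<longrightarrow>
    (\<forall>s\<in>{t0..t1}. norm (w s) \<le> C * (norm (w t0) / \<phi> t0 + K) * \<phi> s))"

lemma stable_ode_bound:
  fixes A :: "real^'n^'n"
  assumes eig: "\<forall>c. complex_eigenvalue A c \<longrightarrow> 0 < Re c"
  shows "\<exists>\<eta>>0. \<exists>C\<ge>0. ode_bound \<eta> A C"
proof -
  obtain cs where cs: "\<forall>c\<in>set cs. \<exists>v. v \<noteq> 0 \<and> cmat A *v v = c *s v"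
    "\<forall>v. char_prod (cmat A) cs v = 0"
    using annihilating_eigenvalue_list[of "cmat A"] by auto
  have pos: "0 < Re c" if "c \<in> set cs" for c
    using that cs(1) eig by (auto simp: complex_eigenvalue_def)
  \<comment> \<open>The element 1 keeps the minimum defined and positive when the list is
    empty.\<close>
  define \<eta> where "\<eta> = Min (insert 1 (Re ` set cs)) / 2"
  have eta: "0 < \<eta>" using pos by (simp add: \<eta>_def)
  have "\<forall>c\<in>set cs. 2 * \<eta> \<le> Re c" by (auto simp: \<eta>_def)
  from char_prod_ode_bound[OF eta this, of "cmat A"] obtain C where C: "0 \<le> C"
    "factored_ode_bound \<eta> (cmat A) cs C"
    by (elim exE conjE)
  show ?thesis
    unfolding ode_bound_def
  proof (intro exI[of _ \<eta>] exI[of _ C] conjI eta C(1), intro allI impI)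
    fix t0 t1 :: real and \<phi> \<phi>' w g K
    assume 1: "t0 \<le> t1" "0 \<le> K"
      "\<forall>s\<in>{t0..t1}. 0 < \<phi> s \<and> (\<phi> has_real_derivative \<phi>' s) (at s) \<and> - \<eta> * \<phi> s \<le> \<phi>' s"
      and 2: "\<forall>s\<in>{t0..t1}. (w has_vector_derivative (g s - A *v w s)) (at s) \<and> norm (g s) \<le> K * \<phi> s"
    have dw: "((\<lambda>s. cvec (w s)) has_vector_derivative (cvec (g s) - cmat A *v cvec (w s))) (at s)"
      if "s \<in> {t0..t1}" for s
      using bounded_linear.has_vector_derivative[OF cvec_linear] 2 that
      by (fastforce simp: cmat_mult_cvec linear_diff[OF bounded_linear.linear[OF cvec_linear]])
    have "continuous_on {t0..t1} (\<lambda>s. cvec (w s))"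
      by (intro continuous_at_imp_continuous_on ballI has_vector_derivative_continuous[OF dw])
    with C(2)[unfolded factored_ode_bound_def, THEN spec, of t0, THEN spec, of t1, THEN spec, of \<phi>, THEN spec, of \<phi>',
        THEN spec, of "\<lambda>s. cvec (w s)", THEN spec, of "\<lambda>s. cvec (g s)", THEN spec, of K] 1 2 dw cs(2)
    show "\<forall>s\<in>{t0..t1}. norm (w s) \<le> C * (norm (w t0) / \<phi> t0 + K) * \<phi> s"
      by simp
  qed
qed

text \<open>The weighted supremum of \<open>w\<close> on a long interval is attained; a small multiple of it on the
  right-hand side of the previous bound can be absorbed.\<close>

lemma perturbed_stable_ode_decay:
  fixes A :: "real^'n^'n" and w g :: "real \<Rightarrow> real^'n"
  assumes eig: "\<forall>c. complex_eigenvalue A c \<longrightarrow> 0 < Re c"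
    and phi: "eventually (\<lambda>s. 0 < \<phi> s \<and> (\<phi> has_real_derivative \<phi>' s) (at s)) at_top"
    and slow: "\<And>\<eta>. 0 < \<eta> \<Longrightarrow> eventually (\<lambda>s. - \<eta> * \<phi> s \<le> \<phi>' s) at_top"
    and dw: "eventually (\<lambda>s. (w has_vector_derivative (g s - A *v w s)) (at s)) at_top"
    and g: "\<And>\<epsilon>. 0 < \<epsilon> \<Longrightarrow> eventually (\<lambda>s. norm (g s) \<le> \<epsilon> * norm (w s) + K * \<phi> s) at_top"
  shows "\<exists>B. eventually (\<lambda>s. norm (w s) \<le> B * \<phi> s) at_top"
proof -
  obtain \<eta> C where eta: "0 < \<eta>" and C: "0 \<le> C" "ode_bound \<eta> A C"
    using stable_ode_bound[of A, OF eig] by (elim exE conjE)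
  \<comment> \<open>This gives \<open>C * \<epsilon> \<le> 1 / 2\<close>, so at most half of the
    supremum appears on the right-hand side; C + 1 instead of C covers C = 0.\<close>
  define \<epsilon> where "\<epsilon> = 1 / (2 * (C + 1))"
  have eps: "0 < \<epsilon>" "C * \<epsilon> \<le> 1 / 2" using C(1) by (simp_all add: \<epsilon>_def field_simps)
  have "eventually (\<lambda>s. (0 < \<phi> s \<and> (\<phi> has_real_derivative \<phi>' s) (at s)) \<and> - \<eta> * \<phi> s \<le> \<phi>' s
      \<and> (w has_vector_derivative (g s - A *v w s)) (at s)
      \<and> norm (g s) \<le> \<epsilon> * norm (w s) + K * \<phi> s) at_top"
    by (intro eventually_conj phi slow dw g eta eps)
  then obtain t0 where t0: "\<And>s. t0 \<le> s \<Longrightarrow> (0 < \<phi> s \<and> (\<phi> has_real_derivative \<phi>' s) (at s))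
      \<and> - \<eta> * \<phi> s \<le> \<phi>' s \<and> (w has_vector_derivative (g s - A *v w s)) (at s)
      \<and> norm (g s) \<le> \<epsilon> * norm (w s) + K * \<phi> s"
    unfolding eventually_at_top_linorder by blast
  define R where "R = norm (w t0) / \<phi> t0"
  define K' where "K' = max K 0"
  have "norm (w t1) \<le> 2 * C * (R + K') * \<phi> t1" if t1: "t0 \<le> t1" for t1
  proof -
    have cont: "continuous_on {t0..t1} (\<lambda>s. norm (w s) / \<phi> s)"
    proof (intro continuous_intros)
      show "continuous_on {t0..t1} w"
        by (intro continuous_at_imp_continuous_on ballI has_vector_derivative_continuous) (use t0 in auto)
      show "continuous_on {t0..t1} \<phi>"
        by (intro continuous_at_imp_continuous_on ballI DERIV_isCont) (use t0 in auto)
    qed (use t0 in force)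
    obtain x where x: "x \<in> {t0..t1}" "\<And>s. s \<in> {t0..t1} \<Longrightarrow> norm (w s) / \<phi> s \<le> norm (w x) / \<phi> x"
      using continuous_attains_sup[OF compact_Icc _ cont] t1 by auto
    define S where "S = norm (w x) / \<phi> x"
    have phx: "0 < \<phi> x" using x(1) t0 by auto
    have S0: "0 \<le> S" using phx by (simp add: S_def)
    have wS: "norm (w s) \<le> S * \<phi> s" if "s \<in> {t0..t1}" for s
      using x(2)[OF that] t0[of s] that by (simp add: S_def[symmetric] pos_divide_le_eq)
    have gS: "norm (g s) \<le> (\<epsilon> * S + K') * \<phi> s" if "s \<in> {t0..t1}" for s
    proof -
      have "norm (g s) \<le> \<epsilon> * norm (w s) + K * \<phi> s" using t0 that by auto
      also have "\<dots> \<le> \<epsilon> * (S * \<phi> s) + K' * \<phi> s"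
        using wS[OF that] eps t0[of s] that
        by (intro add_mono mult_left_mono mult_right_mono) (auto simp: K'_def)
      finally show ?thesis by (simp add: algebra_simps)
    qed
    have "0 \<le> \<epsilon> * S + K'" using eps S0 by (simp add: K'_def)
    with C(2)[unfolded ode_bound_def, THEN spec, of t0, THEN spec, of t1, THEN spec, of \<phi>, THEN spec, of \<phi>',
        THEN spec, of w, THEN spec, of g, THEN spec, of "\<epsilon> * S + K'"] t1 t0 gS x(1)
    have "norm (w x) \<le> C * (R + (\<epsilon> * S + K')) * \<phi> x"
      by (simp add: R_def)
    then have "S \<le> C * (R + (\<epsilon> * S + K'))"
      using phx by (simp add: S_def pos_divide_le_eq)
    also have "\<dots> = C * (R + K') + (C * \<epsilon>) * S" by (simp add: algebra_simps)
    finally have "S \<le> 2 * C * (R + K')"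
      using mult_right_mono[OF eps(2) S0] by linarith
    then have "S * \<phi> t1 \<le> 2 * C * (R + K') * \<phi> t1"
      using t0[OF t1] by (intro mult_right_mono) auto
    with wS[of t1] t1 show ?thesis by simp
  qed
  then show ?thesis
    by (intro exI[of _ "2 * C * (R + K')"] eventually_at_top_linorderI)
qed

section \<open>Power sums as combinations of characters\<close>

lemma posdomD: "z \<in> posdom k \<Longrightarrow> -1 \<le> j \<Longrightarrow> j \<le> k \<Longrightarrow> 0 < z j"
  by (simp add: posdom_def)

lemma posdom_mono: "k \<le> k' \<Longrightarrow> z \<in> posdom k' \<Longrightarrow> z \<in> posdom k"
  by (auto simp: posdom_def)

lemma zpow_exp:
  assumes "z \<in> posdom k"
  shows "zpow k z \<alpha> = exp (\<Sum>j\<in>{-1..k}. \<alpha> j * of_real (ln (z j)))"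
  unfolding zpow_def exp_sum[OF finite_atLeastAtMost_int]
proof (rule prod.cong)
  fix j assume "j \<in> {-1..k}"
  then have "0 < z j" using posdomD[OF assms] by auto
  then show "complex_of_real (z j) powr \<alpha> j = exp (\<alpha> j * complex_of_real (ln (z j)))"
    by (simp add: powr_def Ln_of_real)
qed simp

lemma zpow_mult:
  assumes "z \<in> posdom k" "w \<in> posdom k"
  shows "zpow k (\<lambda>j. z j * w j) \<alpha> = zpow k z \<alpha> * zpow k w \<alpha>"
proof -
  have zw: "(\<lambda>j. z j * w j) \<in> posdom k"
    using assms by (auto simp: posdom_def)
  have "(\<Sum>j\<in>{-1..k}. \<alpha> j * complex_of_real (ln (z j * w j))) =
      (\<Sum>j\<in>{-1..k}. \<alpha> j * of_real (ln (z j))) + (\<Sum>j\<in>{-1..k}. \<alpha> j * of_real (ln (w j)))"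
    unfolding sum.distrib[symmetric]
  proof (rule sum.cong)
    fix j assume "j \<in> {-1..k}"
    then have "0 < z j" "0 < w j" using posdomD assms by auto
    then show "\<alpha> j * complex_of_real (ln (z j * w j))
        = \<alpha> j * of_real (ln (z j)) + \<alpha> j * of_real (ln (w j))"
      by (simp add: ln_mult algebra_simps)
  qed simp
  then show ?thesis
    by (simp add: zpow_exp assms zw exp_add)
qed

lemma zpow_add: "zpow k z (\<lambda>j. \<alpha> j + \<beta> j) = zpow k z \<alpha> * zpow k z \<beta>"
  by (simp add: zpow_def powr_add prod.distrib)

lemma zpow_zero: "z \<in> posdom k \<Longrightarrow> zpow k z (\<lambda>j. 0) = 1"
  by (simp add: zpow_exp)

lemma zpow_cnj: "z \<in> posdom k \<Longrightarrow> cnj (zpow k z \<alpha>) = zpow k z (cnj \<circ> \<alpha>)"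
  by (simp add: zpow_exp exp_cnj)

lemma zpow_deeper:
  assumes "k \<le> k'" "z \<in> posdom k'" "\<And>j. j \<notin> {-1..k} \<Longrightarrow> \<alpha> j = 0"
  shows "zpow k' z \<alpha> = zpow k z \<alpha>"
  unfolding zpow_def
proof (rule prod.mono_neutral_right)
  show "\<forall>i\<in>{-1..k'} - {-1..k}. complex_of_real (z i) powr \<alpha> i = 1"
  proof
    fix i assume i: "i \<in> {-1..k'} - {-1..k}"
    then have "0 < z i" using posdomD[OF assms(2)] by auto
    with i assms(3)[of i] show "complex_of_real (z i) powr \<alpha> i = 1" by simp
  qed
qed (use assms in auto)

lemma zpow_cong: "(\<And>j. j \<in> {-1..k} \<Longrightarrow> z j = w j) \<Longrightarrow> zpow k z \<alpha> = zpow k w \<alpha>"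
  by (simp add: zpow_def)

definition pterm :: "int \<Rightarrow> (int \<Rightarrow> real) \<Rightarrow> real \<Rightarrow> pexp \<Rightarrow> complex"
  where "pterm k z \<zeta> s = zpow k z (fst s) * of_real (\<zeta> powr snd s)"

lemma power_sum_pterm: "power_sum k S \<xi> z \<zeta> = (\<Sum>s\<in>S. pterm k z \<zeta> s *s \<xi> s)"
  by (simp add: power_sum_def pterm_def case_prod_beta)

section \<open>Linear independence of the monomials\<close>

lemma exp_separates:
  fixes d :: complex
  assumes "d \<noteq> 0"
  shows "\<exists>x::real. exp (d * of_real x) \<noteq> 1"
\<comment> \<open>At x = 1/|d| the number d x has modulus one, whereas the nonzero periods of exp
  have modulus at least 2 pi.\<close>
proof (rule exI[of _ "1 / norm d"], rule notI)
  assume *: "exp (d * of_real (1 / norm d)) = 1"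
  then have "Re d = 0" using assms by (auto simp: exp_eq_1)
  from * obtain n :: int where n: "Im d / norm d = of_int (2 * n) * pi"
    by (auto simp: exp_eq_1)
  have "\<bar>Im d / norm d\<bar> \<le> 1" using assms abs_Im_le_cmod[of d] by simp
  then have "\<bar>real_of_int (2 * n)\<bar> * pi \<le> 1" by (simp add: n abs_mult)
  moreover have "1 * pi \<le> \<bar>real_of_int (2 * n)\<bar> * pi" if "n \<noteq> 0"
    using that pi_gt_zero by (intro mult_right_mono) linarith+
  ultimately have "n = 0" using pi_gt3 by linarith
  with n assms have "Im d = 0" by simp
  with \<open>Re d = 0\<close> assms show False by (simp add: complex_eq_iff)
qed

text \<open>One coordinate different from 1 is enough: \<zeta> = e if the exponents differ in
  \<zeta>, otherwise z_j = e^x at a position j where they differ. The support condition guarantees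
  that such a position lies in the range of the product.\<close>

lemma pterm_separates:
  assumes "s \<noteq> s'" and "\<And>j. j \<notin> {-1..k} \<Longrightarrow> fst s j = 0" "\<And>j. j \<notin> {-1..k} \<Longrightarrow> fst s' j = 0"
  shows "\<exists>z\<in>posdom k. \<exists>\<zeta>>0. pterm k z \<zeta> s \<noteq> pterm k z \<zeta> s'"
proof (cases "fst s = fst s'")
  case True
  with assms(1) have "snd s \<noteq> snd s'" by (simp add: prod_eq_iff)
  then have "exp 1 powr snd s \<noteq> exp 1 powr snd s'" by (simp add: powr_def)
  moreover have "(\<lambda>_. 1) \<in> posdom k" by (simp add: posdom_def)
  moreover have "zpow k (\<lambda>_. 1) \<alpha> = 1" for \<alpha> by (simp add: zpow_def)
  ultimately show ?thesis
    unfolding pterm_def by (intro bexI[of _ "\<lambda>_. 1"] exI[of _ "exp 1"]) auto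
next
  case False
  then obtain j where j: "fst s j \<noteq> fst s' j" by auto
  with assms have jk: "j \<in> {-1..k}" by metis
  from j exp_separates[of "fst s j - fst s' j"]
  obtain x :: real where x: "exp ((fst s j - fst s' j) * of_real x) \<noteq> 1" by auto
  define z where "z = (\<lambda>i::int. if i = j then exp x else 1)"
  have z: "z \<in> posdom k" by (simp add: posdom_def z_def)
  have "(\<Sum>i\<in>{-1..k}. \<alpha> i * complex_of_real (ln (z i)))
      = (\<Sum>i\<in>{-1..k}. if i = j then \<alpha> i * of_real x else 0)" for \<alpha>
    by (rule sum.cong) (auto simp: z_def)
  then have "zpow k z \<alpha> = exp (\<alpha> j * of_real x)" for \<alpha>
    using jk by (simp add: zpow_exp[OF z])
  with x have "pterm k z 1 s \<noteq> pterm k z 1 s'"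
    by (simp add: pterm_def algebra_simps exp_diff)
  with z show ?thesis by (intro bexI[of _ z] exI[of _ 1]) auto
qed

text \<open>Dedekind's argument: the functions \<open>z\<^sup>\<alpha> \<zeta>\<^sup>\<beta>\<close> are distinct characters of a multiplicative
  group.\<close>

lemma pterm_independent:
  fixes \<xi> :: "pexp \<Rightarrow> complex^'d"
  assumes "finite S" and "\<And>s j. s \<in> S \<Longrightarrow> j \<notin> {-1..k} \<Longrightarrow> fst s j = 0"
    and "\<And>z \<zeta>. z \<in> posdom k \<Longrightarrow> 0 < \<zeta> \<Longrightarrow> (\<Sum>s\<in>S. pterm k z \<zeta> s *s \<xi> s) = 0"
    and "s \<in> S"
  shows "\<xi> s = 0"
  using assms
proof (induction S arbitrary: \<xi> s rule: finite_induct)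
  case (insert s0 S)
  have zero: "pterm k z \<zeta> s0 *s \<xi> s0 + (\<Sum>s\<in>S. pterm k z \<zeta> s *s \<xi> s) = 0"
    if "z \<in> posdom k" "0 < \<zeta>" for z \<zeta>
    using insert.prems(2)[OF that] insert.hyps by simp
  have mult: "pterm k (\<lambda>j. z j * w j) (\<zeta> * \<omega>) s = pterm k z \<zeta> s * pterm k w \<omega> s"
    if "z \<in> posdom k" "w \<in> posdom k" "0 < \<zeta>" "0 < \<omega>" for z w \<zeta> \<omega> s
    using that by (simp add: pterm_def zpow_mult powr_mult)
  have dom: "(\<lambda>j. z j * w j) \<in> posdom k" if "z \<in> posdom k" "w \<in> posdom k" for z w
    using that by (simp add: posdom_def)
  have S0: "\<xi> s = 0" if s: "s \<in> S" for s
  proof -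
    have "s \<noteq> s0" using s insert.hyps by auto
    then obtain w \<omega> where w: "w \<in> posdom k" "0 < \<omega>" "pterm k w \<omega> s \<noteq> pterm k w \<omega> s0"
      using pterm_separates[of s s0 k] insert.prems(1) s by blast
    \<comment> \<open>Subtracting the relation at z, multiplied by the value of the character s0 at
      w, from the relation at the product of w and z cancels the term of s0. What remains is a
      relation over S with these coefficients.\<close>
    have "(pterm k w \<omega> s - pterm k w \<omega> s0) *s \<xi> s = 0"
    proof (rule insert.IH)
      fix z \<zeta> assume z: "z \<in> posdom k" "0 < (\<zeta>::real)"
      have "pterm k z \<zeta> s0 *s \<xi> s0 = - (\<Sum>s\<in>S. pterm k z \<zeta> s *s \<xi> s)"
        using zero[OF z] by (simp add: eq_neg_iff_add_eq_0)
      moreover have "(pterm k w \<omega> s0 * pterm k z \<zeta> s0) *s \<xi> s0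
          = - (\<Sum>s\<in>S. (pterm k w \<omega> s * pterm k z \<zeta> s) *s \<xi> s)"
        using zero[OF dom[OF w(1) z(1)], of "\<omega> * \<zeta>"] w z
        by (simp add: mult[OF w(1) z(1) w(2) z(2)] eq_neg_iff_add_eq_0)
      ultimately have "(\<Sum>s\<in>S. (pterm k w \<omega> s * pterm k z \<zeta> s) *s \<xi> s)
          = pterm k w \<omega> s0 *s (\<Sum>s\<in>S. pterm k z \<zeta> s *s \<xi> s)"
        by (metis (no_types, lifting) neg_equal_iff_equal vector_smult_assoc vector_smult_rneg)
      then have "(\<Sum>s\<in>S. (pterm k w \<omega> s * pterm k z \<zeta> s) *s \<xi> s)
          - (\<Sum>s\<in>S. pterm k w \<omega> s0 *s (pterm k z \<zeta> s *s \<xi> s)) = 0"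
        by (simp add: vec.scale_sum_right)
      then show "(\<Sum>s\<in>S. pterm k z \<zeta> s *s ((pterm k w \<omega> s - pterm k w \<omega> s0) *s \<xi> s)) = 0"
        unfolding sum_subtractf[symmetric]
        by (simp add: vector_smult_assoc algebra_simps vec.scale_left_diff_distrib)
    qed (use insert.prems(1) s in auto)
    with w(3) show ?thesis by (simp add: vector_mul_eq_0)
  qed
  show ?case
  proof (cases "s = s0")
    case True
    have one: "(\<lambda>_. 1) \<in> posdom k" by (simp add: posdom_def)
    have "pterm k (\<lambda>_. 1) 1 s0 = 1" by (simp add: pterm_def zpow_def)
    with zero[OF one, of 1] S0 True show ?thesis by simp
  next
    case False
    with S0 insert.prems show ?thesis by auto
  qed
qed simp

text \<open>Padding by zero makes representations over different index sets comparable; uniqueness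
  of coefficients becomes equality of padded functions.\<close>

definition extend :: "pexp set \<Rightarrow> (pexp \<Rightarrow> complex^'d) \<Rightarrow> pexp \<Rightarrow> complex^'d"
  where "extend S \<xi> s = (if s \<in> S then \<xi> s else 0)"

lemma power_sum_extend:
  assumes "finite S'" "S \<subseteq> S'"
  shows "power_sum k S \<xi> z \<zeta> = (\<Sum>s\<in>S'. pterm k z \<zeta> s *s extend S \<xi> s)"
proof -
  have "power_sum k S \<xi> z \<zeta> = (\<Sum>s\<in>S. pterm k z \<zeta> s *s extend S \<xi> s)"
    by (simp add: power_sum_pterm extend_def)
  also have "\<dots> = (\<Sum>s\<in>S'. pterm k z \<zeta> s *s extend S \<xi> s)"
    by (rule sum.mono_neutral_left) (use assms in \<open>auto simp: extend_def\<close>)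
  finally show ?thesis .
qed

lemma power_sum_unique:
  assumes fin: "finite S" "finite S'"
    and supp: "\<And>s j. s \<in> S \<union> S' \<Longrightarrow> j \<notin> {-1..k} \<Longrightarrow> fst s j = 0"
    and eq: "\<And>z \<zeta>. z \<in> posdom k \<Longrightarrow> 0 < \<zeta> \<Longrightarrow> power_sum k S \<xi> z \<zeta> = power_sum k S' \<xi>' z \<zeta>"
  shows "extend S \<xi> = extend S' \<xi>'"
proof
  fix s
  show "extend S \<xi> s = extend S' \<xi>' s"
  proof (cases "s \<in> S \<union> S'")
    case True
    have "extend S \<xi> s - extend S' \<xi>' s = 0"
    proof (rule pterm_independent[OF _ supp _ True])
      fix z \<zeta> assume z: "z \<in> posdom k" "0 < (\<zeta>::real)"
      show "(\<Sum>s\<in>S \<union> S'. pterm k z \<zeta> s *s (extend S \<xi> s - extend S' \<xi>' s)) = 0"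
        using eq[OF z] power_sum_extend[of "S \<union> S'" S k \<xi> z \<zeta>] power_sum_extend[of "S \<union> S'" S' k \<xi>' z \<zeta>] fin
        by (simp add: vector_ssub_ldistrib sum_subtractf)
    qed (use fin in auto)
    then show ?thesis by simp
  qed (simp add: extend_def)
qed

section \<open>Conjugation-symmetric representations\<close>

lemma power_repD:
  assumes "power_rep k S \<xi> p"
  shows "finite S" "s \<in> S \<Longrightarrow> j \<notin> {-1..k} \<Longrightarrow> fst s j = 0"
    "s \<in> S \<Longrightarrow> (cnj \<circ> fst s, snd s) \<in> S"
    "s \<in> S \<Longrightarrow> \<xi> (cnj \<circ> fst s, snd s) = cnjvec (\<xi> s)"
    "z \<in> posdom k \<Longrightarrow> 0 < \<zeta> \<Longrightarrow> cvec (p z \<zeta>) = power_sum k S \<xi> z \<zeta>"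
  using assms by (auto simp: power_rep_def case_prod_beta)

lemma cnjvec_simps:
  "cnjvec (v + w) = cnjvec v + cnjvec w" "cnjvec (c *s v) = cnj c *s cnjvec v"
  "cnjvec (0 :: complex^'d) = 0" "cnjvec (cnjvec v) = v" "cnjvec (cvec x) = cvec x"
  by (simp_all add: cnjvec_def cvec_def vec_eq_iff)

lemma cnjvec_sum: "cnjvec (\<Sum>s\<in>S. f s) = (\<Sum>s\<in>S. cnjvec (f s))"
  by (induction S rule: infinite_finite_induct) (simp_all add: cnjvec_simps)

lemma cvec_Revec: "cnjvec v = v \<Longrightarrow> cvec (Revec v) = v"
  by (auto simp: cnjvec_def cvec_def Revec_def vec_eq_iff complex_eq_iff)

lemma Revec_cvec [simp]: "Revec (cvec v) = v"
  by (simp add: cvec_def Revec_def)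

lemma cvec_inject: "cvec x = cvec y \<longleftrightarrow> x = y"
  by (metis Revec_cvec)

lemma pterm_cnj: "z \<in> posdom k \<Longrightarrow> cnj (pterm k z \<zeta> s) = pterm k z \<zeta> (cnj \<circ> fst s, snd s)"
  by (simp add: pterm_def zpow_cnj)

lemma bij_betw_cnj_exponents:
  assumes "\<And>s. s \<in> S \<Longrightarrow> (cnj \<circ> fst s, snd s) \<in> S"
  shows "bij_betw (\<lambda>s. (cnj \<circ> fst s, snd s)) S S"
  by (rule bij_betw_byWitness[where f'="\<lambda>s. (cnj \<circ> fst s, snd s)"])
    (use assms in \<open>auto simp: o_def\<close>)

lemma cnjvec_power_sum:
  assumes z: "z \<in> posdom k" and S: "\<And>s. s \<in> S \<Longrightarrow> (cnj \<circ> fst s, snd s) \<in> S"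
    and \<xi>: "\<And>s. s \<in> S \<Longrightarrow> \<xi> (cnj \<circ> fst s, snd s) = cnjvec (\<xi> s)"
  shows "cnjvec (power_sum k S \<xi> z \<zeta>) = power_sum k S \<xi> z \<zeta>"
proof -
  have "cnjvec (power_sum k S \<xi> z \<zeta>)
      = (\<Sum>s\<in>S. pterm k z \<zeta> (cnj \<circ> fst s, snd s) *s \<xi> (cnj \<circ> fst s, snd s))"
    by (simp add: power_sum_pterm cnjvec_sum cnjvec_simps pterm_cnj[OF z] \<xi>)
  also have "\<dots> = (\<Sum>s\<in>S. pterm k z \<zeta> s *s \<xi> s)"
    by (rule sum.reindex_bij_betw[OF bij_betw_cnj_exponents[OF S], where g="\<lambda>s. pterm k z \<zeta> s *s \<xi> s"])
  finally show ?thesis by (simp add: power_sum_pterm)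
qed

text \<open>The choice inside \<open>coeff_map\<close> yields an unknown representation. It has the
  same padded coefficients as the given one, and \<Phi> passes through the padding because it maps 0
  to 0. The compatibility with conjugation makes the result real, so that taking real parts loses
  nothing.\<close>

lemma power_rep_coeff_map:
  assumes rep: "power_rep k S \<xi> p" and \<Phi>0: "\<And>\<alpha>. \<Phi> \<alpha> 0 = 0"
    and conj: "\<And>s v. s \<in> S \<Longrightarrow> \<Phi> (cnj \<circ> fst s) (cnjvec v) = cnjvec (\<Phi> (fst s) v)"
  shows "power_rep k S (\<lambda>(\<alpha>, \<beta>). \<Phi> \<alpha> (\<xi> (\<alpha>, \<beta>))) (coeff_map k \<Phi> p)"
proof -
  obtain S' \<xi>' where some: "(SOME (S, \<xi>). power_rep k S \<xi> p) = (S', \<xi>')"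
    by (metis surj_pair)
  have rep': "power_rep k S' \<xi>' p"
    using someI[of "\<lambda>(S, \<xi>). power_rep k S \<xi> p" "(S, \<xi>)"] rep by (simp add: some)
  note R = power_repD[OF rep] and R' = power_repD[OF rep']
  have ext: "extend S \<xi> = extend S' \<xi>'"
    by (rule power_sum_unique[OF R(1) R'(1)]) (use R(2,5) R'(2,5) in auto)
  have E: "extend S (\<lambda>(\<alpha>, \<beta>). \<Phi> \<alpha> (\<xi> (\<alpha>, \<beta>))) s = \<Phi> (fst s) (extend S \<xi> s)" for S \<xi> and s :: pexp
    by (auto simp: extend_def \<Phi>0 case_prod_beta)
  have map: "coeff_map k \<Phi> p z \<zeta> = Revec (power_sum k S (\<lambda>(\<alpha>, \<beta>). \<Phi> \<alpha> (\<xi> (\<alpha>, \<beta>))) z \<zeta>)" for z \<zeta>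
    unfolding coeff_map_def some prod.case
    using power_sum_extend[of "S \<union> S'" S k "\<lambda>(\<alpha>, \<beta>). \<Phi> \<alpha> (\<xi> (\<alpha>, \<beta>))" z \<zeta>]
      power_sum_extend[of "S \<union> S'" S' k "\<lambda>(\<alpha>, \<beta>). \<Phi> \<alpha> (\<xi>' (\<alpha>, \<beta>))" z \<zeta>] R(1) R'(1)
    by (simp add: E ext)
  have sym: "(\<lambda>(\<alpha>, \<beta>). \<Phi> \<alpha> (\<xi> (\<alpha>, \<beta>))) (cnj \<circ> fst s, snd s)
      = cnjvec ((\<lambda>(\<alpha>, \<beta>). \<Phi> \<alpha> (\<xi> (\<alpha>, \<beta>))) s)" if "s \<in> S" for s
    using that by (simp add: case_prod_beta R(4) conj)
  have cv: "cvec (coeff_map k \<Phi> p z \<zeta>) = power_sum k S (\<lambda>(\<alpha>, \<beta>). \<Phi> \<alpha> (\<xi> (\<alpha>, \<beta>))) z \<zeta>"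
    if "z \<in> posdom k" for z \<zeta>
    unfolding map by (rule cvec_Revec, rule cnjvec_power_sum[OF that R(3)]) (assumption, rule sym)
  show ?thesis
    unfolding power_rep_def
  proof (intro conjI ballI allI impI)
    fix s assume s: "s \<in> S"
    show "case s of (\<alpha>, \<beta>) \<Rightarrow> \<forall>j. j \<notin> {-1..k} \<longrightarrow> \<alpha> j = 0"
      using R(2)[OF s] by (simp add: case_prod_beta)
    show "case s of (\<alpha>, \<beta>) \<Rightarrow> (cnj \<circ> \<alpha>, \<beta>) \<in> S \<and> (\<lambda>(\<alpha>, \<beta>). \<Phi> \<alpha> (\<xi> (\<alpha>, \<beta>))) (cnj \<circ> \<alpha>, \<beta>)
        = cnjvec ((\<lambda>(\<alpha>, \<beta>). \<Phi> \<alpha> (\<xi> (\<alpha>, \<beta>))) (\<alpha>, \<beta>))"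
      using R(3)[OF s] sym[OF s] by (simp add: case_prod_beta)
  qed (use R(1) cv in auto)
qed

text \<open>Membership of complex-valued functions in the class, without record of index sets or
  symmetry, so that sums and products are plain inductions. Exponents may repeat, and each
  constructor admits any function with the right values on the positive domain.\<close>

inductive scalar_sum :: "int \<Rightarrow> int \<Rightarrow> real \<Rightarrow> ((int \<Rightarrow> real) \<Rightarrow> real \<Rightarrow> complex) \<Rightarrow> bool"
  for m k \<mu>
  where
    zero: "(\<And>z \<zeta>. z \<in> posdom k \<Longrightarrow> 0 < \<zeta> \<Longrightarrow> g z \<zeta> = 0) \<Longrightarrow> scalar_sum m k \<mu> g"
  | add: "scalar_sum m k \<mu> g \<Longrightarrow> \<alpha> \<in> EC m k \<mu> \<Longrightarrow>
      (\<And>z \<zeta>. z \<in> posdom k \<Longrightarrow> 0 < \<zeta> \<Longrightarrow> h z \<zeta> = g z \<zeta> + pterm k z \<zeta> (\<alpha>, \<beta>) * c) \<Longrightarrow> scalar_sum m k \<mu> h"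

lemma scalar_sum_cong:
  assumes "scalar_sum m k \<mu> g" and "\<And>z \<zeta>. z \<in> posdom k \<Longrightarrow> 0 < \<zeta> \<Longrightarrow> h z \<zeta> = g z \<zeta>"
  shows "scalar_sum m k \<mu> h"
  using assms(1)
proof cases
  case zero
  then show ?thesis by (intro scalar_sum.zero) (simp add: assms(2))
next
  case (add g \<alpha> \<beta> c)
  show ?thesis
    by (rule scalar_sum.add[where g=g and \<alpha>=\<alpha> and \<beta>=\<beta> and c=c]) (use add in \<open>simp_all add: assms(2)\<close>)
qed

lemma scalar_sum_term: "\<alpha> \<in> EC m k \<mu> \<Longrightarrow> scalar_sum m k \<mu> (\<lambda>z \<zeta>. pterm k z \<zeta> (\<alpha>, \<beta>) * c)"
  by (rule scalar_sum.add[OF scalar_sum.zero[where g="\<lambda>_ _. 0"]]) auto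

lemma scalar_sum_add:
  assumes "scalar_sum m k \<mu> g" "scalar_sum m k \<mu> h"
  shows "scalar_sum m k \<mu> (\<lambda>z \<zeta>. g z \<zeta> + h z \<zeta>)"
  using assms(1)
proof induction
  case (zero g)
  then show ?case by (intro scalar_sum_cong[OF assms(2)]) simp
next
  case (add g \<alpha> h' \<beta> c)
  show ?case
    by (rule scalar_sum.add[where g="\<lambda>z \<zeta>. g z \<zeta> + h z \<zeta>" and \<alpha>=\<alpha> and \<beta>=\<beta> and c=c])
      (use add in \<open>simp_all add: algebra_simps\<close>)
qed

lemma scalar_sum_sum: "(\<And>x. x \<in> X \<Longrightarrow> scalar_sum m k \<mu> (g x)) \<Longrightarrow> scalar_sum m k \<mu> (\<lambda>z \<zeta>. \<Sum>x\<in>X. g x z \<zeta>)"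
  by (induction X rule: infinite_finite_induct) (auto intro: scalar_sum.zero scalar_sum_add)

lemma EC_add:
  "\<alpha> \<in> EC m k \<mu> \<Longrightarrow> \<beta> \<in> EC m k \<nu> \<Longrightarrow> (\<lambda>j. \<alpha> j + \<beta> j) \<in> EC m k (\<mu> + \<nu>)"
  by (simp add: EC_def)

lemma pterm_mult:
  "0 < \<zeta> \<Longrightarrow> pterm k z \<zeta> (\<alpha>, a) * pterm k z \<zeta> (\<beta>, b) = pterm k z \<zeta> (\<lambda>j. \<alpha> j + \<beta> j, a + b)"
  by (simp add: pterm_def zpow_add powr_add)

lemma scalar_sum_mult:
  assumes "scalar_sum m k \<mu> g" "scalar_sum m k \<nu> h"
  shows "scalar_sum m k (\<mu> + \<nu>) (\<lambda>z \<zeta>. g z \<zeta> * h z \<zeta>)"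
  using assms(2)
proof induction
  case (zero h)
  then show ?case by (intro scalar_sum.zero) simp
next
  case (add h \<alpha> h' \<beta> c)
  have "scalar_sum m k (\<mu> + \<nu>) (\<lambda>z \<zeta>. g z \<zeta> * (pterm k z \<zeta> (\<alpha>, \<beta>) * c))"
    using assms(1)
  proof induction
    case (zero g)
    then show ?case by (intro scalar_sum.zero) simp
  next
    case (add g \<alpha>' g' \<beta>' c')
    show ?case
      by (rule scalar_sum.add[where g="\<lambda>z \<zeta>. g z \<zeta> * (pterm k z \<zeta> (\<alpha>, \<beta>) * c)" and c="c' * c"
            and \<alpha>="\<lambda>j. \<alpha>' j + \<alpha> j" and \<beta>="\<beta>' + \<beta>"])
        (use add \<open>\<alpha> \<in> EC m k \<nu>\<close> in \<open>simp_all add: EC_add pterm_mult[symmetric] algebra_simps\<close>)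
  qed
  from scalar_sum_add[OF add.IH this] show ?case
    by (rule scalar_sum_cong) (simp add: add.hyps algebra_simps)
qed

lemma scalar_sum_const: "scalar_sum m k 0 (\<lambda>z \<zeta>. c)"
  by (rule scalar_sum_cong[OF scalar_sum_term[of "\<lambda>_. 0" _ _ _ 0 c]]) (simp_all add: EC_def pterm_def zpow_zero)

lemma scalar_sum_subset:
  assumes "scalar_sum m k \<mu> g" "EC m k \<mu> \<subseteq> EC m' k \<mu>'"
  shows "scalar_sum m' k \<mu>' g"
  using assms(1) by induction (use assms(2) in \<open>auto intro: scalar_sum.zero scalar_sum.add\<close>)

lemma EC_deeper: "k \<le> k' \<Longrightarrow> \<alpha> \<in> EC m k \<mu> \<Longrightarrow> \<alpha> \<in> EC m k' \<mu>"
  by (auto simp: EC_def)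

lemma pterm_deeper:
  "k \<le> k' \<Longrightarrow> z \<in> posdom k' \<Longrightarrow> \<alpha> \<in> EC m k \<mu> \<Longrightarrow> pterm k' z \<zeta> (\<alpha>, \<beta>) = pterm k z \<zeta> (\<alpha>, \<beta>)"
  using zpow_deeper[of k k' z \<alpha>] by (auto simp: pterm_def EC_def)

lemma scalar_sum_deeper:
  assumes "scalar_sum m k \<mu> g" "k \<le> k'"
  shows "scalar_sum m k' \<mu> g"
  using assms(1)
proof induction
  case (zero g)
  then show ?case using assms(2) by (intro scalar_sum.zero) (auto dest: posdom_mono)
next
  case (add g \<alpha> h \<beta> c)
  show ?case
    by (rule scalar_sum.add[where g=g and \<alpha>=\<alpha> and \<beta>=\<beta> and c=c])
      (use add assms(2) in \<open>auto simp: pterm_deeper dest: posdom_mono EC_deeper\<close>)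
qed

lemma scalar_sum_zeta: "scalar_sum m k 0 (\<lambda>z \<zeta>. of_real (\<zeta> powr b))"
  by (rule scalar_sum_cong[OF scalar_sum_term[of "\<lambda>_. 0" _ _ _ b 1]]) (simp_all add: EC_def pterm_def zpow_zero)

lemma scalar_sum_monomial:
  assumes "-1 \<le> m" "m \<le> k"
  shows "scalar_sum m k a (\<lambda>z \<zeta>. of_real (z m powr a))"
proof (rule scalar_sum_cong)
  let ?\<alpha> = "\<lambda>j::int. if j = m then of_real a else 0"
  show "scalar_sum m k a (\<lambda>z \<zeta>. pterm k z \<zeta> (?\<alpha>, 0) * 1)"
    by (rule scalar_sum_term) (use assms in \<open>auto simp: EC_def\<close>)
  fix z :: "int \<Rightarrow> real" and \<zeta> :: real
  assume z: "z \<in> posdom k" and \<zeta>: "0 < \<zeta>"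
  have zm: "0 < z m" using posdomD[OF z] assms by auto
  have "(\<Sum>j\<in>{-1..k}. ?\<alpha> j * complex_of_real (ln (z j)))
      = (\<Sum>j\<in>{-1..k}. if j = m then of_real a * of_real (ln (z m)) else 0)"
    by (rule sum.cong) auto
  also have "\<dots> = of_real a * of_real (ln (z m))" using assms by simp
  finally have "zpow k z ?\<alpha> = exp (of_real (a * ln (z m)))"
    by (simp only: zpow_exp[OF z] of_real_mult)
  also have "\<dots> = of_real (z m powr a)"
    using zm by (simp add: powr_def flip: exp_of_real)
  finally show "complex_of_real (z m powr a) = pterm k z \<zeta> (?\<alpha>, 0) * 1"
    using \<zeta> by (simp add: pterm_def)
qed

lemma scalar_sum_inverse_product:
  assumes "0 \<le> j" "j \<le> k"
  shows "scalar_sum 0 k (-1) (\<lambda>z \<zeta>. of_real (\<Prod>i\<in>{0..j}. inverse (z i)))"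
proof (rule scalar_sum_cong)
  let ?\<alpha> = "\<lambda>i::int. if i \<in> {0..j} then - 1 else (0::complex)"
  show "scalar_sum 0 k (-1) (\<lambda>z \<zeta>. pterm k z \<zeta> (?\<alpha>, 0) * 1)"
    by (rule scalar_sum_term) (use assms in \<open>auto simp: EC_def\<close>)
  fix z :: "int \<Rightarrow> real" and \<zeta> :: real
  assume z: "z \<in> posdom k" and \<zeta>: "0 < \<zeta>"
  have "zpow k z ?\<alpha> = (\<Prod>i\<in>{0..j}. complex_of_real (inverse (z i)))"
    unfolding zpow_def
  proof (rule prod.mono_neutral_cong_right)
    show "\<forall>i\<in>{-1..k} - {0..j}. complex_of_real (z i) powr ?\<alpha> i = 1"
    proof
      fix i assume i: "i \<in> {-1..k} - {0..j}"
      then have "0 < z i" using posdomD[OF z] by auto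
      with i show "complex_of_real (z i) powr ?\<alpha> i = 1" by auto
    qed
    fix i assume i: "i \<in> {0..j}"
    then have "0 < z i" using posdomD[OF z] assms by auto
    with i show "complex_of_real (z i) powr ?\<alpha> i = complex_of_real (inverse (z i))"
      by (simp add: powr_minus)
  qed (use assms in auto)
  then show "complex_of_real (\<Prod>i\<in>{0..j}. inverse (z i)) = pterm k z \<zeta> (?\<alpha>, 0) * 1"
    using \<zeta> by (simp add: pterm_def)
qed

lemma scalar_sum_dzeta:
  assumes "scalar_sum m k \<mu> g"
  shows "\<exists>g'. scalar_sum m k \<mu> g' \<and> (\<forall>z\<in>posdom k. \<forall>\<zeta>>0. ((\<lambda>s. g z s) has_vector_derivative g' z \<zeta>) (at \<zeta>))"
  using assms
proof induction
  case (zero g)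
  show ?case
  proof (intro exI[of _ "\<lambda>_ _. 0"] conjI ballI allI impI)
    fix z and \<zeta> :: real assume z: "z \<in> posdom k" "0 < \<zeta>"
    show "((\<lambda>s. g z s) has_vector_derivative 0) (at \<zeta>)"
      by (rule has_vector_derivative_transform_within_open[OF has_vector_derivative_const[of 0], of "{0<..}"])
        (use z zero in auto)
  qed (rule scalar_sum.zero, simp)
next
  case (add g \<alpha> h \<beta> c)
  then obtain g' where g': "scalar_sum m k \<mu> g'"
    "\<And>z \<zeta>. z \<in> posdom k \<Longrightarrow> 0 < \<zeta> \<Longrightarrow> ((\<lambda>s. g z s) has_vector_derivative g' z \<zeta>) (at \<zeta>)" by blast
  let ?h = "\<lambda>z \<zeta>. g' z \<zeta> + pterm k z \<zeta> (\<alpha>, \<beta> - 1) * (of_real \<beta> * c)"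
  show ?case
  proof (intro exI[of _ ?h] conjI ballI allI impI)
    show "scalar_sum m k \<mu> ?h" by (intro scalar_sum_add g' scalar_sum_term add.hyps)
    fix z and \<zeta> :: real assume z: "z \<in> posdom k" "0 < \<zeta>"
    have "((\<lambda>s. complex_of_real (s powr \<beta>)) has_vector_derivative
        complex_of_real (\<beta> * \<zeta> powr (\<beta> - 1))) (at \<zeta>)"
      using has_real_derivative_powr[OF z(2), of \<beta>]
      by (intro has_vector_derivative_of_real) (simp add: has_real_derivative_iff_has_vector_derivative)
    from has_vector_derivative_mult_right[OF this, of "zpow k z \<alpha>"]
    have "((\<lambda>s. pterm k z s (\<alpha>, \<beta>) * c) has_vector_derivative
        pterm k z \<zeta> (\<alpha>, \<beta> - 1) * (of_real \<beta> * c)) (at \<zeta>)"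
      unfolding pterm_def fst_conv snd_conv
      by (intro has_vector_derivative_eq_rhs[OF has_vector_derivative_mult_left]) (auto simp: algebra_simps)
    from has_vector_derivative_add[OF g'(2)[OF z] this]
    show "((\<lambda>s. h z s) has_vector_derivative ?h z \<zeta>) (at \<zeta>)"
      by (rule has_vector_derivative_transform_within_open[of _ _ _ "{0<..}"]) (use z add.hyps in auto)
  qed
qed

section \<open>Operators on power sums\<close>

definition complex_rep ::
  "int \<Rightarrow> int \<Rightarrow> real \<Rightarrow> pexp set \<Rightarrow> (pexp \<Rightarrow> complex^'d) \<Rightarrow> ((int \<Rightarrow> real) \<Rightarrow> real \<Rightarrow> complex^'d) \<Rightarrow> bool"
  where "complex_rep m k \<mu> S \<xi> G \<longleftrightarrow> finite S \<and> (\<forall>s\<in>S. fst s \<in> EC m k \<mu>) \<and>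
    (\<forall>z\<in>posdom k. \<forall>\<zeta>>0. G z \<zeta> = power_sum k S \<xi> z \<zeta>)"

lemma complex_rep_add:
  assumes "complex_rep m k \<mu> S \<xi> G" "complex_rep m k \<mu> S' \<xi>' G'"
  shows "complex_rep m k \<mu> (S \<union> S') (\<lambda>s. extend S \<xi> s + extend S' \<xi>' s) (\<lambda>z \<zeta>. G z \<zeta> + G' z \<zeta>)"
  unfolding complex_rep_def
proof (intro conjI ballI allI impI)
  have fin: "finite (S \<union> S')" using assms by (simp add: complex_rep_def)
  then show "finite (S \<union> S')" .
  fix z and \<zeta> :: real assume z: "z \<in> posdom k" "0 < \<zeta>"
  have "G z \<zeta> = (\<Sum>s\<in>S \<union> S'. pterm k z \<zeta> s *s extend S \<xi> s)"
    "G' z \<zeta> = (\<Sum>s\<in>S \<union> S'. pterm k z \<zeta> s *s extend S' \<xi>' s)"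
    using assms z power_sum_extend[OF fin, of S k \<xi> z \<zeta>] power_sum_extend[OF fin, of S' k \<xi>' z \<zeta>]
    by (simp_all add: complex_rep_def)
  then show "G z \<zeta> + G' z \<zeta> = power_sum k (S \<union> S') (\<lambda>s. extend S \<xi> s + extend S' \<xi>' s) z \<zeta>"
    by (simp add: power_sum_pterm sum.distrib vector_add_ldistrib)
qed (use assms in \<open>auto simp: complex_rep_def\<close>)

lemma complex_rep_term:
  "\<alpha> \<in> EC m k \<mu> \<Longrightarrow> complex_rep m k \<mu> {(\<alpha>, \<beta>)} (\<lambda>_. v) (\<lambda>z \<zeta>. pterm k z \<zeta> (\<alpha>, \<beta>) *s v)"
  by (simp add: complex_rep_def power_sum_pterm)

lemma complex_rep_zero: "complex_rep m k \<mu> {} \<xi> (\<lambda>z \<zeta>. 0)"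
  by (simp add: complex_rep_def power_sum_pterm)

lemma scalar_sum_imp_complex_rep:
  fixes v :: "complex^'d"
  assumes "scalar_sum m k \<mu> g"
  shows "\<exists>S \<xi>. complex_rep m k \<mu> S \<xi> (\<lambda>z \<zeta>. g z \<zeta> *s v)"
  using assms
proof induction
  case (zero g)
  then show ?case
    by (intro exI[of _ "{}"] exI[of _ "\<lambda>_. 0"]) (simp add: complex_rep_def power_sum_pterm)
next
  case (add g \<alpha> h \<beta> c)
  then obtain S \<xi> where S: "complex_rep m k \<mu> S \<xi> (\<lambda>z \<zeta>. g z \<zeta> *s v)" by blast
  from complex_rep_add[OF S complex_rep_term[OF add.hyps(2), of \<beta> "c *s v"]] add.hyps(3)
  have "complex_rep m k \<mu> (S \<union> {(\<alpha>, \<beta>)})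
      (\<lambda>s. extend S \<xi> s + extend {(\<alpha>, \<beta>)} (\<lambda>_. c *s v) s) (\<lambda>z \<zeta>. h z \<zeta> *s v)"
    by (simp add: complex_rep_def vec.scale_left_distrib vector_smult_assoc)
  then show ?case by blast
qed

lemma complex_rep_sum:
  assumes "\<And>x. x \<in> X \<Longrightarrow> \<exists>S \<xi>. complex_rep m k \<mu> S \<xi> (G x)"
  shows "\<exists>S \<xi>. complex_rep m k \<mu> S \<xi> (\<lambda>z \<zeta>. \<Sum>x\<in>X. G x z \<zeta>)"
  using assms
proof (induction X rule: infinite_finite_induct)
  case (insert x X)
  then obtain S \<xi> S' \<xi>' where
    "complex_rep m k \<mu> S \<xi> (G x)" "complex_rep m k \<mu> S' \<xi>' (\<lambda>z \<zeta>. \<Sum>x\<in>X. G x z \<zeta>)"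
    by (metis insertCI)
  from complex_rep_add[OF this] insert.hyps show ?case by auto
qed (auto intro: complex_rep_zero)

lemma EC_cnj: "\<alpha> \<in> EC m k \<mu> \<Longrightarrow> cnj \<circ> \<alpha> \<in> EC m k \<mu>"
  by (simp add: EC_def)

text \<open>A real-valued complex power sum is a symmetric one: average it with its conjugate.\<close>

lemma complex_rep_imp_power_rep:
  assumes "complex_rep m k \<mu> S \<xi> (\<lambda>z \<zeta>. cvec (p z \<zeta>))"
  shows "\<exists>S \<xi>. power_rep k S \<xi> p \<and> (\<forall>s\<in>S. fst s \<in> EC m k \<mu>)"
proof -
  define c :: "pexp \<Rightarrow> pexp" where "c s = (cnj \<circ> fst s, snd s)" for s
  have cc [simp]: "c (c s) = s" for s by (cases s) (auto simp: c_def o_def)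
  define S' where "S' = S \<union> c ` S"
  define \<xi>' where "\<xi>' s = (1 / 2 :: complex) *s (extend S \<xi> s + cnjvec (extend S \<xi> (c s)))" for s
  have fin: "finite S'" using assms by (simp add: S'_def complex_rep_def)
  have EC: "fst s \<in> EC m k \<mu>" if "s \<in> S'" for s
    using that assms by (auto simp: S'_def c_def complex_rep_def EC_cnj)
  have cS: "c s \<in> S'" if "s \<in> S'" for s using that by (auto simp: S'_def)
  have c\<xi>: "\<xi>' (c s) = cnjvec (\<xi>' s)" for s
    by (simp add: \<xi>'_def cnjvec_simps add.commute)
  have "cvec (p z \<zeta>) = power_sum k S' \<xi>' z \<zeta>" if z: "z \<in> posdom k" "0 < \<zeta>" for z \<zeta>
  proof -
    let ?P = "\<Sum>s\<in>S'. pterm k z \<zeta> s *s extend S \<xi> s"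
    have P: "cvec (p z \<zeta>) = ?P"
      using assms z power_sum_extend[OF fin, of S k \<xi> z \<zeta>] by (simp add: complex_rep_def S'_def)
    have "(\<Sum>s\<in>S'. pterm k z \<zeta> s *s cnjvec (extend S \<xi> (c s)))
        = (\<Sum>s\<in>S'. pterm k z \<zeta> (c s) *s cnjvec (extend S \<xi> (c (c s))))"
      by (rule sum.reindex_bij_betw[symmetric]) (rule bij_betw_byWitness[where f'=c], use cS in auto)
    also have "\<dots> = cnjvec ?P"
      by (simp add: cnjvec_sum cnjvec_simps pterm_cnj[OF z(1)] c_def[symmetric])
    also have "\<dots> = ?P" by (simp add: P[symmetric] cnjvec_simps)
    finally have eqP: "(\<Sum>s\<in>S'. pterm k z \<zeta> s *s cnjvec (extend S \<xi> (c s))) = ?P" .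
    have "power_sum k S' \<xi>' z \<zeta> = (\<Sum>s\<in>S'. (1 / 2 :: complex) *s
        (pterm k z \<zeta> s *s extend S \<xi> s + pterm k z \<zeta> s *s cnjvec (extend S \<xi> (c s))))"
      unfolding power_sum_pterm \<xi>'_def
      by (rule sum.cong) (simp_all add: vec_eq_iff field_simps)
    also have "\<dots> = (1 / 2 :: complex) *s (?P + ?P)"
      by (simp only: vec.scale_sum_right[symmetric] sum.distrib eqP)
    also have "\<dots> = ?P" by (simp add: vec_eq_iff)
    finally show ?thesis by (simp add: P)
  qed
  with fin EC cS c\<xi> have "power_rep k S' \<xi>' p"
    unfolding power_rep_def c_def by (auto simp: EC_def)
  with EC show ?thesis by blast
qed

lemma Phat_power_rep:
  "p \<in> Phat_m m k \<mu> \<longleftrightarrow> (\<exists>S \<xi>. power_rep k S \<xi> p \<and> (\<forall>s\<in>S. fst s \<in> EC m k \<mu>))"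
  by (auto simp: Phat_m_def case_prod_beta)

text \<open>The bridge by which all closure properties of the vector-valued class reduce to scalar
  components. From right to left, the components are reassembled in the standard basis and the
  symmetry of the coefficients is restored by averaging.\<close>

lemma Phat_iff_scalar_sum:
  fixes p :: "(int \<Rightarrow> real) \<Rightarrow> real \<Rightarrow> real^'d"
  shows "p \<in> Phat_m m k \<mu> \<longleftrightarrow> (\<forall>i. scalar_sum m k \<mu> (\<lambda>z \<zeta>. of_real (p z \<zeta> $ i)))"
proof
  assume "p \<in> Phat_m m k \<mu>"
  then obtain S \<xi> where S: "power_rep k S \<xi> p" "\<And>s. s \<in> S \<Longrightarrow> fst s \<in> EC m k \<mu>"
    by (auto simp: Phat_power_rep)
  show "\<forall>i. scalar_sum m k \<mu> (\<lambda>z \<zeta>. of_real (p z \<zeta> $ i))"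
  proof
    fix i
    have "scalar_sum m k \<mu> (\<lambda>z \<zeta>. \<Sum>s\<in>S. pterm k z \<zeta> (fst s, snd s) * \<xi> s $ i)"
      by (intro scalar_sum_sum scalar_sum_term S(2))
    then show "scalar_sum m k \<mu> (\<lambda>z \<zeta>. of_real (p z \<zeta> $ i))"
    proof (rule scalar_sum_cong)
      fix z and \<zeta> :: real assume z: "z \<in> posdom k" "0 < \<zeta>"
      have "complex_of_real (p z \<zeta> $ i) = cvec (p z \<zeta>) $ i" by (simp add: cvec_def)
      also have "\<dots> = (\<Sum>s\<in>S. pterm k z \<zeta> (fst s, snd s) * \<xi> s $ i)"
        using power_repD(5)[OF S(1) z] by (simp add: power_sum_pterm)
      finally show "complex_of_real (p z \<zeta> $ i) = (\<Sum>s\<in>S. pterm k z \<zeta> (fst s, snd s) * \<xi> s $ i)" .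
    qed
  qed
next
  assume scalar_sum: "\<forall>i. scalar_sum m k \<mu> (\<lambda>z \<zeta>. of_real (p z \<zeta> $ i))"
  have "\<exists>S \<xi>. complex_rep m k \<mu> S \<xi> (\<lambda>z \<zeta>. \<Sum>i\<in>UNIV. complex_of_real (p z \<zeta> $ i) *s axis i 1)"
    by (intro complex_rep_sum scalar_sum_imp_complex_rep scalar_sum[rule_format])
  moreover have "(\<Sum>i\<in>UNIV. complex_of_real (p z \<zeta> $ i) *s axis i 1) = cvec (p z \<zeta>)" for z \<zeta>
    using basis_expansion[of "cvec (p z \<zeta>)"] by (simp add: cvec_def)
  ultimately show "p \<in> Phat_m m k \<mu>"
    using complex_rep_imp_power_rep[of m k \<mu> _ _ p] by (auto simp: Phat_power_rep)
qed

lemma Phat_cong: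
  assumes "p \<in> Phat_m m k \<mu>" and "\<And>z \<zeta>. z \<in> posdom k \<Longrightarrow> 0 < \<zeta> \<Longrightarrow> p' z \<zeta> = p z \<zeta>"
  shows "p' \<in> Phat_m m k \<mu>"
  unfolding Phat_iff_scalar_sum
proof
  fix i
  show "scalar_sum m k \<mu> (\<lambda>z \<zeta>. of_real (p' z \<zeta> $ i))"
    using assms(1)[unfolded Phat_iff_scalar_sum, rule_format, of i] by (rule scalar_sum_cong) (simp add: assms(2))
qed

lemma Phat_deeper: "p \<in> Phat_m m k \<mu> \<Longrightarrow> k \<le> k' \<Longrightarrow> p \<in> Phat_m m k' \<mu>"
  unfolding Phat_iff_scalar_sum by (blast intro: scalar_sum_deeper)

lemma Phat_subset: "p \<in> Phat_m m k \<mu> \<Longrightarrow> EC m k \<mu> \<subseteq> EC m' k \<mu>' \<Longrightarrow> p \<in> Phat_m m' k \<mu>'"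
  unfolding Phat_iff_scalar_sum by (blast intro: scalar_sum_subset)

lemma Phat_zero: "(\<lambda>z \<zeta>. 0) \<in> Phat_m m k \<mu>"
  unfolding Phat_iff_scalar_sum by (auto intro: scalar_sum.zero)

lemma Phat_add:
  "p \<in> Phat_m m k \<mu> \<Longrightarrow> q \<in> Phat_m m k \<mu> \<Longrightarrow> (\<lambda>z \<zeta>. p z \<zeta> + q z \<zeta>) \<in> Phat_m m k \<mu>"
  unfolding Phat_iff_scalar_sum by (simp add: scalar_sum_add)

lemma Phat_scale:
  "scalar_sum m k \<mu> (\<lambda>z \<zeta>. of_real (g z \<zeta>)) \<Longrightarrow> p \<in> Phat_m m k \<nu> \<Longrightarrow>
    (\<lambda>z \<zeta>. g z \<zeta> *\<^sub>R p z \<zeta>) \<in> Phat_m m k (\<mu> + \<nu>)"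
  unfolding Phat_iff_scalar_sum by (simp add: scalar_sum_mult)

lemma Phat_diff:
  assumes "p \<in> Phat_m m k \<mu>" "q \<in> Phat_m m k \<mu>"
  shows "(\<lambda>z \<zeta>. p z \<zeta> - q z \<zeta>) \<in> Phat_m m k \<mu>"
proof -
  have "(\<lambda>z \<zeta>. -1 *\<^sub>R q z \<zeta>) \<in> Phat_m m k \<mu>"
    using Phat_scale[where g="\<lambda>_ _. -1" and \<mu>=0, OF scalar_sum_const assms(2)] by simp
  from Phat_add[OF assms(1) this] show ?thesis by simp
qed

lemma Phat_sum:
  "(\<And>x. x \<in> X \<Longrightarrow> p x \<in> Phat_m m k \<mu>) \<Longrightarrow> (\<lambda>z \<zeta>. \<Sum>x\<in>X. p x z \<zeta>) \<in> Phat_m m k \<mu>"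
  by (induction X rule: infinite_finite_induct) (auto intro: Phat_zero Phat_add)

section \<open>Stability of the classes under the operators\<close>

lemma vector_derivative_componentwise:
  fixes f :: "real \<Rightarrow> real^'d"
  assumes "\<And>i. ((\<lambda>s. f s $ i) has_vector_derivative f' $ i) (at x within X)"
  shows "(f has_vector_derivative f') (at x within X)"
proof -
  have "((\<lambda>s. \<Sum>i\<in>UNIV. (f s $ i) *\<^sub>R axis i 1) has_vector_derivative
      (\<Sum>i\<in>UNIV. (f' $ i) *\<^sub>R (axis i 1 :: real^'d))) (at x within X)"
    by (intro has_vector_derivative_sum bounded_linear.has_vector_derivative[OF bounded_linear_scaleR_left] assms)
  moreover have "(\<Sum>i\<in>UNIV. (v $ i) *\<^sub>R axis i 1) = v" for v :: "real^'d"
    using basis_expansion[of v] by (simp add: scalar_mult_eq_scaleR)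
  ultimately show ?thesis by simp
qed

lemma Phat_dzeta:
  fixes p :: "(int \<Rightarrow> real) \<Rightarrow> real \<Rightarrow> real^'d"
  assumes "p \<in> Phat_m m k \<mu>"
  shows "(\<lambda>z \<zeta>. vector_derivative (\<lambda>s. p z s) (at \<zeta>)) \<in> Phat_m m k \<mu>" (is ?A)
    and "z \<in> posdom k \<Longrightarrow> 0 < \<zeta> \<Longrightarrow>
      ((\<lambda>s. p z s) has_vector_derivative vector_derivative (\<lambda>s. p z s) (at \<zeta>)) (at \<zeta>)"
proof -
  have "\<forall>i. \<exists>g'. scalar_sum m k \<mu> g' \<and> (\<forall>z\<in>posdom k. \<forall>\<zeta>>0.
      ((\<lambda>s. complex_of_real (p z s $ i)) has_vector_derivative g' z \<zeta>) (at \<zeta>))"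
    using assms scalar_sum_dzeta unfolding Phat_iff_scalar_sum by blast
  then obtain g' where g': "\<And>i. scalar_sum m k \<mu> (g' i)" "\<And>i z \<zeta>. z \<in> posdom k \<Longrightarrow> 0 < \<zeta> \<Longrightarrow>
      ((\<lambda>s. complex_of_real (p z s $ i)) has_vector_derivative g' i z \<zeta>) (at \<zeta>)"
    by metis
  define d where "d z \<zeta> = (\<chi> i. Re (g' i z \<zeta>))" for z \<zeta>
  have dR: "((\<lambda>s. p z s $ i) has_vector_derivative Re (g' i z \<zeta>)) (at \<zeta>)"
    and dI: "Im (g' i z \<zeta>) = 0"
    if z: "z \<in> posdom k" "0 < \<zeta>" for z \<zeta> i
  proof -
    show "((\<lambda>s. p z s $ i) has_vector_derivative Re (g' i z \<zeta>)) (at \<zeta>)"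
      using bounded_linear.has_vector_derivative[OF bounded_linear_Re g'(2)[OF z]] by simp
    \<comment> \<open>The component is real-valued, so the imaginary part of its complex derivative
      is the derivative of zero.\<close>
    have "((\<lambda>s::real. 0::real) has_vector_derivative Im (g' i z \<zeta>)) (at \<zeta>)"
      using bounded_linear.has_vector_derivative[OF bounded_linear_Im g'(2)[OF z]] by simp
    then show "Im (g' i z \<zeta>) = 0"
      using vector_derivative_at has_vector_derivative_const by metis
  qed
  have d: "((\<lambda>s. p z s) has_vector_derivative d z \<zeta>) (at \<zeta>)" if "z \<in> posdom k" "0 < \<zeta>" for z \<zeta>
    by (rule vector_derivative_componentwise) (simp add: d_def dR[OF that])
  then show "z \<in> posdom k \<Longrightarrow> 0 < \<zeta> \<Longrightarrow>
      ((\<lambda>s. p z s) has_vector_derivative vector_derivative (\<lambda>s. p z s) (at \<zeta>)) (at \<zeta>)"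
    using vector_derivative_at by metis
  have "scalar_sum m k \<mu> (\<lambda>z \<zeta>. of_real (vector_derivative (\<lambda>s. p z s) (at \<zeta>) $ i))" for i
    by (rule scalar_sum_cong[OF g'(1)[of i]])
      (simp add: vector_derivative_at[OF d] d_def complex_eq_iff dI)
  then show ?A unfolding Phat_iff_scalar_sum by blast
qed

lemma opM_rep:
  "power_rep k S \<xi> p \<Longrightarrow> power_rep k S (\<lambda>(\<alpha>, \<beta>). \<alpha> j *s \<xi> (\<alpha>, \<beta>)) (opM k j p)"
  unfolding opM_def by (rule power_rep_coeff_map) (simp_all add: cnjvec_simps)

lemma opM_Phat: "p \<in> Phat_m m k \<mu> \<Longrightarrow> opM k j p \<in> Phat_m m k \<mu>"
  unfolding Phat_power_rep using opM_rep by blast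

text \<open>Each product of inverses starts with the inverse of z_0, so every term loses exactly one
  in the exponent of z_0. That position decides the class only for index 0.\<close>

lemma opR_Phat:
  assumes "p \<in> Phat_m 0 k \<mu>"
  shows "opR k p \<in> Phat_m 0 k (\<mu> - 1)"
proof -
  have "(\<lambda>z \<zeta>. \<Sum>j\<in>{0..k}. (\<Prod>i\<in>{0..j}. inverse (z i)) *\<^sub>R opM k j p z \<zeta>) \<in> Phat_m 0 k (-1 + \<mu>)"
    by (intro Phat_sum Phat_scale scalar_sum_inverse_product opM_Phat assms) auto
  then have "opR k p \<in> Phat_m 0 k (-1 + \<mu>)" by (rule Phat_cong) (simp add: opR_def)
  then show ?thesis by (simp add: add.commute)
qed

lemma cmat_mult_cnjvec: "cmat A *v cnjvec v = cnjvec (cmat A *v v)"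
  by (simp add: cmat_def cnjvec_def matrix_vector_mult_def vec_eq_iff)

lemma mat_mult_vector: "mat (c::complex) *v v = c *s v"
  by (simp add: mat_def matrix_vector_mult_def vec_eq_iff if_distrib[where f="\<lambda>x. x * _"] cong: if_cong)

text \<open>A kernel vector would be an eigenvector of A for - c, whose real part is zero.\<close>

lemma imaginary_shift_invertible:
  fixes A :: "real^'n^'n"
  assumes eig: "\<forall>c. complex_eigenvalue A c \<longrightarrow> 0 < Re c" and c: "Re c = 0"
  defines "M \<equiv> cmat A + mat c"
  shows "M *v (matrix_inv M *v v) = v" "matrix_inv M *v (M *v v) = v"
proof -
  have "x = 0" if "M *v x = 0" for x
  proof (rule ccontr)
    assume "x \<noteq> 0"
    moreover have "cmat A *v x = (- c) *s x"
      using that by (simp add: M_def matrix_vector_mult_add_rdistrib mat_mult_vector eq_neg_iff_add_eq_0)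
    ultimately have "0 < Re (- c)" using eig unfolding complex_eigenvalue_def by blast
    with c show False by simp
  qed
  then have "invertible M"
    unfolding invertible_left_inverse matrix_left_invertible_ker by blast
  then have "M ** matrix_inv M = mat 1 \<and> matrix_inv M ** M = mat 1"
    unfolding invertible_def matrix_inv_def by (rule someI_ex)
  then show "M *v (matrix_inv M *v v) = v" "matrix_inv M *v (M *v v) = v"
    by (simp_all add: matrix_vector_mul_assoc)
qed

text \<open>Symmetry survives because A is real: conjugating (A + c) w = v gives the equation for
  the conjugate shift, and its solution is unique.\<close>

lemma opZ_rep:
  assumes eig: "\<forall>c. complex_eigenvalue A c \<longrightarrow> 0 < Re c"
    and rep: "power_rep k S \<xi> p" and S: "\<And>s. s \<in> S \<Longrightarrow> Re (fst s (-1)) = 0"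
  shows "power_rep k S (\<lambda>(\<alpha>, \<beta>). matrix_inv (cmat A + mat (\<alpha> (-1))) *v \<xi> (\<alpha>, \<beta>)) (opZ A k p)"
  unfolding opZ_def
proof (rule power_rep_coeff_map[OF rep])
  fix s :: pexp and v assume "s \<in> S"
  define c where "c = fst s (-1)"
  have c: "Re c = 0" "Re (cnj c) = 0" using S[OF \<open>s \<in> S\<close>] by (simp_all add: c_def)
  note inv = imaginary_shift_invertible[OF eig c(1)] and inv' = imaginary_shift_invertible[OF eig c(2)]
  let ?w = "matrix_inv (cmat A + mat c) *v v"
  have "(cmat A + mat (cnj c)) *v cnjvec ?w = cnjvec ((cmat A + mat c) *v ?w)"
    by (simp only: matrix_vector_mult_add_rdistrib mat_mult_vector cmat_mult_cnjvec cnjvec_simps)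
  also have "\<dots> = cnjvec v" by (simp only: inv)
  finally have "matrix_inv (cmat A + mat (cnj c)) *v cnjvec v
      = matrix_inv (cmat A + mat (cnj c)) *v ((cmat A + mat (cnj c)) *v cnjvec ?w)" by simp
  also have "\<dots> = cnjvec ?w" by (simp only: inv')
  finally show "matrix_inv (cmat A + mat ((cnj \<circ> fst s) (-1))) *v cnjvec v
      = cnjvec (matrix_inv (cmat A + mat (fst s (-1))) *v v)" by (simp add: c_def)
qed simp

text \<open>For m \<ge> 0 the exponents at z_(-1) are imaginary, so every shifted matrix is
  invertible. The second claim says that the operator inverts A plus the derivative along z_(-1) =
  e^t, the only part of the time derivative that does not lower the order.\<close>

lemma opZ_Phat:
  assumes eig: "\<forall>c. complex_eigenvalue A c \<longrightarrow> 0 < Re c" and m: "0 \<le> m"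
    and p: "p \<in> Phat_m m k \<mu>"
  shows "opZ A k p \<in> Phat_m m k \<mu>"
    and "z \<in> posdom k \<Longrightarrow> 0 < \<zeta> \<Longrightarrow> A *v opZ A k p z \<zeta> + opM k (-1) (opZ A k p) z \<zeta> = p z \<zeta>"
proof -
  obtain S \<xi> where S: "power_rep k S \<xi> p" "\<And>s. s \<in> S \<Longrightarrow> fst s \<in> EC m k \<mu>"
    using p by (auto simp: Phat_power_rep)
  then have Re: "\<And>s. s \<in> S \<Longrightarrow> Re (fst s (-1)) = 0" using m by (auto simp: EC_def)
  note Z = opZ_rep[OF eig S(1) Re] and MZ = opM_rep[OF opZ_rep[OF eig S(1) Re], where j="-1"]
  show "opZ A k p \<in> Phat_m m k \<mu>" using Z S(2) by (auto simp: Phat_power_rep)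
  assume z: "z \<in> posdom k" "0 < \<zeta>"
  have "cvec (A *v opZ A k p z \<zeta> + opM k (-1) (opZ A k p) z \<zeta>)
      = cmat A *v cvec (opZ A k p z \<zeta>) + cvec (opM k (-1) (opZ A k p) z \<zeta>)"
    by (simp add: linear_add[OF bounded_linear.linear[OF cvec_linear]] cmat_mult_cvec)
  also have "\<dots> = (\<Sum>s\<in>S. pterm k z \<zeta> s *s
      ((cmat A + mat (fst s (-1))) *v (matrix_inv (cmat A + mat (fst s (-1))) *v \<xi> s)))"
    by (simp add: power_repD(5)[OF Z z] power_repD(5)[OF MZ z] power_sum_pterm case_prod_beta
        matrix_vector_mult_add_rdistrib mat_mult_vector vector_add_ldistrib sum.distrib
        linear_sum[OF Finite_Cartesian_Product.matrix_vector_mul_linear] vector_scalar_commute)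
  also have "\<dots> = (\<Sum>s\<in>S. pterm k z \<zeta> s *s \<xi> s)"
    by (rule sum.cong) (simp_all only: imaginary_shift_invertible[OF eig Re])
  also have "\<dots> = cvec (p z \<zeta>)" by (simp add: power_repD(5)[OF S(1) z] power_sum_pterm)
  finally show "A *v opZ A k p z \<zeta> + opM k (-1) (opZ A k p) z \<zeta> = p z \<zeta>"
    by (simp add: cvec_inject)
qed

section \<open>Iterated logarithms\<close>

lemma L_minus_one [simp]: "L (-1) t = exp t"
  by (simp add: L_def)

lemma L_zero [simp]: "L 0 t = t"
  by (simp add: L_def)

lemma L_step: "-1 \<le> j \<Longrightarrow> L (j + 1) t = ln (L j t)"
proof (cases "j = -1")
  case False
  assume "-1 \<le> j"
  with False have "nat (j + 1) = Suc (nat j)" "\<not> j < 0" "\<not> j + 1 < 0" by auto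
  then show ?thesis by (simp add: L_def)
qed simp

lemma filterlim_L: "-1 \<le> j \<Longrightarrow> filterlim (L j) at_top at_top"
proof (induction j rule: int_ge_induct)
  case base
  show ?case using exp_at_top by (simp add: L_def)
next
  case (step j)
  have "filterlim (\<lambda>t. ln (L j t)) at_top at_top"
    by (rule filterlim_compose[OF ln_at_top step.IH])
  then show ?case using step.hyps by (simp add: L_step)
qed

lemma eventually_L_gt: "-1 \<le> j \<Longrightarrow> eventually (\<lambda>t. c < L j t) at_top"
  using filterlim_L[of j] by (simp add: filterlim_at_top_dense)

lemma eventually_L_all_gt: "eventually (\<lambda>t. \<forall>j\<in>{-1..k}. c < L j t) at_top"
  by (intro eventually_ball_finite) (auto intro: eventually_L_gt)

lemma L_has_derivative:
  "-1 \<le> j \<Longrightarrow> (\<And>i. 0 \<le> i \<Longrightarrow> i \<le> j \<Longrightarrow> 0 < L i t) \<Longrightarrow>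
    (L (j + 1) has_real_derivative (\<Prod>i\<in>{0..j}. inverse (L i t))) (at t)"
proof (induction j rule: int_ge_induct)
  case base
  have "L (-1 + 1) = (\<lambda>t. t)" by (simp add: fun_eq_iff)
  then show ?case by simp
next
  case (step j)
  have L: "L (j + 1 + 1) = (\<lambda>t. ln (L (j + 1) t))"
    using step.hyps L_step[of "j + 1"] by (simp add: fun_eq_iff)
  have set: "{0..j + 1} = insert (j + 1) {0..j}" using step.hyps by auto
  show ?case
    unfolding L set using step
    by (auto intro!: derivative_eq_intros simp: field_simps)
qed

text \<open>The untruncated tuple. A power sum of depth k reads only the positions up to k, so one
  curve serves all depths; \<open>Lhat\<close> is replaced by it and restored at the end.\<close>

definition logs :: "real \<Rightarrow> int \<Rightarrow> real" where "logs t = (\<lambda>j. L j t)"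

lemma eventually_logs_posdom: "eventually (\<lambda>t. logs t \<in> posdom k) at_top"
  using eventually_L_all_gt[of k 0] by eventually_elim (simp add: posdom_def logs_def)

lemma logs_posdom_iff: "logs t \<in> posdom k \<longleftrightarrow> (\<forall>j\<in>{-1..k}. 0 < L j t)"
  by (simp add: posdom_def logs_def)

lemma L_smallo_step: "-1 \<le> j \<Longrightarrow> L (j + 1) \<in> o(L j)"
proof -
  assume j: "-1 \<le> j"
  have "(\<lambda>x::real. ln x) \<in> o(\<lambda>x. x)" by real_asymp
  from landau_o.small.compose[OF this filterlim_L[OF j]]
  have "(\<lambda>t. ln (L j t)) \<in> o(\<lambda>t. L j t)" .
  moreover have "L (j + 1) = (\<lambda>t. ln (L j t))" using L_step[OF j] by (simp add: fun_eq_iff)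
  ultimately show ?thesis by simp
qed

lemma L_smallo:
  assumes "-1 \<le> i" "i < j"
  shows "L j \<in> o(L i)"
  using assms(2)
proof (induction j rule: int_gr_induct)
  case base
  then show ?case using L_smallo_step assms(1) by simp
next
  case (step j)
  then have "L (j + 1) \<in> o(L j)" using assms(1) by (intro L_smallo_step) simp
  with step show ?case by (blast intro: landau_o.small_trans)
qed

text \<open>Since \<open>L (j + 1)\<close> is the logarithm of \<open>L j\<close>, the sum is the
  logarithm of a real monomial along the curve. All positions after i contribute o(L_(i+1)). The
  coefficient at i may itself be zero.\<close>

lemma log_growth:
  assumes i: "-1 \<le> i" "i \<le> k" and a: "\<And>j. -1 \<le> j \<Longrightarrow> j < i \<Longrightarrow> a j = 0" and e: "0 < \<epsilon>"
  shows "eventually (\<lambda>t. \<bar>(\<Sum>j\<in>{-1..k}. a j * L (j + 1) t) - a i * L (i + 1) t\<bar> \<le> \<epsilon> * L (i + 1) t) at_top"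
proof -
  have "(\<lambda>t. \<Sum>j\<in>{i+1..k}. a j * L (j + 1) t) \<in> o(\<lambda>t. L (i + 1) t)"
  proof (rule big_sum_in_smallo)
    fix j assume "j \<in> {i+1..k}"
    then have "L (j + 1) \<in> o(L (i + 1))" using i by (intro L_smallo) auto
    then show "(\<lambda>t. a j * L (j + 1) t) \<in> o(\<lambda>t. L (i + 1) t)"
      by (cases "a j = 0") simp_all
  qed
  from landau_o.smallD[OF this e]
  have "eventually (\<lambda>t. norm (\<Sum>j\<in>{i+1..k}. a j * L (j + 1) t) \<le> \<epsilon> * norm (L (i + 1) t)) at_top" .
  moreover have "eventually (\<lambda>t. 0 < L (i + 1) t) at_top"
    using i by (intro eventually_L_gt) auto
  ultimately have "eventually (\<lambda>t. \<bar>\<Sum>j\<in>{i+1..k}. a j * L (j + 1) t\<bar> \<le> \<epsilon> * L (i + 1) t) at_top"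
    by eventually_elim simp
  moreover have "(\<Sum>j\<in>{-1..k}. a j * L (j + 1) t) - a i * L (i + 1) t
      = (\<Sum>j\<in>{i+1..k}. a j * L (j + 1) t)" for t
  proof -
    have "(\<Sum>j\<in>{-1..k}. a j * L (j + 1) t) = (\<Sum>j\<in>{i..k}. a j * L (j + 1) t)"
      by (rule sum.mono_neutral_right) (use i a in auto)
    also have "{i..k} = insert i {i+1..k}" using i by auto
    finally show ?thesis by simp
  qed
  ultimately show ?thesis by simp
qed

lemma norm_pterm_logs:
  assumes "logs t \<in> posdom k" "0 < \<zeta>"
  shows "norm (pterm k (logs t) \<zeta> s)
    = exp ((\<Sum>j\<in>{-1..k}. Re (fst s j) * L (j + 1) t) + snd s * ln \<zeta>)"
proof -
  have "(\<Sum>j\<in>{-1..k}. Re (fst s j) * ln (logs t j)) = (\<Sum>j\<in>{-1..k}. Re (fst s j) * L (j + 1) t)"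
    by (rule sum.cong) (auto simp: L_step logs_def)
  then show ?thesis using assms
    by (simp add: pterm_def zpow_exp norm_mult exp_add) (simp add: powr_def)
qed



section \<open>Orders of decay in powers of L_m\<close>

definition decay :: "int \<Rightarrow> real \<Rightarrow> (real \<Rightarrow> 'a::real_normed_vector) \<Rightarrow> bool"
  where "decay m \<nu> g \<longleftrightarrow> (\<lambda>t. norm (g t)) \<in> O(\<lambda>t. L m t powr - \<nu>)"

text \<open>What a power sum of order s satisfies: deeper logarithms and \<zeta> may spoil the bound
  at s itself. Its counterpart \<open>decay_beyond\<close> is the error condition of the expansion,
  with a definite surplus over s.\<close>

definition decay_upto :: "int \<Rightarrow> real \<Rightarrow> (real \<Rightarrow> 'a::real_normed_vector) \<Rightarrow> bool"
  where "decay_upto m s g \<longleftrightarrow> (\<forall>\<nu><s. decay m \<nu> g)"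

definition decay_beyond :: "int \<Rightarrow> real \<Rightarrow> (real \<Rightarrow> 'a::real_normed_vector) \<Rightarrow> bool"
  where "decay_beyond m s g \<longleftrightarrow> (\<exists>\<nu>>s. decay m \<nu> g)"

lemma decayI:
  assumes "eventually (\<lambda>t. norm (g t) \<le> C * L m t powr - \<nu>) at_top"
  shows "decay m \<nu> g"
  unfolding decay_def by (rule bigoI[of _ C]) (use assms in \<open>simp add: eventually_mono\<close>)

lemma decayE:
  assumes "decay m \<nu> g"
  obtains C where "0 < C" "eventually (\<lambda>t. norm (g t) \<le> C * L m t powr - \<nu>) at_top"
  using assms unfolding decay_def by (elim landau_o.bigE) simp

lemma decay_bound:
  assumes "decay m \<nu> h" "eventually (\<lambda>t. norm (g t) \<le> C * norm (h t)) at_top"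
  shows "decay m \<nu> g"
proof -
  have "(\<lambda>t. norm (g t)) \<in> O(\<lambda>t. norm (h t))"
    by (rule bigoI[of _ C]) (use assms(2) in simp)
  with assms(1) show ?thesis unfolding decay_def by (blast intro: landau_o.big_trans)
qed

lemma decay_cong: "decay m \<nu> h \<Longrightarrow> eventually (\<lambda>t. g t = h t) at_top \<Longrightarrow> decay m \<nu> g"
  by (rule decay_bound[where C=1]) (auto elim: eventually_mono)

lemma decay_mono:
  assumes m: "-1 \<le> m" and "decay m \<nu> g" "\<nu>' \<le> \<nu>"
  shows "decay m \<nu>' g"
proof -
  obtain C where C: "0 < C" "eventually (\<lambda>t. norm (g t) \<le> C * L m t powr - \<nu>) at_top"
    using assms(2) by (rule decayE)
  show ?thesis
  proof (rule decayI)
    show "eventually (\<lambda>t. norm (g t) \<le> C * L m t powr - \<nu>') at_top"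
      using C(2) eventually_L_gt[OF m, of 1]
    proof eventually_elim
      case (elim t)
      then have "C * L m t powr - \<nu> \<le> C * L m t powr - \<nu>'"
        using C(1) assms(3) by (intro mult_left_mono powr_mono) auto
      with elim show ?case by simp
    qed
  qed
qed

lemma decay_zero: "decay m \<nu> (\<lambda>t. 0)"
  by (simp add: decay_def)

lemma decay_add: "decay m \<nu> g \<Longrightarrow> decay m \<nu> h \<Longrightarrow> decay m \<nu> (\<lambda>t. g t + h t)"
proof -
  assume gh: "decay m \<nu> g" "decay m \<nu> h"
  have "(\<lambda>t. norm (g t + h t)) \<in> O(\<lambda>t. norm (g t) + norm (h t))"
    by (rule bigoI[of _ 1]) (simp add: norm_triangle_ineq)
  moreover have "(\<lambda>t. norm (g t) + norm (h t)) \<in> O(\<lambda>t. L m t powr - \<nu>)"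
    using gh unfolding decay_def by (rule sum_in_bigo)
  ultimately show ?thesis unfolding decay_def by (rule landau_o.big_trans)
qed

lemma decay_uminus: "decay m \<nu> g \<Longrightarrow> decay m \<nu> (\<lambda>t. - g t)"
  by (simp add: decay_def)

lemma decay_sum: "(\<And>x. x \<in> X \<Longrightarrow> decay m \<nu> (g x)) \<Longrightarrow> decay m \<nu> (\<lambda>t. \<Sum>x\<in>X. g x t)"
  by (induction X rule: infinite_finite_induct) (auto intro: decay_zero decay_add)

lemma decay_mult:
  assumes m: "-1 \<le> m" and g: "decay m \<nu> g" and h: "decay m \<nu>' h"
    and f: "eventually (\<lambda>t. norm (f t) \<le> C * (norm (g t) * norm (h t))) at_top"
  shows "decay m (\<nu> + \<nu>') f"
proof -
  have "(\<lambda>t. norm (f t)) \<in> O(\<lambda>t. norm (g t) * norm (h t))"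
    by (rule bigoI[of _ C]) (use f in simp)
  also have "(\<lambda>t. norm (g t) * norm (h t)) \<in> O(\<lambda>t. L m t powr - \<nu> * L m t powr - \<nu>')"
    using g h unfolding decay_def by (rule landau_o.big.mult)
  also have "(\<lambda>t. L m t powr - \<nu> * L m t powr - \<nu>') \<in> O(\<lambda>t. L m t powr - (\<nu> + \<nu>'))"
    by (simp flip: powr_add)
  finally show ?thesis unfolding decay_def .
qed

text \<open>The arbitrarily small loss of one factor is paid from the surplus of the other: half of
  the surplus is spent, half is kept.\<close>

lemma decay_upto_beyond_mult:
  assumes m: "-1 \<le> m" and g: "decay_upto m s g" and h: "decay_beyond m s' h"
    and f: "eventually (\<lambda>t. norm (f t) \<le> C * (norm (g t) * norm (h t))) at_top"
  shows "decay_beyond m (s + s') f"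
proof -
  obtain \<nu> where \<nu>: "s' < \<nu>" "decay m \<nu> h" using h by (auto simp: decay_beyond_def)
  have "decay m (s - (\<nu> - s') / 2) g" using g \<nu> by (simp add: decay_upto_def)
  from decay_mult[OF m this \<nu>(2) f] \<nu>(1) show ?thesis
    unfolding decay_beyond_def by (intro exI[of _ "s - (\<nu> - s') / 2 + \<nu>"]) (auto simp: field_simps)
qed

lemma decay_upto_imp_beyond: "decay_upto m s g \<Longrightarrow> s' < s \<Longrightarrow> decay_beyond m s' g"
  unfolding decay_upto_def decay_beyond_def by (meson dense)

lemma decay_beyond_imp_upto: "-1 \<le> m \<Longrightarrow> decay_beyond m s g \<Longrightarrow> decay_upto m s g"
  unfolding decay_upto_def decay_beyond_def by (auto intro: decay_mono)

lemma decay_beyond_mono: "decay_beyond m s g \<Longrightarrow> s' \<le> s \<Longrightarrow> decay_beyond m s' g"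
  unfolding decay_beyond_def by force

lemma decay_beyond_cong:
  "decay_beyond m s h \<Longrightarrow> eventually (\<lambda>t. g t = h t) at_top \<Longrightarrow> decay_beyond m s g"
  unfolding decay_beyond_def using decay_cong by blast

lemma decay_beyond_zero: "decay_beyond m s (\<lambda>t. 0)"
  unfolding decay_beyond_def by (intro exI[of _ "s + 1"]) (simp add: decay_zero)

lemma decay_beyond_add:
  assumes "-1 \<le> m" "decay_beyond m s g" "decay_beyond m s h"
  shows "decay_beyond m s (\<lambda>t. g t + h t)"
proof -
  obtain \<nu> \<nu>' where "s < \<nu>" "decay m \<nu> g" "s < \<nu>'" "decay m \<nu>' h"
    using assms(2,3) by (auto simp: decay_beyond_def)
  then show ?thesis unfolding decay_beyond_def
    using assms(1) by (intro exI[of _ "min \<nu> \<nu>'"] conjI decay_add) (auto intro: decay_mono)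
qed

lemma decay_beyond_uminus: "decay_beyond m s g \<Longrightarrow> decay_beyond m s (\<lambda>t. - g t)"
  unfolding decay_beyond_def using decay_uminus by blast

lemma decay_beyond_sum:
  "-1 \<le> m \<Longrightarrow> (\<And>x. x \<in> X \<Longrightarrow> decay_beyond m s (g x)) \<Longrightarrow> decay_beyond m s (\<lambda>t. \<Sum>x\<in>X. g x t)"
  by (induction X rule: infinite_finite_induct) (auto intro: decay_beyond_zero decay_beyond_add)

lemma decay_upto_add: "decay_upto m s g \<Longrightarrow> decay_upto m s h \<Longrightarrow> decay_upto m s (\<lambda>t. g t + h t)"
  unfolding decay_upto_def by (auto intro: decay_add)



text \<open>All that matters about the function substituted for \<open>\<zeta>\<close> is that it is subpolynomial in \<open>L\<^sub>m\<close>.\<close>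

definition subpower :: "int \<Rightarrow> (real \<Rightarrow> real) \<Rightarrow> bool"
  where "subpower m ze \<longleftrightarrow>
    (\<forall>\<epsilon>>0. eventually (\<lambda>t. 0 < ze t \<and> \<bar>ln (ze t)\<bar> \<le> \<epsilon> * L (m + 1) t) at_top)"

lemma subpower_pos: "subpower m ze \<Longrightarrow> eventually (\<lambda>t. 0 < ze t) at_top"
  unfolding subpower_def by (auto dest: spec[of _ 1] elim: eventually_mono)

lemma subpower_shallower:
  assumes "subpower m ze" "-1 \<le> i" "i \<le> m"
  shows "subpower i ze"
proof (cases "i = m")
  case False
  with assms have "L (m + 1) \<in> o(L (i + 1))" by (intro L_smallo) auto
  from landau_o.smallD[OF this zero_less_one]
  have 1: "eventually (\<lambda>t. \<bar>L (m + 1) t\<bar> \<le> \<bar>L (i + 1) t\<bar>) at_top" by simp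
  have 2: "eventually (\<lambda>t. 0 < L (i + 1) t) at_top" using assms by (intro eventually_L_gt) auto
  show ?thesis unfolding subpower_def
  proof (intro allI impI)
    fix \<epsilon> :: real assume e: "0 < \<epsilon>"
    with assms(1) have "eventually (\<lambda>t. 0 < ze t \<and> \<bar>ln (ze t)\<bar> \<le> \<epsilon> * L (m + 1) t) at_top"
      by (simp add: subpower_def)
    with 1 2 show "eventually (\<lambda>t. 0 < ze t \<and> \<bar>ln (ze t)\<bar> \<le> \<epsilon> * L (i + 1) t) at_top"
    proof eventually_elim
      case (elim t)
      then have "\<epsilon> * L (m + 1) t \<le> \<epsilon> * L (i + 1) t" using e by (intro mult_left_mono) auto
      with elim show ?case by linarith
    qed
  qed
qed (use assms in simp)

lemma pterm_decay:
  assumes \<alpha>: "\<alpha> \<in> EC m k \<mu>" and m: "-1 \<le> m" "m \<le> k" and ze: "subpower m ze" and \<nu>: "\<nu> < - \<mu>"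
  shows "decay m \<nu> (\<lambda>t. pterm k (logs t) (ze t) (\<alpha>, \<beta>) * c)"
proof -
  \<comment> \<open>Half of the gap between \<nu> and - \<mu>: one \<epsilon> bounds the deeper
    logarithms, the other the power of \<zeta>. Below, \<delta> is small enough that multiplying by
    the modulus of \<beta> stays within \<epsilon>.\<close>
  define \<epsilon> where "\<epsilon> = (- \<mu> - \<nu>) / 2"
  have e: "0 < \<epsilon>" using \<nu> by (simp add: \<epsilon>_def)
  define \<delta> where "\<delta> = \<epsilon> / (\<bar>\<beta>\<bar> + 1)"
  have d: "0 < \<delta>" using e by (simp add: \<delta>_def)
  have bd: "\<bar>\<beta>\<bar> * \<delta> \<le> \<epsilon>" using e by (simp add: \<delta>_def field_simps)
  have 1: "eventually (\<lambda>t. \<bar>(\<Sum>j\<in>{-1..k}. Re (\<alpha> j) * L (j + 1) t) - Re (\<alpha> m) * L (m + 1) t\<bar>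
      \<le> \<epsilon> * L (m + 1) t) at_top"
    using \<alpha> by (intro log_growth m e) (auto simp: EC_def)
  have 2: "eventually (\<lambda>t. 0 < ze t \<and> \<bar>ln (ze t)\<bar> \<le> \<delta> * L (m + 1) t) at_top"
    using ze d by (simp add: subpower_def)
  have 3: "eventually (\<lambda>t. 0 < L m t) at_top" "eventually (\<lambda>t. 0 < L (m + 1) t) at_top"
    using m by (auto intro: eventually_L_gt)
  show ?thesis
  proof (rule decayI)
    show "eventually (\<lambda>t. norm (pterm k (logs t) (ze t) (\<alpha>, \<beta>) * c) \<le> norm c * L m t powr - \<nu>) at_top"
      using 1 2 3 eventually_logs_posdom[of k]
    proof eventually_elim
      case (elim t)
      have "\<beta> * ln (ze t) \<le> \<bar>\<beta>\<bar> * \<bar>ln (ze t)\<bar>" by (metis abs_ge_self abs_mult)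
      also have "\<dots> \<le> \<bar>\<beta>\<bar> * (\<delta> * L (m + 1) t)" using elim by (intro mult_left_mono) auto
      also have "\<dots> \<le> \<epsilon> * L (m + 1) t" using bd elim by (simp add: mult.assoc[symmetric] mult_right_mono)
      finally have "(\<Sum>j\<in>{-1..k}. Re (\<alpha> j) * L (j + 1) t) + \<beta> * ln (ze t)
          \<le> \<mu> * L (m + 1) t + \<epsilon> * L (m + 1) t + \<epsilon> * L (m + 1) t"
        using elim \<alpha> by (simp add: EC_def abs_le_iff)
      also have "\<dots> = - \<nu> * ln (L m t)"
        using L_step[OF m(1), of t] by (simp add: \<epsilon>_def field_simps)
      finally have "norm (pterm k (logs t) (ze t) (\<alpha>, \<beta>)) \<le> L m t powr - \<nu>"
        using elim by (simp add: norm_pterm_logs powr_def)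
      from mult_right_mono[OF this norm_ge_zero[of c]] show ?case
        by (simp add: norm_mult mult.commute)
    qed
  qed
qed

lemma scalar_sum_decay:
  assumes "scalar_sum m k \<mu> g" and m: "-1 \<le> m" "m \<le> k" and ze: "subpower m ze" and \<nu>: "\<nu> < - \<mu>"
  shows "decay m \<nu> (\<lambda>t. g (logs t) (ze t))"
  using assms(1)
proof induction
  case (zero g)
  have "eventually (\<lambda>t. g (logs t) (ze t) = 0) at_top"
    using eventually_logs_posdom[of k] subpower_pos[OF ze] by eventually_elim (simp add: zero)
  then show ?case by (rule decay_cong[OF decay_zero])
next
  case (add g \<alpha> h \<beta> c)
  have "eventually (\<lambda>t. h (logs t) (ze t) = g (logs t) (ze t) + pterm k (logs t) (ze t) (\<alpha>, \<beta>) * c) at_top"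
    using eventually_logs_posdom[of k] subpower_pos[OF ze] by eventually_elim (simp add: add.hyps)
  then show ?case
    by (rule decay_cong[OF decay_add[OF add.IH pterm_decay[OF add.hyps(2) m ze \<nu>]]])
qed

lemma Phat_decay:
  assumes p: "p \<in> Phat_m m k (- \<mu>)" and m: "-1 \<le> m" "m \<le> k" and ze: "subpower m ze"
  shows "decay_upto m \<mu> (\<lambda>t. p (logs t) (ze t))"
  unfolding decay_upto_def
proof (intro allI impI)
  fix \<nu> assume \<nu>: "\<nu> < \<mu>"
  have "decay m \<nu> (\<lambda>t. \<Sum>i\<in>UNIV. norm (complex_of_real (p (logs t) (ze t) $ i)))"
  proof (rule decay_sum)
    fix i
    have "decay m \<nu> (\<lambda>t. complex_of_real (p (logs t) (ze t) $ i))"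
      by (rule scalar_sum_decay[OF _ m ze]) (use p \<nu> in \<open>auto simp: Phat_iff_scalar_sum\<close>)
    then show "decay m \<nu> (\<lambda>t. norm (complex_of_real (p (logs t) (ze t) $ i)))"
      by (simp add: decay_def)
  qed
  then show "decay m \<nu> (\<lambda>t. p (logs t) (ze t))"
    by (rule decay_bound[where C=1])
      (auto intro!: always_eventually order_trans[OF norm_le_l1_cart])
qed

section \<open>Evaluation and differentiation along curves\<close>

lemma Phat_agree:
  assumes p: "p \<in> Phat_m m k \<mu>" and z: "z \<in> posdom k" "w \<in> posdom k"
    and eq: "\<And>j. j \<in> {-1..k} \<Longrightarrow> z j = w j" and \<zeta>: "0 < \<zeta>"
  shows "p z \<zeta> = p w \<zeta>"
proof -
  obtain S \<xi> where S: "power_rep k S \<xi> p" using p by (auto simp: Phat_power_rep)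
  have "zpow k z \<alpha> = zpow k w \<alpha>" for \<alpha> by (rule zpow_cong) (rule eq)
  then have "cvec (p z \<zeta>) = cvec (p w \<zeta>)"
    using power_repD(5)[OF S z(1) \<zeta>] power_repD(5)[OF S z(2) \<zeta>]
    by (simp add: power_sum_pterm pterm_def)
  then show ?thesis by (simp add: cvec_inject)
qed

lemma Phat_Lhat:
  assumes p: "p \<in> Phat_m m k \<mu>" and k: "k \<le> k'" and ze: "eventually (\<lambda>t. 0 < ze t) at_top"
  shows "eventually (\<lambda>t. p (Lhat k' t) (ze t) = p (logs t) (ze t)) at_top"
  using eventually_logs_posdom[of k'] ze
proof eventually_elim
  case (elim t)
  show ?case
    by (rule Phat_agree[OF p]) (use elim k in \<open>auto simp: posdom_def logs_def Lhat_def\<close>)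
qed

text \<open>Each monomial is the exponential of a linear form in the logarithms of z_j and \<zeta>,
  so its derivative is itself times that form in the logarithmic derivatives. Leaving the curve
  general serves three uses: along the logarithms, in \<zeta> alone, and in z_(-1) alone.\<close>

lemma power_rep_curve:
  assumes rep: "power_rep k S \<xi> p"
    and dom: "eventually (\<lambda>s. z s \<in> posdom k \<and> 0 < ze s) (nhds t)"
    and dz: "\<And>j. j \<in> {-1..k} \<Longrightarrow> ((\<lambda>s. ln (z s j)) has_real_derivative d j) (at t)"
    and dze: "(ze has_real_derivative e) (at t)"
  shows "((\<lambda>s. p (z s) (ze s)) has_vector_derivative Revec (\<Sum>x\<in>S. (pterm k (z t) (ze t) x *
    ((\<Sum>j\<in>{-1..k}. fst x j * of_real (d j)) + of_real (snd x * (e / ze t)))) *s \<xi> x)) (at t)"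
proof -
  have t: "z t \<in> posdom k" "0 < ze t" using eventually_nhds_x_imp_x[OF dom] by auto
  define E where "E x s = (\<Sum>j\<in>{-1..k}. fst x j * of_real (ln (z s j))) + of_real (snd x * ln (ze s))"
    for x :: pexp and s
  have E: "pterm k (z s) (ze s) x = exp (E x s)" if "z s \<in> posdom k" "0 < ze s" for x s
    using that by (simp add: pterm_def zpow_exp E_def exp_add powr_def flip: exp_of_real)
  have dE: "(E x has_vector_derivative ((\<Sum>j\<in>{-1..k}. fst x j * of_real (d j)) + of_real (snd x * (e / ze t)))) (at t)"
    for x
  proof -
    have "((\<lambda>s. snd x * ln (ze s)) has_real_derivative snd x * (e / ze t)) (at t)"
      using t by (auto intro!: derivative_eq_intros dze)
    then show ?thesis unfolding E_def
      by (intro has_vector_derivative_add has_vector_derivative_sum has_vector_derivative_mult_right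
          has_vector_derivative_of_real) (auto intro: dz[unfolded has_real_derivative_iff_has_vector_derivative]
          simp: has_real_derivative_iff_has_vector_derivative)
  qed
  have "((\<lambda>s. exp (E x s) *s \<xi> x) has_vector_derivative (exp (E x t) *
      ((\<Sum>j\<in>{-1..k}. fst x j * of_real (d j)) + of_real (snd x * (e / ze t)))) *s \<xi> x) (at t)" for x
  proof (rule bounded_linear.has_vector_derivative[where f="\<lambda>c. c *s \<xi> x"])
    show "bounded_linear (\<lambda>c. c *s \<xi> x)"
      by (rule bounded_bilinear.bounded_linear_left[OF bounded_bilinear_vector_smult])
    have "((exp \<circ> E x) has_vector_derivative ((\<Sum>j\<in>{-1..k}. fst x j * of_real (d j)) + of_real (snd x * (e / ze t)))
        * exp (E x t)) (at t)"
      by (rule field_vector_diff_chain_at[OF dE DERIV_exp])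
    then show "((\<lambda>s. exp (E x s)) has_vector_derivative exp (E x t) *
        ((\<Sum>j\<in>{-1..k}. fst x j * of_real (d j)) + of_real (snd x * (e / ze t)))) (at t)"
      by (simp add: o_def mult.commute)
  qed
  then have D: "((\<lambda>s. \<Sum>x\<in>S. exp (E x s) *s \<xi> x) has_vector_derivative (\<Sum>x\<in>S. (exp (E x t) *
      ((\<Sum>j\<in>{-1..k}. fst x j * of_real (d j)) + of_real (snd x * (e / ze t)))) *s \<xi> x)) (at t)"
    by (intro has_vector_derivative_sum)
  have Re: "bounded_linear (Revec :: complex^'a \<Rightarrow> real^'a)"
  proof (rule bounded_linear_intro[where K=1])
    show "norm (Revec x) \<le> norm x * 1" for x :: "complex^'a"
      unfolding norm_vec_def by (simp add: Revec_def) (intro L2_set_mono, auto simp: abs_Re_le_cmod)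
  qed (simp_all add: Revec_def vec_eq_iff)
  have ev: "eventually (\<lambda>s. Revec (\<Sum>x\<in>S. exp (E x s) *s \<xi> x) = p (z s) (ze s)) (nhds t)"
    using dom
  proof eventually_elim
    case (elim s)
    then have "(\<Sum>x\<in>S. exp (E x s) *s \<xi> x) = cvec (p (z s) (ze s))"
      by (simp add: power_repD(5)[OF rep] power_sum_pterm E)
    then show ?case by simp
  qed
  have "((\<lambda>s. Revec (\<Sum>x\<in>S. exp (E x s) *s \<xi> x)) has_vector_derivative Revec (\<Sum>x\<in>S. (exp (E x t) *
      ((\<Sum>j\<in>{-1..k}. fst x j * of_real (d j)) + of_real (snd x * (e / ze t)))) *s \<xi> x)) (at t)"
    by (rule bounded_linear.has_vector_derivative[OF Re D])
  then have "((\<lambda>s. p (z s) (ze s)) has_vector_derivative Revec (\<Sum>x\<in>S. (exp (E x t) *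
      ((\<Sum>j\<in>{-1..k}. fst x j * of_real (d j)) + of_real (snd x * (e / ze t)))) *s \<xi> x)) (at t)"
    unfolding has_vector_derivative_def
    by (rule has_derivative_transform_eventually[OF _ ev[unfolded eventually_nhds_conv_at, THEN conjunct1]])
      (use eventually_nhds_x_imp_x[OF ev] in auto)
  then show ?thesis by (simp only: E[OF t])
qed

lemma eventually_nhds_logs:
  assumes "logs t \<in> posdom k"
  shows "eventually (\<lambda>s. logs s \<in> posdom k) (nhds t)"
proof -
  have "eventually (\<lambda>s. 0 < L j s) (nhds t)" if j: "j \<in> {-1..k}" for j
  proof (cases "j = -1")
    case False
    with j have j0: "-1 \<le> j - 1" by auto
    have "(L (j - 1 + 1) has_real_derivative (\<Prod>i\<in>{0..j - 1}. inverse (L i t))) (at t)"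
      by (rule L_has_derivative[OF j0]) (use assms j in \<open>auto simp: logs_posdom_iff\<close>)
    then have "(L j \<longlongrightarrow> L j t) (at t)"
      using DERIV_isCont isContD by fastforce
    moreover have "0 < L j t" using assms j by (simp add: logs_posdom_iff)
    ultimately show ?thesis by (simp add: eventually_nhds_conv_at order_tendstoD(1))
  qed simp
  then have "eventually (\<lambda>s. \<forall>j\<in>{-1..k}. 0 < L j s) (nhds t)"
    by (intro eventually_ball_finite) auto
  then show ?thesis by (simp add: logs_posdom_iff)
qed

lemma Revec_linear: "Revec (v + w) = Revec v + Revec w" "Revec (of_real r *s v) = r *\<^sub>R Revec v"
  by (simp_all add: Revec_def vec_eq_iff)

lemma Revec_sum: "Revec (\<Sum>x\<in>X. f x) = (\<Sum>x\<in>X. Revec (f x))"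
  by (induction X rule: infinite_finite_induct) (simp_all add: Revec_linear, simp_all add: Revec_def vec_eq_iff)

lemma opM_eq:
  "power_rep k S \<xi> p \<Longrightarrow> z \<in> posdom k \<Longrightarrow> 0 < \<zeta> \<Longrightarrow>
    opM k j p z \<zeta> = Revec (\<Sum>x\<in>S. (pterm k z \<zeta> x * fst x j) *s \<xi> x)"
  using power_repD(5)[OF opM_rep, of k S \<xi> p z \<zeta> j] Revec_cvec[of "opM k j p z \<zeta>"]
  by (simp add: power_sum_pterm case_prod_beta vector_smult_assoc)

text \<open>The chain rule: ln L_j has derivative 1/(L_0 ... L_j). The index -1 gives the factor one
  and is kept apart, the indices from 0 on add up to the operator R.\<close>

lemma Phat_logs_derivative:
  assumes p: "p \<in> Phat_m m k \<mu>" and k: "-1 \<le> k" and t: "logs t \<in> posdom k"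
    and ze: "eventually (\<lambda>s. 0 < ze s) (nhds t)" and dze: "(ze has_real_derivative e) (at t)"
  shows "((\<lambda>s. p (logs s) (ze s)) has_vector_derivative
    (opM k (-1) p (logs t) (ze t) + opR k p (logs t) (ze t)
      + e *\<^sub>R vector_derivative (\<lambda>s. p (logs t) s) (at (ze t)))) (at t)"
proof -
  obtain S \<xi> where rep: "power_rep k S \<xi> p" using p by (auto simp: Phat_power_rep)
  have \<zeta>: "0 < ze t" using eventually_nhds_x_imp_x[OF ze] .
  define d where "d j = (\<Prod>i\<in>{0..j}. inverse (L i t))" for j :: int
  let ?P = "\<lambda>x. pterm k (logs t) (ze t) x"
  have "((\<lambda>s. p (logs s) (ze s)) has_vector_derivative Revec (\<Sum>x\<in>S. (?P x *
    ((\<Sum>j\<in>{-1..k}. fst x j * of_real (d j)) + of_real (snd x * (e / ze t)))) *s \<xi> x)) (at t)"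
  proof (rule power_rep_curve[OF rep _ _ dze])
    show "eventually (\<lambda>s. logs s \<in> posdom k \<and> 0 < ze s) (nhds t)"
      using eventually_nhds_logs[OF t] ze by (rule eventually_conj)
    fix j assume j: "j \<in> {-1..k}"
    have "(L (j + 1) has_real_derivative d j) (at t)"
      unfolding d_def by (rule L_has_derivative) (use t j in \<open>auto simp: logs_posdom_iff\<close>)
    moreover have "L (j + 1) = (\<lambda>s. ln (logs s j))"
      using j by (simp add: fun_eq_iff logs_def L_step)
    ultimately show "((\<lambda>s. ln (logs s j)) has_real_derivative d j) (at t)" by simp
  qed
  moreover have "vector_derivative (\<lambda>s. p (logs t) s) (at (ze t))
      = Revec (\<Sum>x\<in>S. (?P x * of_real (snd x / ze t)) *s \<xi> x)"
  proof (rule vector_derivative_at)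
    have "((\<lambda>s. p (logs t) s) has_vector_derivative Revec (\<Sum>x\<in>S. (?P x *
      ((\<Sum>j\<in>{-1..k}. fst x j * of_real 0) + of_real (snd x * (1 / ze t)))) *s \<xi> x)) (at (ze t))"
      by (rule power_rep_curve[OF rep, where z="\<lambda>_. logs t" and ze="\<lambda>s. s"])
        (use t \<zeta> in \<open>auto intro: eventually_nhds_in_open[of "{0<..}", simplified]\<close>)
    then show "((\<lambda>s. p (logs t) s) has_vector_derivative
      Revec (\<Sum>x\<in>S. (?P x * of_real (snd x / ze t)) *s \<xi> x)) (at (ze t))" by simp
  qed
  moreover have "opR k p (logs t) (ze t) = (\<Sum>j\<in>{0..k}. d j *\<^sub>R Revec (\<Sum>x\<in>S. (?P x * fst x j) *s \<xi> x))"
    by (simp add: opR_def opM_eq[OF rep t \<zeta>] d_def) (simp add: logs_def)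
  moreover have "Revec (\<Sum>x\<in>S. (?P x *
    ((\<Sum>j\<in>{-1..k}. fst x j * of_real (d j)) + of_real (snd x * (e / ze t)))) *s \<xi> x)
    = Revec (\<Sum>x\<in>S. (?P x * fst x (-1)) *s \<xi> x)
    + (\<Sum>j\<in>{0..k}. d j *\<^sub>R Revec (\<Sum>x\<in>S. (?P x * fst x j) *s \<xi> x))
    + e *\<^sub>R Revec (\<Sum>x\<in>S. (?P x * of_real (snd x / ze t)) *s \<xi> x)"
  proof -
    have set: "{-1..k} = insert (-1) {0..k}" using k by auto
    \<comment> \<open>The product over \<open>{0..-1}\<close> is empty, in accordance with ln e^t =
      t.\<close>
    have d1: "d (-1) = 1" by (simp add: d_def)
    have "(?P x * ((\<Sum>j\<in>{-1..k}. fst x j * of_real (d j)) + of_real (snd x * (e / ze t)))) *s \<xi> x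
      = (?P x * fst x (-1)) *s \<xi> x + (\<Sum>j\<in>{0..k}. of_real (d j) *s ((?P x * fst x j) *s \<xi> x))
        + of_real e *s ((?P x * of_real (snd x / ze t)) *s \<xi> x)" for x
      unfolding set
      by (simp add: d1 vec_eq_iff algebra_simps sum_distrib_left sum_distrib_right)
    then have "(\<Sum>x\<in>S. (?P x * ((\<Sum>j\<in>{-1..k}. fst x j * of_real (d j)) + of_real (snd x * (e / ze t)))) *s \<xi> x)
      = (\<Sum>x\<in>S. (?P x * fst x (-1)) *s \<xi> x) + (\<Sum>j\<in>{0..k}. of_real (d j) *s (\<Sum>x\<in>S. (?P x * fst x j) *s \<xi> x))
        + of_real e *s (\<Sum>x\<in>S. (?P x * of_real (snd x / ze t)) *s \<xi> x)"
      by (simp only: sum.distrib vec.scale_sum_right sum.swap[of _ "{0..k}" S])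
    then show ?thesis by (simp only: Revec_linear Revec_sum[of _ "{0..k}"])
  qed
  ultimately show ?thesis by (simp only: opM_eq[OF rep t \<zeta>])
qed

section \<open>The leading factor substituted for \<zeta>\<close>

lemma P_plus_repE:
  assumes "p0 \<in> P_plus m k"
  obtains S \<xi> where "power_rep k S \<xi> (lift1 p0)"
    "\<And>s. s \<in> S \<Longrightarrow> fst s \<in> EC m k 0 \<and> fst s (-1) = 0 \<and> snd s = 0"
  using assms unfolding P_plus_def by (auto simp: case_prod_beta)

lemma P_plus_Phat: "p0 \<in> P_plus m k \<Longrightarrow> lift1 p0 \<in> Phat_m m k 0"
  by (elim P_plus_repE) (auto simp: Phat_power_rep)

lemma P_plus_scalar_sum: "p0 \<in> P_plus m k \<Longrightarrow> scalar_sum m k 0 (\<lambda>z \<zeta>. of_real (p0 z))"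
  using P_plus_Phat[of p0 m k] by (simp add: Phat_iff_scalar_sum lift1_def)

text \<open>Without exponents at z_(-1) only the R part of the derivative is left; it is the factor
  of the \<zeta>-derivative in \<chi>.\<close>

lemma P_plus_derivative:
  assumes p0: "p0 \<in> P_plus m k" and k: "-1 \<le> k" and t: "logs t \<in> posdom k" and \<zeta>: "0 < \<zeta>"
  shows "((\<lambda>s. p0 (logs s)) has_real_derivative opR k (lift1 p0) (logs t) \<zeta> $ 1) (at t)"
proof -
  obtain S \<xi> where rep: "power_rep k S \<xi> (lift1 p0)"
    and S: "\<And>s. s \<in> S \<Longrightarrow> fst s \<in> EC m k 0 \<and> fst s (-1) = 0 \<and> snd s = 0"
    using p0 by (elim P_plus_repE) blast
  have "((\<lambda>s. lift1 p0 (logs s) \<zeta>) has_vector_derivative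
    (opM k (-1) (lift1 p0) (logs t) \<zeta> + opR k (lift1 p0) (logs t) \<zeta>
      + 0 *\<^sub>R vector_derivative (\<lambda>s. lift1 p0 (logs t) s) (at \<zeta>))) (at t)"
    by (rule Phat_logs_derivative[OF P_plus_Phat[OF p0] k t, where ze="\<lambda>_. \<zeta>"]) (use \<zeta> in auto)
  moreover have "opM k (-1) (lift1 p0) (logs t) \<zeta> = 0"
    unfolding opM_eq[OF rep t \<zeta>] using S by (simp add: Revec_def vec_eq_iff)
  ultimately have "((\<lambda>s. lift1 p0 (logs s) \<zeta>) has_vector_derivative opR k (lift1 p0) (logs t) \<zeta>) (at t)"
    by simp
  from bounded_linear.has_vector_derivative[OF bounded_linear_vec_nth[of 1] this]
  show ?thesis by (simp add: lift1_def has_real_derivative_iff_has_vector_derivative)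
qed

text \<open>The function is asymptotic to c times its leading monomial, and the exponents of that
  monomial vanish at all positions up to m. So its logarithm is o(L_(m+1)). That the leading
  monomial obeys the class condition is not immediate, because the class and the leading term are
  given by two separate representations; uniqueness of coefficients links them.\<close>

lemma P_plus_subpower:
  assumes p0: "p0 \<in> P_plus m k" and m: "0 \<le> m" "m \<le> k"
  shows "subpower m (\<lambda>t. p0 (logs t))"
proof -
  obtain S \<xi> where rep: "power_rep k S \<xi> (lift1 p0)"
    and S: "\<And>s. s \<in> S \<Longrightarrow> fst s \<in> EC m k 0 \<and> fst s (-1) = 0 \<and> snd s = 0"
    using p0 by (elim P_plus_repE) blast
  obtain c a q S' \<xi>' where c: "0 < c" and a0: "\<And>j. j \<notin> {-1..k} \<Longrightarrow> a j = 0"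
    and rep': "power_rep k S' \<xi>' (lift1 q)"
    and lex: "\<And>s. s \<in> S' \<Longrightarrow> lex_less k (Re \<circ> fst s) a \<and> snd s = 0"
    and eq: "\<And>z. z \<in> posdom k \<Longrightarrow> p0 z = c * (\<Prod>j\<in>{-1..k}. z j powr a j) + q z"
    using p0 unfolding P_plus_def mem_Collect_eq case_prod_beta by blast
  define x :: pexp where "x = (of_real \<circ> a, 0)"
  have lead: "pterm k z \<zeta> x = of_real (\<Prod>j\<in>{-1..k}. z j powr a j)" if "z \<in> posdom k" "0 < \<zeta>" for z \<zeta>
    unfolding pterm_def zpow_def x_def of_real_prod
    using that posdomD[OF that(1)] by (simp add: powr_of_real less_imp_le)
  have "x \<notin> S'"
    using lex by (fastforce simp: x_def lex_less_def)
  \<comment> \<open>Lexicographic strictness keeps the leading exponent out of the lower terms, so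
    its coefficient c cannot cancel and it must occur in the first representation. Being real, it
    then vanishes wherever its real part does.\<close>
  have "a j = 0" if "j \<le> m" for j
  proof -
    have "extend S \<xi> = extend (insert x S') (\<xi>'(x := \<chi> i. of_real c))"
    proof (rule power_sum_unique)
      show "finite S" "finite (insert x S')" using power_repD(1)[OF rep] power_repD(1)[OF rep'] by auto
      show "fst s j = 0" if "s \<in> S \<union> insert x S'" "j \<notin> {-1..k}" for s j
        using that power_repD(2)[OF rep, of s j] power_repD(2)[OF rep', of s j] a0[of j]
        by (auto simp: x_def)
      fix z and \<zeta> :: real assume z: "z \<in> posdom k" "0 < \<zeta>"
      have "power_sum k S \<xi> z \<zeta> = cvec (lift1 p0 z \<zeta>)" by (simp add: power_repD(5)[OF rep z])
      also have "\<dots> = pterm k z \<zeta> x *s (\<chi> i. of_real c) + cvec (lift1 q z \<zeta>)"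
        by (simp add: lead[OF z] eq[OF z(1)] lift1_def cvec_def vec_eq_iff mult.commute)
      also have "\<dots> = power_sum k (insert x S') (\<xi>'(x := \<chi> i. of_real c)) z \<zeta>"
        using \<open>x \<notin> S'\<close> power_repD(1)[OF rep']
        by (simp add: power_repD(5)[OF rep' z] power_sum_pterm) (rule sum.cong, auto)
      finally show "power_sum k S \<xi> z \<zeta> = power_sum k (insert x S') (\<xi>'(x := \<chi> i. of_real c)) z \<zeta>" .
    qed
    from fun_cong[OF this, of x] c have "x \<in> S"
      by (auto simp: extend_def vec_eq_iff split: if_splits)
    from S[OF this] that show ?thesis
      by (cases "j < -1"; cases "j = m") (auto simp: x_def EC_def a0)
  qed
  note a = this
  define G where "G t = (\<Sum>j\<in>{-1..k}. a j * L (j + 1) t)" for t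
  have lim: "((\<lambda>t. p0 (logs t) / exp (G t)) \<longlongrightarrow> c) at_top"
  proof -
    have small: "((\<lambda>t. pterm k (logs t) 1 s * \<xi>' s $ 1 / of_real (exp (G t))) \<longlongrightarrow> 0) at_top"
      if s: "s \<in> S'" for s
    proof -
      from lex[OF s] obtain i where i: "i \<in> {-1..k}" "Re (fst s i) < a i"
        "\<And>j. j \<in> {-1..<i} \<Longrightarrow> Re (fst s j) = a j" unfolding lex_less_def by auto
      \<comment> \<open>The exponents of a lower term divided by the leading monomial. The first
        nonzero entry is negative; half of it absorbs all later positions and the other half gives
        convergence to zero.\<close>
      define b where "b j = Re (fst s j) - a j" for j
      have "0 < - b i / 2" using i by (simp add: b_def)
      from log_growth[of i k b, OF _ _ _ this] i
      have ev: "eventually (\<lambda>t. \<bar>(\<Sum>j\<in>{-1..k}. b j * L (j + 1) t) - b i * L (i + 1) t\<bar>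
          \<le> - b i / 2 * L (i + 1) t) at_top" by (auto simp: b_def)
      have lim: "((\<lambda>t. norm (\<xi>' s $ 1) * exp (b i / 2 * L (i + 1) t)) \<longlongrightarrow> 0) at_top"
      proof -
        have "filterlim (\<lambda>t. b i / 2 * L (i + 1) t) at_bot at_top"
          using i by (intro filterlim_tendsto_neg_mult_at_bot[OF tendsto_const] filterlim_L)
            (auto simp: b_def)
        from filterlim_compose[OF exp_at_bot this] show ?thesis
          by (intro tendsto_mult_right_zero)
      qed
      show ?thesis
      proof (rule Lim_null_comparison[OF _ lim])
        show "eventually (\<lambda>t. norm (pterm k (logs t) 1 s * \<xi>' s $ 1 / of_real (exp (G t)))
            \<le> norm (\<xi>' s $ 1) * exp (b i / 2 * L (i + 1) t)) at_top"
          using ev eventually_logs_posdom[of k]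
        proof eventually_elim
          case (elim t)
          have "norm (pterm k (logs t) 1 s) / exp (G t) = exp (\<Sum>j\<in>{-1..k}. b j * L (j + 1) t)"
            using elim by (simp add: norm_pterm_logs G_def b_def exp_diff left_diff_distrib sum_subtractf)
          also have "\<dots> \<le> exp (b i / 2 * L (i + 1) t)" using elim by (simp add: abs_le_iff)
          finally have "norm (\<xi>' s $ 1) * (norm (pterm k (logs t) 1 s) / exp (G t))
              \<le> norm (\<xi>' s $ 1) * exp (b i / 2 * L (i + 1) t)" by (intro mult_left_mono) auto
          then show ?case by (simp add: norm_mult norm_divide mult.commute)
        qed
      qed
    qed
    have "((\<lambda>t. of_real c + (\<Sum>s\<in>S'. pterm k (logs t) 1 s * \<xi>' s $ 1 / of_real (exp (G t))))
        \<longlongrightarrow> of_real c + (\<Sum>s\<in>S'. 0)) at_top"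
      by (intro tendsto_intros small)
    then have *: "((\<lambda>t. Re (of_real c + (\<Sum>s\<in>S'. pterm k (logs t) 1 s * \<xi>' s $ 1 / of_real (exp (G t)))))
        \<longlongrightarrow> c) at_top"
      using tendsto_Re by fastforce
    show ?thesis
    proof (rule Lim_transform_eventually[OF *])
      show "eventually (\<lambda>t. Re (of_real c + (\<Sum>s\<in>S'. pterm k (logs t) 1 s * \<xi>' s $ 1 / of_real (exp (G t))))
          = p0 (logs t) / exp (G t)) at_top"
        using eventually_logs_posdom[of k]
      proof eventually_elim
        case (elim t)
        have "(\<Prod>j\<in>{-1..k}. logs t j powr a j) = exp (G t)"
          unfolding G_def exp_sum[OF finite_atLeastAtMost_int]
          using posdomD[OF elim]
          by (intro prod.cong) (auto simp: powr_def logs_def L_step less_imp_neq[THEN not_sym])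
        then have p0: "p0 (logs t) = c * exp (G t) + q (logs t)" by (simp add: eq[OF elim])
        have "complex_of_real (q (logs t)) = cvec (lift1 q (logs t) 1) $ 1"
          by (simp add: lift1_def cvec_def)
        also have "\<dots> = (\<Sum>s\<in>S'. pterm k (logs t) 1 s * \<xi>' s $ 1)"
          by (simp add: power_repD(5)[OF rep' elim] power_sum_pterm)
        finally have "(\<Sum>s\<in>S'. pterm k (logs t) 1 s * \<xi>' s $ 1 / of_real (exp (G t)))
            = of_real (q (logs t) / exp (G t))" by (simp add: sum_divide_distrib)
        then show ?case unfolding p0 by (simp only: plus_complex.sel Re_complex_of_real) (simp add: field_simps)
      qed
    qed
  qed
  show ?thesis unfolding subpower_def
  proof (intro allI impI)
    fix \<epsilon> :: real assume e: "0 < \<epsilon>"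
    \<comment> \<open>The quotient by the leading monomial ends up between c/2 and 2c, so B bounds
      its logarithm; the third condition below makes this constant at most half of the permitted
      amount.\<close>
    define B where "B = max \<bar>ln (c / 2)\<bar> \<bar>ln (2 * c)\<bar>"
    have 1: "eventually (\<lambda>t. c / 2 < p0 (logs t) / exp (G t)) at_top"
      "eventually (\<lambda>t. p0 (logs t) / exp (G t) < 2 * c) at_top"
      by (rule order_tendstoD[OF lim], use c in simp)+
    have 2: "eventually (\<lambda>t. \<bar>G t - a m * L (m + 1) t\<bar> \<le> \<epsilon> / 2 * L (m + 1) t) at_top"
      unfolding G_def by (rule log_growth) (use m a e in auto)
    have 3: "eventually (\<lambda>t. 2 * B / \<epsilon> < L (m + 1) t) at_top"
      using m by (intro eventually_L_gt) auto
    show "eventually (\<lambda>t. 0 < p0 (logs t) \<and> \<bar>ln (p0 (logs t))\<bar> \<le> \<epsilon> * L (m + 1) t) at_top"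
      using 1 2 3
    proof eventually_elim
      case (elim t)
      define r where "r = p0 (logs t) / exp (G t)"
      have r: "c / 2 < r" "r < 2 * c" using elim by (simp_all add: r_def)
      then have r0: "0 < r" using c by simp
      have p0: "p0 (logs t) = r * exp (G t)" by (simp add: r_def)
      have "ln (c / 2) \<le> ln r" "ln r \<le> ln (2 * c)" using r r0 c by (auto intro: ln_mono)
      then have "\<bar>ln r\<bar> \<le> B" unfolding B_def by linarith
      moreover have "ln (p0 (logs t)) = ln r + G t" using r0 by (simp add: p0 ln_mult)
      moreover have "B \<le> \<epsilon> / 2 * L (m + 1) t" using elim e by (simp add: field_simps)
      moreover have "\<bar>G t\<bar> \<le> \<epsilon> / 2 * L (m + 1) t" using elim a[of m] by simp
      ultimately have "\<bar>ln (p0 (logs t))\<bar> \<le> \<epsilon> * L (m + 1) t" by linarith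
      with r0 show ?case by (simp add: p0)
    qed
  qed
qed

section \<open>The exponents\<close>

text \<open>The successor function of S is iterated. An element missed by the iteration would lie
  above infinitely many others, contrary to local finiteness.\<close>

lemma locally_finite_enumeration:
  fixes S :: "real set"
  assumes nonneg: "\<And>s. s \<in> S \<Longrightarrow> 0 \<le> s" and inf: "infinite S" and fin: "\<And>B. finite (S \<inter> {..B})"
  shows "\<exists>s. strict_mono_on {1::nat..} s \<and> s ` {1..} = S"
proof -
  have "\<exists>y\<in>S. x < y \<and> (\<forall>y'\<in>S. x < y' \<longrightarrow> y \<le> y')" for x
  proof -
    have "\<not> S \<subseteq> S \<inter> {..x}" using inf fin finite_subset by blast
    then obtain y0 where y0: "y0 \<in> S" "x < y0" by force
    define M where "M = {y \<in> S. x < y \<and> y \<le> y0}"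
    have M: "finite M" "y0 \<in> M"
      using y0 by (auto simp: M_def intro: finite_subset[OF _ fin[of y0]])
    then have "Min M \<in> M" by (intro Min_in) auto
    moreover have "Min M \<le> y'" if "y' \<in> S" "x < y'" for y'
    proof (cases "y' \<le> y0")
      case True
      with that M show ?thesis by (intro Min_le) (auto simp: M_def)
    next
      case False
      with Min_le[OF M] show ?thesis by simp
    qed
    ultimately show ?thesis by (intro bexI[of _ "Min M"]) (auto simp: M_def)
  qed
  then obtain nxt where nxt: "\<And>x. nxt x \<in> S" "\<And>x. x < nxt x" "\<And>x y. y \<in> S \<Longrightarrow> x < y \<Longrightarrow> nxt x \<le> y"
    by metis
  \<comment> \<open>The start -1 lies below every element of S, so the first iterate is the least
    element; \<open>Suc n\<close> leaves the start itself out.\<close>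
  define e where "e n = (nxt ^^ Suc n) (-1)" for n
  have e0: "e 0 = nxt (-1)" and eS: "e (Suc n) = nxt (e n)" for n by (simp_all add: e_def)
  have mono: "strict_mono e" by (rule strict_monoI_Suc) (simp add: eS nxt)
  have in_S: "e n \<in> S" for n by (cases n) (simp_all add: e0 eS nxt)
  have "s \<in> range e" if s: "s \<in> S" for s
  proof (rule ccontr)
    assume no: "s \<notin> range e"
    have "e n < s" for n
    proof (induction n)
      case 0
      have "e 0 \<le> s" using nxt(3)[OF s, of "-1"] nonneg[OF s] by (simp add: e0)
      with no show ?case by (metis order_le_less rangeI)
    next
      case (Suc n)
      then have "e (Suc n) \<le> s" using nxt(3)[OF s] by (simp add: eS)
      with no show ?case by (metis order_le_less rangeI)
    qed
    then have "range e \<subseteq> S \<inter> {..s}" using in_S by (auto simp: less_imp_le)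
    then have "finite (range e)" using fin finite_subset by blast
    then show False using range_inj_infinite[OF strict_mono_imp_inj_on[OF mono]] by blast
  qed
  then have range: "range e = S" using in_S by auto
  show ?thesis
  proof (intro exI[of _ "\<lambda>k. e (k - 1)"] conjI)
    show "strict_mono_on {1..} (\<lambda>k. e (k - 1))"
      using mono by (auto simp: strict_mono_on_def strict_mono_def)
    have "(\<lambda>k. e (k - 1)) ` {1..} = range e"
    proof (rule set_eqI, rule iffI)
      fix y assume "y \<in> range e"
      then obtain n where "y = e n" by auto
      then show "y \<in> (\<lambda>k. e (k - 1)) ` {1..}" by (intro image_eqI[of _ _ "Suc n"]) auto
    qed auto
    with range show "(\<lambda>k. e (k - 1)) ` {1..} = S" by simp
  qed
qed

text \<open>Covers finite and infinite index sets at once: apart from signs, what the alternatives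
  have in common is that only finitely many exponents lie below any bound. A nonempty J makes the
  set of exponents infinite, so that the enumeration never stops.\<close>

locale exponents =
  fixes m :: nat and J :: "nat set" and \<beta> :: "nat \<Rightarrow> real" and I :: "nat set" and \<gamma> :: "nat \<Rightarrow> real"
  assumes gamma1_pos: "0 < \<gamma> 1" and one_in_I: "1 \<in> I"
    and gamma_gt: "\<And>k. k \<in> I \<Longrightarrow> k \<noteq> 1 \<Longrightarrow> \<gamma> 1 < \<gamma> k"
    and gamma_inj: "inj_on \<gamma> I"
    and gamma_fin: "\<And>B. finite {k \<in> I. \<gamma> k \<le> B}"
    and J_nonempty: "J \<noteq> {}" and beta_gt: "\<And>j. j \<in> J \<Longrightarrow> 1 < \<beta> j"
    and beta_fin: "\<And>B. finite {j \<in> J. \<beta> j \<le> B}"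
begin

abbreviation "S \<equiv> Stilde m J \<beta> I \<gamma>"
abbreviation "\<mu> \<equiv> mu m J \<beta> I \<gamma>"

lemma sum_support:
  fixes f :: "nat \<Rightarrow> real" and a :: "nat \<Rightarrow> nat"
  assumes "finite U" "{k. a k \<noteq> 0} \<subseteq> U" "\<And>k. a k = 0 \<Longrightarrow> f k = 0"
  shows "(\<Sum>k | a k \<noteq> 0. f k) = sum f U"
  by (rule sum.mono_neutral_left) (use assms in auto)

lemma S_add:
  assumes "s \<in> S" "s' \<in> S"
  shows "s + s' \<in> S"
proof -
  obtain a b and \<kappa> :: nat where 1: "finite {k. a k \<noteq> (0::nat)}" "{k. a k \<noteq> 0} \<subseteq> I"
    "finite {j. b j \<noteq> (0::nat)}" "{j. b j \<noteq> 0} \<subseteq> J"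
    "s = (\<Sum>k | a k \<noteq> 0. real (a k) * (\<gamma> k - \<gamma> 1))
      + (\<Sum>j | b j \<noteq> 0. real (b j) * (\<beta> j - 1) * \<gamma> 1) + (1 - sgn (real m)) * real \<kappa>"
    using assms(1) unfolding Stilde_def by blast
  obtain a' b' and \<kappa>' :: nat where 2: "finite {k. a' k \<noteq> (0::nat)}" "{k. a' k \<noteq> 0} \<subseteq> I"
    "finite {j. b' j \<noteq> (0::nat)}" "{j. b' j \<noteq> 0} \<subseteq> J"
    "s' = (\<Sum>k | a' k \<noteq> 0. real (a' k) * (\<gamma> k - \<gamma> 1))
      + (\<Sum>j | b' j \<noteq> 0. real (b' j) * (\<beta> j - 1) * \<gamma> 1) + (1 - sgn (real m)) * real \<kappa>'"
    using assms(2) unfolding Stilde_def by blast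
  let ?U = "{k. a k \<noteq> 0} \<union> {k. a' k \<noteq> 0}" and ?V = "{j. b j \<noteq> 0} \<union> {j. b' j \<noteq> 0}"
  have fin: "finite ?U" "finite ?V" using 1 2 by auto
  have "s + s' = (\<Sum>k | a k + a' k \<noteq> 0. real (a k + a' k) * (\<gamma> k - \<gamma> 1))
      + (\<Sum>j | b j + b' j \<noteq> 0. real (b j + b' j) * (\<beta> j - 1) * \<gamma> 1)
      + (1 - sgn (real m)) * real (\<kappa> + \<kappa>')"
    unfolding 1(5) 2(5)
    using sum_support[OF fin(1), of a "\<lambda>k. real (a k) * (\<gamma> k - \<gamma> 1)"]
      sum_support[OF fin(1), of a' "\<lambda>k. real (a' k) * (\<gamma> k - \<gamma> 1)"]
      sum_support[OF fin(1), of "\<lambda>k. a k + a' k" "\<lambda>k. real (a k + a' k) * (\<gamma> k - \<gamma> 1)"]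
      sum_support[OF fin(2), of b "\<lambda>k. real (b k) * (\<beta> k - 1) * \<gamma> 1"]
      sum_support[OF fin(2), of b' "\<lambda>k. real (b' k) * (\<beta> k - 1) * \<gamma> 1"]
      sum_support[OF fin(2), of "\<lambda>k. b k + b' k" "\<lambda>k. real (b k + b' k) * (\<beta> k - 1) * \<gamma> 1"]
    by (simp add: sum.distrib distrib_right distrib_left subset_eq del: sum.mono_neutral_left)
  moreover have "{k. a k + a' k \<noteq> 0} = ?U" "{j. b j + b' j \<noteq> 0} = ?V" by auto
  ultimately show ?thesis
    unfolding Stilde_def using fin 1 2
    by (intro CollectI exI[of _ "\<lambda>k. a k + a' k"] exI[of _ "\<lambda>j. b j + b' j"] exI[of _ "\<kappa> + \<kappa>'"]) auto
qed

lemma S_zero: "0 \<in> S"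
  unfolding Stilde_def by (intro CollectI exI[of _ "\<lambda>_. 0"] exI[of _ 0]) simp

lemma S_gamma: "k \<in> I \<Longrightarrow> \<gamma> k - \<gamma> 1 \<in> S"
proof -
  assume k: "k \<in> I"
  have "{i. (if i = k then 1 else 0) \<noteq> (0::nat)} = {k}" by auto
  with k show ?thesis
    unfolding Stilde_def
    by (intro CollectI exI[of _ "\<lambda>i. if i = k then 1 else 0"] exI[of _ "\<lambda>_. 0"] exI[of _ 0]) simp
qed

lemma S_beta: "j \<in> J \<Longrightarrow> (\<beta> j - 1) * \<gamma> 1 \<in> S"
proof -
  assume j: "j \<in> J"
  have "{i. (if i = j then 1 else 0) \<noteq> (0::nat)} = {j}" by auto
  with j show ?thesis
    unfolding Stilde_def
    by (intro CollectI exI[of _ "\<lambda>_. 0"] exI[of _ "\<lambda>i. if i = j then 1 else 0"] exI[of _ 0]) simp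
qed

lemma S_one: "m = 0 \<Longrightarrow> 1 \<in> S"
  unfolding Stilde_def
  by (intro CollectI exI[of _ "\<lambda>_. 0"] exI[of _ "\<lambda>_. 0"] exI[of _ 1]) simp

text \<open>The index 1 is left out because it would contribute the generator 0; all others are
  positive. The generator 1 stands for \<kappa>, whose factor \<open>1 - sgn (real m)\<close> is
  nonzero only for m = 0.\<close>

definition gens :: "real set" where "gens = (\<lambda>k. \<gamma> k - \<gamma> 1) ` (I - {1}) \<union> (\<lambda>j. (\<beta> j - 1) * \<gamma> 1) ` J \<union> (if m = 0 then {1} else {})"

lemma gens_pos: "g \<in> gens \<Longrightarrow> 0 < g"
proof -
  have "0 < \<gamma> k - \<gamma> 1" if "k \<in> I - {1}" for k
    using gamma_gt that by auto
  moreover have "0 < (\<beta> j - 1) * \<gamma> 1" if "j \<in> J" for j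
    using beta_gt[OF that] gamma1_pos by simp
  ultimately show "g \<in> gens \<Longrightarrow> 0 < g"
    unfolding gens_def by (elim UnE imageE) (blast, blast, simp split: if_splits)
qed

lemma gens_fin: "finite (gens \<inter> {..B})"
proof (rule finite_subset)
  show "gens \<inter> {..B} \<subseteq> (\<lambda>k. \<gamma> k - \<gamma> 1) ` {k \<in> I. \<gamma> k \<le> B + \<gamma> 1}
      \<union> (\<lambda>j. (\<beta> j - 1) * \<gamma> 1) ` {j \<in> J. \<beta> j \<le> B / \<gamma> 1 + 1} \<union> {1}"
    using gamma1_pos by (auto simp: gens_def field_simps split: if_splits)
qed (use gamma_fin beta_fin in auto)

text \<open>Finite sums written as lists, so that the number of summands can be counted. Containing
  S is enough for nonnegativity and local finiteness.\<close>

definition gspan :: "real set" where "gspan = {sum_list xs |xs. set xs \<subseteq> gens}"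

lemma gspan_zero: "0 \<in> gspan"
  unfolding gspan_def by (auto intro: exI[of _ "[]"])

lemma gspan_add: "x \<in> gspan \<Longrightarrow> y \<in> gspan \<Longrightarrow> x + y \<in> gspan"
proof -
  assume "x \<in> gspan" "y \<in> gspan"
  then obtain xs ys where "x = sum_list xs" "set xs \<subseteq> gens" "y = sum_list ys" "set ys \<subseteq> gens"
    by (auto simp: gspan_def)
  then show ?thesis unfolding gspan_def by (intro CollectI exI[of _ "xs @ ys"]) auto
qed

lemma gspan_gen: "g \<in> gens \<Longrightarrow> g \<in> gspan"
  unfolding gspan_def by (intro CollectI exI[of _ "[g]"]) auto

lemma gspan_mult: "g \<in> gens \<or> g = 0 \<Longrightarrow> real n * g \<in> gspan"
  by (induction n) (auto simp: gspan_zero distrib_right intro: gspan_add gspan_gen)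

lemma gspan_sum: "(\<And>x. x \<in> X \<Longrightarrow> f x \<in> gspan) \<Longrightarrow> sum f X \<in> gspan"
  by (induction X rule: infinite_finite_induct) (auto intro: gspan_zero gspan_add)

lemma S_subset_gspan: "S \<subseteq> gspan"
proof
  fix s assume "s \<in> S"
  then obtain a b and \<kappa> :: nat where 1: "{k. a k \<noteq> 0} \<subseteq> I" "{j. b j \<noteq> 0} \<subseteq> J"
    "s = (\<Sum>k | a k \<noteq> 0. real (a k) * (\<gamma> k - \<gamma> 1))
      + (\<Sum>j | b j \<noteq> 0. real (b j) * (\<beta> j - 1) * \<gamma> 1) + (1 - sgn (real m)) * real \<kappa>"
    unfolding Stilde_def by blast
  have "real \<kappa> * (1 - sgn (real m)) \<in> gspan"
    by (rule gspan_mult) (auto simp: gens_def)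
  moreover have "real (a k) * (\<gamma> k - \<gamma> 1) \<in> gspan" if "a k \<noteq> 0" for k
    by (rule gspan_mult) (use 1 that in \<open>auto simp: gens_def\<close>)
  moreover have "real (b j) * ((\<beta> j - 1) * \<gamma> 1) \<in> gspan" if "b j \<noteq> 0" for j
    by (rule gspan_mult) (use 1 that in \<open>auto simp: gens_def\<close>)
  ultimately show "s \<in> gspan"
    unfolding 1(3) by (intro gspan_add gspan_sum) (auto simp: mult_ac)
qed

lemma sum_list_nonneg_gens: "set xs \<subseteq> gens \<Longrightarrow> 0 \<le> sum_list xs"
  by (induction xs) (auto dest: gens_pos)

lemma S_nonneg: "s \<in> S \<Longrightarrow> 0 \<le> s"
  using S_subset_gspan sum_list_nonneg_gens by (auto simp: gspan_def)

text \<open>In a sum bounded by B every generator is at most B, which leaves finitely many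
  generators with a positive minimum, and hence boundedly many summands.\<close>

lemma S_fin: "finite (S \<inter> {..B})"
proof -
  define G where "G = gens \<inter> {..B}"
  define \<delta> where "\<delta> = Min (insert 1 G)"
  have d: "0 < \<delta>" using gens_fin gens_pos by (auto simp: \<delta>_def G_def)
  have G: "finite G" using gens_fin by (simp add: G_def)
  have mem: "x \<le> sum_list xs" if "x \<in> set xs" "set xs \<subseteq> gens" for x xs
    by (rule member_le_sum_list) (use that gens_pos in \<open>auto simp: less_imp_le\<close>)
  have len: "real (length xs) * \<delta> \<le> sum_list xs" if "set xs \<subseteq> G" for xs
    using that
  proof (induction xs)
    case (Cons x xs)
    then have "\<delta> \<le> x" using G by (auto simp: \<delta>_def)
    with Cons show ?case by (simp add: algebra_simps)
  qed simp
  have "S \<inter> {..B} \<subseteq> sum_list ` {xs. set xs \<subseteq> G \<and> length xs \<le> nat \<lceil>B / \<delta>\<rceil>}"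
  proof
    fix s assume "s \<in> S \<inter> {..B}"
    then obtain xs where xs: "s = sum_list xs" "set xs \<subseteq> gens" "s \<le> B"
      using S_subset_gspan by (auto simp: gspan_def)
    then have sub: "set xs \<subseteq> G" using mem[of _ xs] by (auto simp: G_def intro: order_trans)
    have "real (length xs) * \<delta> \<le> B" using len[OF sub] xs by simp
    then have "real (length xs) \<le> B / \<delta>" using d by (simp add: pos_le_divide_eq)
    then have "length xs \<le> nat \<lceil>B / \<delta>\<rceil>" by linarith
    with sub xs show "s \<in> sum_list ` {xs. set xs \<subseteq> G \<and> length xs \<le> nat \<lceil>B / \<delta>\<rceil>}" by auto
  qed
  moreover have "finite {xs. set xs \<subseteq> G \<and> length xs \<le> nat \<lceil>B / \<delta>\<rceil>}"
    by (rule finite_lists_length_le[OF G])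
  ultimately show ?thesis by (meson finite_imageI finite_subset)
qed

lemma S_infinite: "infinite S"
proof
  assume fin: "finite S"
  obtain j where j: "j \<in> J" using J_nonempty by auto
  define g where "g = (\<beta> j - 1) * \<gamma> 1"
  have g: "0 < g" "g \<in> S" using beta_gt[OF j] gamma1_pos S_beta[OF j] by (auto simp: g_def)
  have "Max S + g \<in> S" using S_add[OF Max_in[OF fin] g(2)] g(2) by auto
  from Max_ge[OF fin this] g(1) show False by simp
qed

lemma enum: "strict_mono_on {1..} (increasing_enum S)" "increasing_enum S ` {1..} = S"
proof -
  have "\<exists>s. strict_mono_on {1::nat..} s \<and> s ` {1..} = S"
    by (rule locally_finite_enumeration[OF S_nonneg S_infinite S_fin])
  from someI_ex[OF this] show "strict_mono_on {1..} (increasing_enum S)" "increasing_enum S ` {1..} = S"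
    unfolding increasing_enum_def by auto
qed

lemma mu_less: "1 \<le> i \<Longrightarrow> i < j \<Longrightarrow> \<mu> i < \<mu> j"
  using enum(1) by (simp add: mu_def strict_mono_on_def)

lemma mu_le_iff: "1 \<le> i \<Longrightarrow> 1 \<le> j \<Longrightarrow> \<mu> i \<le> \<mu> j \<longleftrightarrow> i \<le> j"
  by (metis mu_less linorder_not_less order_le_less)

lemma mu_less_iff: "1 \<le> i \<Longrightarrow> 1 \<le> j \<Longrightarrow> \<mu> i < \<mu> j \<longleftrightarrow> i < j"
  by (metis mu_le_iff linorder_not_less)

lemma mu_inj: "1 \<le> i \<Longrightarrow> 1 \<le> j \<Longrightarrow> \<mu> i = \<mu> j \<longleftrightarrow> i = j"
  by (metis mu_less_iff linorder_neq_iff order_less_irrefl)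

lemma mu_in_S: "1 \<le> k \<Longrightarrow> \<mu> k - \<gamma> 1 \<in> S"
  using enum(2) by (auto simp: mu_def)

lemma S_mu: "s \<in> S \<Longrightarrow> \<exists>k\<ge>1. \<mu> k = s + \<gamma> 1"
  using enum(2) by (auto simp: mu_def) (metis (no_types, lifting) imageE atLeast_iff)

lemma mu_1: "\<mu> 1 = \<gamma> 1"
proof -
  obtain k where k: "1 \<le> k" "\<mu> k = \<gamma> 1" using S_mu[OF S_zero] by auto
  have "\<mu> 1 \<le> \<mu> k" using k(1) mu_le_iff[of 1 k] by blast
  moreover have "\<gamma> 1 \<le> \<mu> 1" using S_nonneg[OF mu_in_S[of 1]] by simp
  ultimately show ?thesis using k by linarith
qed

lemma mu_pos: "1 \<le> k \<Longrightarrow> 0 < \<mu> k"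
  using mu_1 gamma1_pos mu_le_iff[of 1 k] by simp

lemma mu_gamma: "l \<in> I \<Longrightarrow> \<exists>k\<ge>1. \<mu> k = \<gamma> l"
  using S_mu[OF S_gamma, of l] by simp

lemma mu_plus_one: "m = 0 \<Longrightarrow> 1 \<le> l \<Longrightarrow> \<exists>k\<ge>1. \<mu> k = \<mu> l + 1"
  using S_mu[OF S_add[OF mu_in_S S_one], of l] by simp

lemma mu_plus_beta: "j \<in> J \<Longrightarrow> 1 \<le> l \<Longrightarrow> \<exists>k\<ge>1. \<mu> k = \<mu> l + (\<beta> j - 1) * \<mu> 1"
  using S_mu[OF S_add[OF mu_in_S S_beta], of l j] unfolding mu_1 by (simp add: algebra_simps)

lemma sum_list_mu_in_S: "\<forall>i\<in>set ks. 1 \<le> i \<Longrightarrow> sum_list (map \<mu> ks) - real (length ks) * \<gamma> 1 \<in> S"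
proof (induction ks)
  case (Cons i ks)
  then have "\<mu> i - \<gamma> 1 + (sum_list (map \<mu> ks) - real (length ks) * \<gamma> 1) \<in> S"
    by (intro S_add mu_in_S) auto
  then show ?case by (simp add: algebra_simps)
qed (simp add: S_zero)

text \<open>Relative to \<gamma>_1 the order is the sum of all \<mu>_i - \<gamma>_1 and of
  (\<beta>_r - 1) \<gamma>_1, hence in the semigroup. So every term of the expanded nonlinearity has
  one of the listed orders.\<close>

lemma mu_product:
  assumes "r \<in> J" "\<forall>i\<in>set ks. 1 \<le> i"
  shows "\<exists>k\<ge>1. \<mu> k = sum_list (map \<mu> ks) + (\<beta> r - real (length ks)) * \<mu> 1"
  using S_mu[OF S_add[OF sum_list_mu_in_S[OF assms(2)] S_beta[OF assms(1)]]]
  unfolding mu_1 by (simp add: algebra_simps)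

definition Qset :: "nat \<Rightarrow> (nat \<times> nat list) set"
  where "Qset k = {(r, ks). r \<in> J \<and> (\<forall>j\<in>set ks. 2 \<le> j) \<and>
    sum_list (map \<mu> ks) + (\<beta> r - real (length ks)) * \<mu> 1 = \<mu> k}"

lemma sum_list_mu_ge:
  "\<forall>j\<in>set ks. 2 \<le> j \<Longrightarrow> real (length ks) * (\<mu> 2 - \<mu> 1) \<le> sum_list (map \<mu> ks) - real (length ks) * \<mu> 1"
proof (induction ks)
  case (Cons j ks)
  then have "\<mu> 2 \<le> \<mu> j" using mu_le_iff[of 2 j] by auto
  with Cons show ?case by (simp add: algebra_simps)
qed simp

lemma sum_list_mu_member:
  "\<forall>j\<in>set ks. 2 \<le> j \<Longrightarrow> i \<in> set ks \<Longrightarrow> \<mu> i - \<mu> 1 \<le> sum_list (map \<mu> ks) - real (length ks) * \<mu> 1"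
proof (induction ks)
  case (Cons j ks)
  have j: "\<mu> 1 \<le> \<mu> j" using Cons.prems mu_le_iff[of 1 j] by auto
  have "0 \<le> real (length ks) * (\<mu> 2 - \<mu> 1)" using mu_less[of 1 2] by simp
  with sum_list_mu_ge[of ks] Cons.prems have "0 \<le> sum_list (map \<mu> ks) - real (length ks) * \<mu> 1" by simp
  with Cons j show ?case by (auto simp: algebra_simps)
qed simp

text \<open>The equation reads \<beta>_r \<mu>_1 plus the sum of \<mu>_j - \<mu>_1 over the list
  equals \<mu>_k, with each difference at least \<mu>_2 - \<mu>_1 > 0. This bounds r and the length.
  As \<beta>_r > 1, each \<mu>_j stays strictly below \<mu>_k, so the recursion for q_k refers only
  to earlier indices.\<close>

lemma Qset_bounds:
  assumes "(r, ks) \<in> Qset k"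
  shows "r \<in> J" "\<beta> r * \<mu> 1 \<le> \<mu> k" "\<forall>j\<in>set ks. 2 \<le> j"
    "real (length ks) * (\<mu> 2 - \<mu> 1) \<le> \<mu> k" "1 \<le> k \<Longrightarrow> \<forall>j\<in>set ks. j < k"
proof -
  have Q: "r \<in> J" "\<forall>j\<in>set ks. 2 \<le> j" "\<beta> r * \<mu> 1 + (sum_list (map \<mu> ks) - real (length ks) * \<mu> 1) = \<mu> k"
    using assms by (auto simp: Qset_def algebra_simps)
  have ge: "0 \<le> real (length ks) * (\<mu> 2 - \<mu> 1)" using mu_less[of 1 2] by simp
  have pos: "\<mu> 1 < \<beta> r * \<mu> 1" using beta_gt[OF Q(1)] mu_pos[of 1] by simp
  show "r \<in> J" "\<forall>j\<in>set ks. 2 \<le> j" by (fact Q)+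
  show "\<beta> r * \<mu> 1 \<le> \<mu> k" using sum_list_mu_ge[OF Q(2)] ge Q(3) by linarith
  show "real (length ks) * (\<mu> 2 - \<mu> 1) \<le> \<mu> k"
    using sum_list_mu_ge[OF Q(2)] pos mu_pos[of 1] Q(3) by linarith
  assume k: "1 \<le> k"
  show "\<forall>j\<in>set ks. j < k"
  proof
    fix j assume j: "j \<in> set ks"
    have "\<mu> j < \<mu> k" using sum_list_mu_member[OF Q(2) j] pos Q(3) by linarith
    with mu_less_iff[of j k] k Q(2) j show "j < k" by force
  qed
qed

lemma Qset_finite: "1 \<le> k \<Longrightarrow> finite (Qset k)"
proof (rule finite_subset)
  assume k: "1 \<le> k"
  let ?N = "nat \<lceil>\<mu> k / (\<mu> 2 - \<mu> 1)\<rceil>"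
  show "Qset k \<subseteq> {j \<in> J. \<beta> j \<le> \<mu> k / \<mu> 1} \<times> {ks. set ks \<subseteq> {..<k} \<and> length ks \<le> ?N}"
  proof (rule subrelI)
    fix r ks assume Q: "(r, ks) \<in> Qset k"
    note B = Qset_bounds[OF Q]
    have "real (length ks) \<le> \<mu> k / (\<mu> 2 - \<mu> 1)"
      using B(4) mu_less[of 1 2] by (simp add: pos_le_divide_eq)
    then have "length ks \<le> ?N" by linarith
    then show "(r, ks) \<in> {j \<in> J. \<beta> j \<le> \<mu> k / \<mu> 1} \<times> {ks. set ks \<subseteq> {..<k} \<and> length ks \<le> ?N}"
      using B(1,2) B(5)[OF k] mu_pos[of 1] by (auto simp: pos_le_divide_eq)
  qed
  show "finite ({j \<in> J. \<beta> j \<le> \<mu> k / \<mu> 1} \<times> {ks. set ks \<subseteq> {..<k} \<and> length ks \<le> ?N})"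
    by (intro finite_cartesian_product beta_fin finite_lists_length_le) auto
qed

end

section \<open>The nonlinearity\<close>

lemma smooth_onD:
  assumes "smooth_on U G"
  shows "x \<in> U \<Longrightarrow> G differentiable (at x)" "continuous_on U G"
    "smooth_on U (\<lambda>x. frechet_derivative G (at x) v)"
proof -
  have "Ck_on (Suc k) U G" for k using assms unfolding smooth_on_def by blast
  then show "x \<in> U \<Longrightarrow> G differentiable (at x)" "smooth_on U (\<lambda>x. frechet_derivative G (at x) v)"
    by (auto simp: smooth_on_def)
  have "Ck_on 0 U G" using assms unfolding smooth_on_def by blast
  then show "continuous_on U G" by simp
qed

lemma smooth_on_Dm: "smooth_on U G \<Longrightarrow> smooth_on U (Dm G vs)"
proof (induction vs)
  case Nil
  have "Dm G [] = G" by (simp add: fun_eq_iff)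
  with Nil show ?case by simp
next
  case (Cons v vs)
  have "Dm G (v # vs) = (\<lambda>x. frechet_derivative (Dm G vs) (at x) v)" by (simp add: fun_eq_iff)
  with smooth_onD(3)[OF Cons.IH[OF Cons.prems], of v] show ?case by simp
qed

text \<open>The innermost slot is linear because it is a Frechet derivative. Further
  differentiation, in the directions \<open>us\<close>, preserves the linearity identity, since that
  identity holds on the whole open set.\<close>

lemma Dm_linear:
  assumes G: "smooth_on U G" and U: "open U" and x: "x \<in> U"
  shows "linear (\<lambda>v. Dm G (us @ v # vs) x)"
  using x
proof (induction us arbitrary: x)
  case Nil
  have "linear (frechet_derivative (Dm G vs) (at x))"
    by (rule linear_frechet_derivative) (rule smooth_onD(1)[OF smooth_on_Dm[OF G] Nil])
  then show ?case by simp
next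
  case (Cons u us)
  let ?f = "\<lambda>v. Dm G (us @ v # vs)"
  have diff: "?f v differentiable (at x)" for v
    by (rule smooth_onD(1)[OF smooth_on_Dm[OF G] Cons.prems])
  have add: "frechet_derivative (?f (v + w)) (at x)
      = (\<lambda>h. frechet_derivative (?f v) (at x) h + frechet_derivative (?f w) (at x) h)" for v w
  proof -
    have "((\<lambda>y. ?f v y + ?f w y) has_derivative
        (\<lambda>h. frechet_derivative (?f v) (at x) h + frechet_derivative (?f w) (at x) h)) (at x)"
      using diff frechet_derivative_works by (intro has_derivative_add) blast+
    then have "(?f (v + w) has_derivative
        (\<lambda>h. frechet_derivative (?f v) (at x) h + frechet_derivative (?f w) (at x) h)) (at x)"
      by (rule has_derivative_transform_within_open[OF _ U Cons.prems])
        (simp add: linear_add[OF Cons.IH])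
    then show ?thesis by (metis frechet_derivative_at)
  qed
  have scale: "frechet_derivative (?f (c *\<^sub>R v)) (at x)
      = (\<lambda>h. c *\<^sub>R frechet_derivative (?f v) (at x) h)" for c v
  proof -
    have "((\<lambda>y. c *\<^sub>R ?f v y) has_derivative
        (\<lambda>h. c *\<^sub>R frechet_derivative (?f v) (at x) h)) (at x)"
      using diff frechet_derivative_works by (intro has_derivative_scaleR_right) blast+
    then have "(?f (c *\<^sub>R v) has_derivative
        (\<lambda>h. c *\<^sub>R frechet_derivative (?f v) (at x) h)) (at x)"
      by (rule has_derivative_transform_within_open[OF _ U Cons.prems])
        (simp add: linear_scale[OF Cons.IH])
    then show ?thesis by (metis frechet_derivative_at)
  qed
  show ?case by (rule linearI) (simp_all add: add scale)
qed

section \<open>Multilinear expansion and Taylor's formula\<close>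

context
  fixes G :: "'a::real_normed_vector \<Rightarrow> 'b::real_normed_vector" and U x
  assumes G: "smooth_on U G" and U: "open U" and x: "x \<in> U"
begin

lemma Dm_sum:
  "Dm G (us @ (\<Sum>b\<in>B. c b *\<^sub>R e b) # vs) x = (\<Sum>b\<in>B. c b *\<^sub>R Dm G (us @ e b # vs) x)"
  using linear_sum[OF Dm_linear[OF G U x, of us vs], of "\<lambda>b. c b *\<^sub>R e b" B]
  by (simp add: linear_scale[OF Dm_linear[OF G U x, of us vs]])

lemma Dm_scale_all:
  "Dm G (us @ map (\<lambda>k. c *\<^sub>R h k) ks) x = c ^ length ks *\<^sub>R Dm G (us @ map h ks) x"
proof (induction ks arbitrary: us)
  case (Cons k ks)
  have "Dm G (us @ map (\<lambda>k. c *\<^sub>R h k) (k # ks)) x = c *\<^sub>R Dm G ((us @ [h k]) @ map (\<lambda>k. c *\<^sub>R h k) ks) x"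
    by (simp add: linear_scale[OF Dm_linear[OF G U x, of us "map (\<lambda>k. c *\<^sub>R h k) ks"]])
  then show ?case unfolding Cons.IH by simp
qed simp

text \<open>The source of the tuples in the construction: a power of a sum expands into all lists of
  summands, and keeping lists ordered avoids multinomial coefficients.\<close>

lemma Dm_replicate_sum:
  assumes "finite B"
  shows "Dm G (us @ replicate j (\<Sum>b\<in>B. h b)) x
    = (\<Sum>ks\<in>{ks. set ks \<subseteq> B \<and> length ks = j}. Dm G (us @ map h ks) x)"
proof (induction j arbitrary: us)
  case 0
  have "{ks. set ks \<subseteq> B \<and> length ks = 0} = {[]}" by auto
  then show ?case by simp
next
  case (Suc j)
  let ?A = "{ks. set ks \<subseteq> B \<and> length ks = j}"
  have "Dm G (us @ replicate (Suc j) (\<Sum>b\<in>B. h b)) x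
      = (\<Sum>b\<in>B. Dm G ((us @ [h b]) @ replicate j (\<Sum>b\<in>B. h b)) x)"
    using Dm_sum[of us "\<lambda>_. 1" h B "replicate j (\<Sum>b\<in>B. h b)"] by simp
  also have "\<dots> = (\<Sum>b\<in>B. \<Sum>ks\<in>?A. Dm G (us @ map h (b # ks)) x)"
    unfolding Suc.IH by simp
  also have "\<dots> = (\<Sum>(b, ks)\<in>B \<times> ?A. Dm G (us @ map h (b # ks)) x)"
    by (rule sum.cartesian_product)
  also have "\<dots> = (\<Sum>ks\<in>(\<lambda>(b, ks). b # ks) ` (B \<times> ?A). Dm G (us @ map h ks) x)"
    by (subst sum.reindex) (auto simp: inj_on_def case_prod_beta)
  also have "(\<lambda>(b, ks). b # ks) ` (B \<times> ?A) = {ks. set ks \<subseteq> B \<and> length ks = Suc j}"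
    by (force simp: length_Suc_conv image_iff)
  finally show ?case .
qed

end

lemma basis_sum: "(\<Sum>b\<in>UNIV. (v $ b) *\<^sub>R axis b 1) = (v :: real^'n)"
  using basis_expansion[of v] by (simp add: scalar_mult_eq_scaleR)

text \<open>Derivatives in fixed directions are continuous, hence bounded on the compact set.
  General directions are expanded in the basis one slot at a time; \<open>us\<close> collects the
  basis vectors already chosen.\<close>

lemma Dm_bound:
  fixes G :: "real^'n \<Rightarrow> 'b::real_normed_vector"
  assumes G: "smooth_on U G" and U: "open U" and K: "compact K" "K \<subseteq> U"
  shows "\<exists>C\<ge>0. \<forall>x\<in>K. \<forall>vs. length vs = j \<longrightarrow> norm (Dm G (us @ vs) x) \<le> C * prod_list (map norm vs)"
proof (induction j arbitrary: us)
  case 0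
  have "continuous_on K (Dm G us)"
    using smooth_onD(2)[OF smooth_on_Dm[OF G]] K(2) continuous_on_subset by blast
  then have "bounded (Dm G us ` K)" using K(1) compact_continuous_image compact_imp_bounded by blast
  then obtain C where "\<forall>x\<in>K. norm (Dm G us x) \<le> C" by (auto simp: bounded_iff)
  then show ?case by (intro exI[of _ "max C 0"]) force
next
  case (Suc j)
  have "\<forall>b. \<exists>C\<ge>0. \<forall>x\<in>K. \<forall>vs. length vs = j \<longrightarrow>
      norm (Dm G ((us @ [axis b 1]) @ vs) x) \<le> C * prod_list (map norm vs)"
    using Suc.IH by blast
  then obtain C where C: "\<And>b. 0 \<le> C b" "\<And>b x vs. x \<in> K \<Longrightarrow> length vs = j \<Longrightarrow>
      norm (Dm G ((us @ [axis b 1]) @ vs) x) \<le> C b * prod_list (map norm vs)"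
    by metis
  show ?case
  proof (intro exI[of _ "\<Sum>b\<in>UNIV. C b"] conjI ballI allI impI)
    show "0 \<le> (\<Sum>b\<in>UNIV. C b)" using C(1) by (simp add: sum_nonneg)
    fix x vs assume x: "x \<in> K" and vs: "length (vs :: (real^'n) list) = Suc j"
    then obtain v ws where vw: "vs = v # ws" "length ws = j" by (auto simp: length_Suc_conv)
    have "Dm G (us @ vs) x = Dm G (us @ (\<Sum>b\<in>UNIV. (v $ b) *\<^sub>R axis b 1) # ws) x"
      by (simp add: basis_sum vw)
    also have "\<dots> = (\<Sum>b\<in>UNIV. (v $ b) *\<^sub>R Dm G (us @ axis b 1 # ws) x)"
      by (rule Dm_sum[OF G U]) (use x K in auto)
    finally have "norm (Dm G (us @ vs) x) \<le> (\<Sum>b\<in>UNIV. norm ((v $ b) *\<^sub>R Dm G (us @ axis b 1 # ws) x))"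
      by (simp only: norm_sum)
    also have "\<dots> \<le> (\<Sum>b\<in>UNIV. norm v * (C b * prod_list (map norm ws)))"
    proof (rule sum_mono)
      fix b
      have "\<bar>v $ b\<bar> \<le> norm v" by (rule component_le_norm_cart)
      moreover have "norm (Dm G (us @ axis b 1 # ws) x) \<le> C b * prod_list (map norm ws)"
        using C(2)[OF x vw(2), of b] by simp
      ultimately show "norm ((v $ b) *\<^sub>R Dm G (us @ axis b 1 # ws) x) \<le> norm v * (C b * prod_list (map norm ws))"
        by (simp add: mult_mono)
    qed
    also have "\<dots> = (\<Sum>b\<in>UNIV. C b) * prod_list (map norm vs)"
      by (simp add: vw sum_distrib_right sum_distrib_left mult_ac)
    finally show "norm (Dm G (us @ vs) x) \<le> (\<Sum>b\<in>UNIV. C b) * prod_list (map norm vs)" .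
  qed
qed

text \<open>The one-dimensional formula with integral remainder along the segment. The constant is
  uniform in the base point: j = 1 serves as a Lipschitz bound at moving points, larger j as the
  remainder at a fixed one.\<close>

lemma taylor_bound:
  fixes G :: "real^'n \<Rightarrow> real^'k"
  assumes G: "smooth_on U G" and U: "open U" "cball \<xi> r \<subseteq> U" and j: "0 < j"
  shows "\<exists>C\<ge>0. \<forall>x\<in>cball \<xi> r. \<forall>h. x + h \<in> cball \<xi> r \<longrightarrow>
    norm (G (x + h) - (\<Sum>i<j. (1 / fact i) *\<^sub>R Dm G (replicate i h) x)) \<le> C * norm h ^ j"
proof -
  obtain C where C: "0 \<le> C" "\<And>x vs. x \<in> cball \<xi> r \<Longrightarrow> length vs = j \<Longrightarrow>
      norm (Dm G vs x) \<le> C * prod_list (map norm vs)"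
    using Dm_bound[OF G U(1) compact_cball U(2), of j "[]"] by auto
  show ?thesis
  proof (intro exI[of _ C] conjI C(1) ballI allI impI)
    fix x h assume x: "x \<in> cball \<xi> r" and xh: "x + h \<in> cball \<xi> r"
    define Df where "Df i s = Dm G (replicate i h) (x + s *\<^sub>R h)" for i and s :: real
    have seg: "x + s *\<^sub>R h \<in> cball \<xi> r" if "0 \<le> s" "s \<le> 1" for s
    proof -
      have "(1 - s) *\<^sub>R x + s *\<^sub>R (x + h) \<in> cball \<xi> r"
        by (rule convexD[OF convex_cball x xh]) (use that in auto)
      then show ?thesis by (simp add: algebra_simps)
    qed
    have dDf: "(Df i has_vector_derivative Df (Suc i) s) (at s within {0..1})" if s: "0 \<le> s" "s \<le> 1" for i s
    proof -
      have "x + s *\<^sub>R h \<in> U" using seg[OF s] U(2) by auto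
      then have "(Dm G (replicate i h) has_derivative frechet_derivative (Dm G (replicate i h)) (at (x + s *\<^sub>R h)))
          (at (x + s *\<^sub>R h))"
        using smooth_onD(1)[OF smooth_on_Dm[OF G]] frechet_derivative_works by blast
      moreover have "((\<lambda>s. x + s *\<^sub>R h) has_vector_derivative h) (at s within {0..1})"
        by (auto intro!: derivative_eq_intros)
      ultimately have "((Dm G (replicate i h) \<circ> (\<lambda>s. x + s *\<^sub>R h)) has_vector_derivative
          frechet_derivative (Dm G (replicate i h)) (at (x + s *\<^sub>R h)) h) (at s within {0..1})"
        by (intro vector_derivative_diff_chain_within) (auto intro: has_derivative_at_withinI)
      then show ?thesis by (simp add: Df_def[abs_def] o_def)
    qed
    have int: "((\<lambda>s. ((1 - s) ^ (j - 1) / fact (j - 1)) *\<^sub>R Df j s) has_integral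
        Df 0 1 - (\<Sum>i<j. ((1 - 0) ^ i / fact i) *\<^sub>R Df i 0)) {0..1}"
      by (rule Taylor_has_integral[OF j refl]) (use dDf in auto)
    have "norm (Df 0 1 - (\<Sum>i<j. ((1 - 0) ^ i / fact i) *\<^sub>R Df i 0))
        \<le> (C * norm h ^ j) * measure lborel (cbox 0 (1::real))"
    proof (rule has_integral_bound[OF _ int[folded cbox_interval]])
      show "0 \<le> C * norm h ^ j" using C(1) by simp
      fix s :: real assume "s \<in> cbox 0 1"
      then have s: "0 \<le> s" "s \<le> 1" by auto
      have "norm (Df j s) \<le> C * norm h ^ j"
        using C(2)[OF seg[OF s], of "replicate j h"] by (simp add: Df_def prod_list_replicate)
      moreover have "(1 - s) ^ (j - 1) / fact (j - 1) \<le> 1"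
        using s power_le_one[of "1 - s" "j - 1"] by (simp add: divide_le_eq order_trans[OF _ fact_ge_1])
      ultimately show "norm (((1 - s) ^ (j - 1) / fact (j - 1)) *\<^sub>R Df j s) \<le> C * norm h ^ j"
        using s C(1) mult_mono[of "(1 - s) ^ (j - 1) / fact (j - 1)" 1 "norm (Df j s)" "C * norm h ^ j"] by simp
    qed
    then show "norm (G (x + h) - (\<Sum>i<j. (1 / fact i) *\<^sub>R Dm G (replicate i h) x)) \<le> C * norm h ^ j"
      by (simp add: Df_def)
  qed
qed

text \<open>At a fixed point the derivative is multilinear, hence polynomial in the components of
  the arguments, and the orders of the factors add up.\<close>

lemma Phat_Dm:
  assumes G: "smooth_on U (G :: real^'n \<Rightarrow> real^'k)" and U: "open U" and x: "x \<in> U"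
    and q: "\<And>k. k \<in> set ks \<Longrightarrow> q k \<in> Phat_m m K (\<nu> k)"
  shows "(\<lambda>z \<zeta>. Dm G (us @ map (\<lambda>k. q k z \<zeta>) ks) x) \<in> Phat_m m K (sum_list (map \<nu> ks))"
  using q
proof (induction ks arbitrary: us)
  case Nil
  show ?case by (simp add: Phat_iff_scalar_sum scalar_sum_const)
next
  case (Cons k ks)
  have "(\<lambda>z \<zeta>. \<Sum>b\<in>UNIV. (q k z \<zeta> $ b) *\<^sub>R Dm G ((us @ [axis b 1]) @ map (\<lambda>k. q k z \<zeta>) ks) x)
      \<in> Phat_m m K (\<nu> k + sum_list (map \<nu> ks))"
    by (intro Phat_sum Phat_scale Cons.IH) (use Cons.prems in \<open>auto simp: Phat_iff_scalar_sum\<close>)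
  then show ?case
    unfolding list.map sum_list.Cons
  proof (rule Phat_cong)
    fix z \<zeta>
    have "Dm G (us @ q k z \<zeta> # map (\<lambda>k. q k z \<zeta>) ks) x
        = Dm G (us @ (\<Sum>b\<in>UNIV. (q k z \<zeta> $ b) *\<^sub>R axis b 1) # map (\<lambda>k. q k z \<zeta>) ks) x"
      by (simp only: basis_sum)
    also have "\<dots> = (\<Sum>b\<in>UNIV. (q k z \<zeta> $ b) *\<^sub>R Dm G ((us @ [axis b 1]) @ map (\<lambda>k. q k z \<zeta>) ks) x)"
      by (subst Dm_sum[OF G U x]) simp
    finally show "Dm G (us @ q k z \<zeta> # map (\<lambda>k. q k z \<zeta>) ks) x
        = (\<Sum>b\<in>UNIV. (q k z \<zeta> $ b) *\<^sub>R Dm G ((us @ [axis b 1]) @ map (\<lambda>k. q k z \<zeta>) ks) x)" .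
  qed
qed

section \<open>Homogeneous terms and the expansion of F\<close>

lemma F_term_zero: "F_term b G \<Longrightarrow> 1 < b \<Longrightarrow> G 0 = 0"
proof -
  assume G: "F_term b G" and b: "1 < b"
  have "G ((2::real) *\<^sub>R 0) = (2 powr b) *\<^sub>R G 0"
    using G unfolding F_term_def pos_homogeneous_def by (meson zero_less_numeral)
  moreover have "(2::real) powr b \<noteq> 1"
    using powr_less_mono[of 0 b 2] b by simp
  ultimately have "(2 powr b - 1) *\<^sub>R G 0 = 0" by (simp add: scaleR_left_diff_distrib)
  with \<open>2 powr b \<noteq> 1\<close> show "G 0 = 0" by simp
qed

lemma F_term_bound:
  fixes G :: "real^'n \<Rightarrow> real^'n"
  assumes G: "F_term b G" and b: "1 < b"
  shows "\<exists>C\<ge>0. \<forall>x. norm (G x) \<le> C * norm x powr b"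
proof -
  have "continuous_on (sphere 0 1) G"
    using G smooth_onD(2)[of "UNIV - {0}" G] unfolding F_term_def
    by (auto intro: continuous_on_subset)
  then have "bounded (G ` sphere 0 1)"
    using compact_continuous_image[OF _ compact_sphere] compact_imp_bounded by blast
  then obtain C where "\<forall>x\<in>sphere 0 1. norm (G x) \<le> C" by (auto simp: bounded_iff)
  then have C: "norm (G x) \<le> C" if "norm x = 1" for x using that by simp
  have "norm (G x) \<le> max C 0 * norm x powr b" for x
  proof (cases "x = 0")
    case True
    with F_term_zero[OF G b] show ?thesis by simp
  next
    case False
    then have "G (norm x *\<^sub>R (x /\<^sub>R norm x)) = (norm x powr b) *\<^sub>R G (x /\<^sub>R norm x)"
      using G unfolding F_term_def pos_homogeneous_def by (metis zero_less_norm_iff)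
    then have "norm (G x) = norm x powr b * norm (G (x /\<^sub>R norm x))" using False by simp
    also have "\<dots> \<le> norm x powr b * max C 0"
      using C[of "x /\<^sub>R norm x"] False by (intro mult_left_mono) auto
    finally show ?thesis by (simp add: mult.commute)
  qed
  then show ?thesis by (intro exI[of _ "max C 0"]) auto
qed

lemma F_index_set:
  assumes "F_H1 F J \<beta> Fs \<or> F_H2 F J \<beta> Fs"
  shows "J \<noteq> {}" "\<And>j. j \<in> J \<Longrightarrow> 1 < \<beta> j" "\<And>j. j \<in> J \<Longrightarrow> F_term (\<beta> j) (Fs j)"
    "\<And>B. finite {j \<in> J. \<beta> j \<le> B}"
proof -
  show "J \<noteq> {}" "\<And>j. j \<in> J \<Longrightarrow> 1 < \<beta> j" "\<And>j. j \<in> J \<Longrightarrow> F_term (\<beta> j) (Fs j)"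
    using assms by (auto simp: F_H1_def F_H2_def)
  show "finite {j \<in> J. \<beta> j \<le> B}" for B
    using assms
  proof
    assume "F_H1 F J \<beta> Fs"
    then have "eventually (\<lambda>n. B < \<beta> n) sequentially"
      by (simp add: F_H1_def filterlim_at_top_dense)
    then obtain N where "\<And>n. N \<le> n \<Longrightarrow> B < \<beta> n" by (auto simp: eventually_sequentially)
    then have "{j \<in> J. \<beta> j \<le> B} \<subseteq> {..N}" by (force simp: not_less[symmetric])
    then show ?thesis by (rule finite_subset) simp
  qed (auto simp: F_H2_def)
qed

text \<open>Puts both alternatives into one form: finitely many terms, including all of degree at
  most B, leave a remainder of order B. With infinitely many terms, the sum is cut at a degree above
  B. The point 0 is checked separately, since the Landau bound at 0 excludes it.\<close>

lemma F_expansion: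
  fixes F :: "real^'n \<Rightarrow> real^'n"
  assumes H: "F_H1 F J \<beta> Fs \<or> F_H2 F J \<beta> Fs" and F0: "F 0 = 0"
  shows "\<exists>R C \<delta>. finite R \<and> R \<subseteq> J \<and> {r \<in> J. \<beta> r \<le> B} \<subseteq> R \<and> 0 < \<delta> \<and>
    (\<forall>x. norm x < \<delta> \<longrightarrow> norm (F x - (\<Sum>r\<in>R. Fs r x)) \<le> C * norm x powr B)"
proof -
  have "\<exists>R b. finite R \<and> R \<subseteq> J \<and> {r \<in> J. \<beta> r \<le> B} \<subseteq> R \<and> B \<le> b \<and>
      (\<lambda>x. norm (F x - (\<Sum>r\<in>R. Fs r x))) \<in> O[at 0](\<lambda>x. norm x powr b)"
    using H
  proof
    assume H1: "F_H1 F J \<beta> Fs"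
    then have J: "J = {1..}" and mono: "strict_mono_on J \<beta>" by (auto simp: F_H1_def)
    from H1 have "eventually (\<lambda>n. B < \<beta> n) sequentially"
      by (simp add: F_H1_def filterlim_at_top_dense)
    then obtain N where N: "\<And>n. N \<le> n \<Longrightarrow> B < \<beta> n" by (auto simp: eventually_sequentially)
    define M where "M = max N 1"
    have M: "M \<in> J" "B < \<beta> M" using N by (auto simp: M_def J)
    obtain b where b: "\<beta> M < b" "(\<lambda>x. norm (F x - (\<Sum>k=1..M. Fs k x))) \<in> O[at 0](\<lambda>x. norm x powr b)"
      using H1 M unfolding F_H1_def by blast
    have "{r \<in> J. \<beta> r \<le> B} \<subseteq> {1..M}"
    proof
      fix r assume r: "r \<in> {r \<in> J. \<beta> r \<le> B}"
      have "\<not> M < r" using strict_mono_onD[OF mono M(1), of r] r M(2) by auto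
      with r show "r \<in> {1..M}" by (auto simp: J)
    qed
    with b M show ?thesis by (intro exI[of _ "{1..M}"] exI[of _ b]) (auto simp: J)
  next
    assume H2: "F_H2 F J \<beta> Fs"
    then obtain Ns where Ns: "J = {1..Ns}" "\<And>b. \<beta> Ns < b \<Longrightarrow>
        (\<lambda>x. norm (F x - (\<Sum>k=1..Ns. Fs k x))) \<in> O[at 0](\<lambda>x. norm x powr b)"
      unfolding F_H2_def by blast
    then show ?thesis
      by (intro exI[of _ "{1..Ns}"] exI[of _ "max B (\<beta> Ns + 1)"]) auto
  qed
  then obtain R b where R: "finite R" "R \<subseteq> J" "{r \<in> J. \<beta> r \<le> B} \<subseteq> R" "B \<le> b"
    "(\<lambda>x. norm (F x - (\<Sum>r\<in>R. Fs r x))) \<in> O[at 0](\<lambda>x. norm x powr b)" by blast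
  from R(5) obtain C where C: "0 < C"
    "eventually (\<lambda>x. norm (F x - (\<Sum>r\<in>R. Fs r x)) \<le> C * norm x powr b) (at 0)"
    by (elim landau_o.bigE) auto
  then obtain d where d: "0 < d" "\<And>x. x \<noteq> 0 \<Longrightarrow> norm x < d \<Longrightarrow>
      norm (F x - (\<Sum>r\<in>R. Fs r x)) \<le> C * norm x powr b"
    by (auto simp: eventually_at)
  have "norm (F x - (\<Sum>r\<in>R. Fs r x)) \<le> C * norm x powr B" if x: "norm x < min d 1" for x
  proof (cases "x = 0")
    case True
    have "Fs r 0 = 0" if "r \<in> R" for r
      using F_term_zero F_index_set[OF H] that R(2) by blast
    with True F0 show ?thesis by simp
  next
    case False
    with x d(2)[of x] have "norm (F x - (\<Sum>r\<in>R. Fs r x)) \<le> C * norm x powr b" by simp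
    also have "\<dots> \<le> C * norm x powr B"
      using C(1) R(4) x False by (intro mult_left_mono powr_mono') auto
    finally show ?thesis .
  qed
  with R d(1) show ?thesis
    by (intro exI[of _ R] exI[of _ C] exI[of _ "min d 1"]) auto
qed

lemma F_superlinear:
  fixes F :: "real^'n \<Rightarrow> real^'n"
  assumes H: "F_H1 F J \<beta> Fs \<or> F_H2 F J \<beta> Fs" and F0: "F 0 = 0"
  shows "\<exists>C b \<delta>. 0 \<le> C \<and> 1 < b \<and> 0 < \<delta> \<and> (\<forall>x. norm x < \<delta> \<longrightarrow> norm (F x) \<le> C * norm x powr b)"
proof -
  obtain R C \<delta> where R: "finite R" "R \<subseteq> J" "0 < \<delta>"
    "\<And>x. norm x < \<delta> \<Longrightarrow> norm (F x - (\<Sum>r\<in>R. Fs r x)) \<le> C * norm x powr 2"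
    using F_expansion[OF H F0, of 2] by blast
  \<comment> \<open>The least order among the remainder, which has order 2, and the retained terms;
    it is above one and bounds all of them for small x.\<close>
  define b where "b = Min (insert 2 (\<beta> ` R))"
  have b: "1 < b" "b \<le> 2" "\<And>r. r \<in> R \<Longrightarrow> b \<le> \<beta> r"
    using R(1,2) F_index_set(2)[OF H] by (auto simp: b_def)
  have "\<forall>r\<in>R. \<exists>c\<ge>0. \<forall>x. norm (Fs r x) \<le> c * norm x powr \<beta> r"
    using F_term_bound F_index_set[OF H] R(2) by blast
  then obtain c where c: "\<And>r. r \<in> R \<Longrightarrow> 0 \<le> c r"
    "\<And>r x. r \<in> R \<Longrightarrow> norm (Fs r x) \<le> c r * norm x powr \<beta> r" by metis
  have "norm (F x) \<le> (max C 0 + sum c R) * norm x powr b" if x: "norm x < min \<delta> 1" for x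
  proof -
    have less: "norm x powr s \<le> norm x powr b" if "b \<le> s" for s
      using that x by (cases "x = 0") (auto intro: powr_mono')
    have "norm (F x) \<le> norm (F x - (\<Sum>r\<in>R. Fs r x)) + norm (\<Sum>r\<in>R. Fs r x)"
      using norm_triangle_ineq[of "F x - (\<Sum>r\<in>R. Fs r x)" "\<Sum>r\<in>R. Fs r x"] by simp
    also have "norm (F x - (\<Sum>r\<in>R. Fs r x)) \<le> max C 0 * norm x powr b"
    proof -
      have "norm (F x - (\<Sum>r\<in>R. Fs r x)) \<le> C * norm x powr 2" using R(4) x by simp
      also have "\<dots> \<le> max C 0 * norm x powr b" by (intro mult_mono less b(2)) auto
      finally show ?thesis .
    qed
    also have "norm (\<Sum>r\<in>R. Fs r x) \<le> (\<Sum>r\<in>R. c r * norm x powr b)"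
    proof (rule order_trans[OF norm_sum sum_mono])
      fix r assume r: "r \<in> R"
      have "norm (Fs r x) \<le> c r * norm x powr \<beta> r" by (rule c(2)[OF r])
      also have "\<dots> \<le> c r * norm x powr b" by (intro mult_left_mono less b(3) c(1) r)
      finally show "norm (Fs r x) \<le> c r * norm x powr b" .
    qed
    finally show ?thesis by (simp add: sum_distrib_right distrib_right)
  qed
  moreover have "0 \<le> max C 0 + sum c R"
    using sum_nonneg[of R c] c(1) by (simp add: add_nonneg_nonneg)
  moreover have "0 < min \<delta> 1" using R(3) by simp
  ultimately show ?thesis using b(1) by blast
qed

section \<open>Forcing and decay estimates\<close>

lemma decay_powr:
  assumes m: "-1 \<le> m" and g: "decay m \<nu> g" and b: "0 \<le> b"
    and f: "eventually (\<lambda>t. norm (f t) \<le> C * norm (g t) powr b) at_top"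
  shows "decay m (b * \<nu>) f"
proof -
  obtain K where K: "0 < K" "eventually (\<lambda>t. norm (g t) \<le> K * L m t powr - \<nu>) at_top"
    using g by (rule decayE)
  show ?thesis
  proof (rule decayI)
    show "eventually (\<lambda>t. norm (f t) \<le> max C 0 * K powr b * L m t powr - (b * \<nu>)) at_top"
      using f K(2) eventually_L_gt[OF m, of 0]
    proof eventually_elim
      case (elim t)
      have "norm (f t) \<le> max C 0 * norm (g t) powr b"
        using elim(1) by (rule order_trans) (intro mult_right_mono, auto)
      also have "\<dots> \<le> max C 0 * (K * L m t powr - \<nu>) powr b"
        using elim b by (intro mult_left_mono powr_mono2) auto
      also have "(K * L m t powr - \<nu>) powr b = K powr b * L m t powr - (b * \<nu>)"
        using K elim by (simp add: powr_mult powr_powr mult.commute)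
      finally show ?case by (simp add: mult.assoc)
    qed
  qed
qed

lemma decay_tendsto_0:
  fixes g :: "real \<Rightarrow> 'a::real_normed_vector"
  assumes m: "-1 \<le> m" and g: "decay m \<nu> g" and "0 < \<nu>"
  shows "(g \<longlongrightarrow> 0) at_top"
proof -
  obtain K where K: "eventually (\<lambda>t. norm (g t) \<le> K * L m t powr - \<nu>) at_top"
    using g by (rule decayE)
  have "((\<lambda>t. K * L m t powr - \<nu>) \<longlongrightarrow> 0) at_top"
    by (intro tendsto_mult_right_zero tendsto_neg_powr filterlim_L m) (use assms in simp)
  with K show ?thesis by (rule Lim_null_comparison)
qed

text \<open>For m > 0 the logarithm of L_m is o(ln t), so any negative power of t beats every power
  of L_m. This is why derivatives of the coefficients along the logarithms are negligible there and
  \<chi> vanishes.\<close>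

lemma decay_0_imp:
  assumes m: "0 < m" and g: "decay 0 \<nu> g" "0 < \<nu>"
  shows "decay m \<nu>' g"
proof -
  have "L (m + 1) \<in> o(L 1)" using m by (intro L_smallo) auto
  then have "eventually (\<lambda>t. norm (L (m + 1) t) \<le> \<nu> / (\<bar>\<nu>'\<bar> + 1) * norm (L 1 t)) at_top"
    using g(2) by (intro landau_o.smallD) auto
  moreover have "eventually (\<lambda>t. 0 < L (m + 1) t) at_top" "eventually (\<lambda>t. 0 < L 1 t) at_top"
    "eventually (\<lambda>t. 0 < L m t) at_top" "eventually (\<lambda>t. 0 < L 0 t) at_top"
    using m by (intro eventually_L_gt; simp)+
  ultimately have ev: "eventually (\<lambda>t. L 0 t powr - \<nu> \<le> L m t powr - \<nu>') at_top"
  proof eventually_elim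
    case (elim t)
    have "\<nu>' * L (m + 1) t \<le> (\<bar>\<nu>'\<bar> + 1) * L (m + 1) t"
      using elim by (intro mult_right_mono) auto
    also have "\<dots> \<le> (\<bar>\<nu>'\<bar> + 1) * (\<nu> / (\<bar>\<nu>'\<bar> + 1) * L 1 t)"
      using elim by (intro mult_left_mono) auto
    also have "\<dots> = \<nu> * L 1 t" by simp
    finally have "\<nu>' * ln (L m t) \<le> \<nu> * ln (L 0 t)"
      using m L_step[of m t] L_step[of 0 t] by simp
    then show ?case using elim by (simp add: powr_def)
  qed
  obtain K where K: "0 < K" "eventually (\<lambda>t. norm (g t) \<le> K * L 0 t powr - \<nu>) at_top"
    using g(1) by (rule decayE)
  show ?thesis
  proof (rule decayI)
    show "eventually (\<lambda>t. norm (g t) \<le> K * L m t powr - \<nu>') at_top"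
      using K(2) ev
    proof eventually_elim
      case (elim t)
      from mult_left_mono[OF elim(2), of K] elim(1) K(1) show ?case by linarith
    qed
  qed
qed

text \<open>The logarithmic derivative is - \<nu>/(L_0 ... L_m), which is bounded by a multiple of
  1/t.\<close>

lemma L_powr_slow:
  assumes m: "0 \<le> m"
  shows "\<exists>\<phi>'. eventually (\<lambda>t. 0 < L m t powr - \<nu> \<and> ((\<lambda>t. L m t powr - \<nu>) has_real_derivative \<phi>' t) (at t)) at_top
    \<and> (\<forall>\<eta>>0. eventually (\<lambda>t. - \<eta> * L m t powr - \<nu> \<le> \<phi>' t) at_top)"
proof -
  define d where "d t = (\<Prod>i\<in>{0..m - 1}. inverse (L i t))" for t
  define \<phi>' where "\<phi>' t = - \<nu> * L m t powr (- \<nu> - 1) * d t" for t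
  have "eventually (\<lambda>t. ((\<lambda>t. L m t powr - \<nu>) has_real_derivative \<phi>' t) (at t)) at_top"
    using eventually_L_all_gt[of m 0]
  proof eventually_elim
    case (elim t)
    have "(L (m - 1 + 1) has_real_derivative d t) (at t)"
      unfolding d_def using m elim by (intro L_has_derivative) auto
    then have "(L m has_real_derivative d t) (at t)" by simp
    moreover have "0 < L m t" using elim m by simp
    ultimately show ?case
      unfolding \<phi>'_def by (auto intro!: derivative_eq_intros simp: powr_diff powr_minus field_simps)
  qed
  \<comment> \<open>Once all logarithms up to depth m exceed 1, the product of their inverses is at
    most 1/t; the second threshold makes this times the modulus of \<nu> at most \<eta>.\<close>
  moreover have "eventually (\<lambda>t. - \<eta> * L m t powr - \<nu> \<le> \<phi>' t) at_top" if "0 < \<eta>" for \<eta>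
    using eventually_L_all_gt[of m 1] eventually_gt_at_top[of "(\<bar>\<nu>\<bar> + 1) / \<eta>"]
  proof eventually_elim
    case (elim t)
    have gt: "1 < L i t" if "0 \<le> i" "i \<le> m" for i using elim(1) that by auto
    have Lm: "0 < L m t" using gt[of m] m by simp
    have "(\<Prod>i\<in>{0..m}. inverse (L i t)) = inverse (L 0 t) * (\<Prod>i\<in>{1..m}. inverse (L i t))"
    proof -
      have "{0..m} = insert 0 {1..m}" using m by auto
      then show ?thesis by simp
    qed
    also have "\<dots> \<le> inverse (L 0 t) * 1"
    proof (rule mult_left_mono)
      have "0 \<le> inverse (L i t) \<and> inverse (L i t) \<le> 1" if "i \<in> {1..m}" for i
      proof -
        have "1 < L i t" using elim that by auto
        then show ?thesis by (simp add: inverse_le_1_iff)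
      qed
      then show "(\<Prod>i\<in>{1..m}. inverse (L i t)) \<le> 1" by (intro prod_le_1) auto
    qed (use gt[of 0] m in simp)
    finally have prod: "(\<Prod>i\<in>{0..m}. inverse (L i t)) \<le> 1 / t" by (simp add: divide_inverse)
    have t0: "1 < t" using gt[of 0] m by simp
    have nonneg: "0 \<le> (\<Prod>i\<in>{0..m}. inverse (L i t))"
      using gt by (intro prod_nonneg) (force intro: less_imp_le[OF less_trans[OF zero_less_one]])
    have set: "{0..m} = insert m {0..m - 1}" using m by auto
    have dL: "d t * inverse (L m t) = (\<Prod>i\<in>{0..m}. inverse (L i t))"
      unfolding set d_def by simp
    have "\<phi>' t = - (\<nu> * (d t * inverse (L m t))) * L m t powr - \<nu>"
      using Lm by (simp add: \<phi>'_def powr_diff field_simps)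
    moreover have "\<nu> * (d t * inverse (L m t)) \<le> \<eta>"
    proof -
      have "\<nu> * (d t * inverse (L m t)) \<le> \<bar>\<nu>\<bar> * (1 / t)"
        unfolding dL by (rule order_trans[OF mult_right_mono[OF abs_ge_self nonneg]])
          (intro mult_left_mono prod, simp)
      also have "\<dots> \<le> \<eta>" using elim(2) that t0 by (simp add: field_simps)
      finally show ?thesis .
    qed
    ultimately show ?case using Lm by (auto intro!: mult_right_mono)
  qed
  moreover have "eventually (\<lambda>t. 0 < L m t powr - \<nu>) at_top"
    using eventually_L_gt[of m 0] m by (auto elim: eventually_mono)
  ultimately show ?thesis by (intro exI[of _ \<phi>']) (auto intro: eventually_conj)
qed

lemma ode_decay:
  fixes A :: "real^'n^'n" and w g :: "real \<Rightarrow> real^'n"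
  assumes eig: "\<forall>c. complex_eigenvalue A c \<longrightarrow> 0 < Re c" and m: "0 \<le> m"
    and dw: "eventually (\<lambda>s. (w has_vector_derivative (g s - A *v w s)) (at s)) at_top"
    and g: "\<And>\<epsilon>. 0 < \<epsilon> \<Longrightarrow> eventually (\<lambda>s. norm (g s) \<le> \<epsilon> * norm (w s) + K * L m s powr - \<nu>) at_top"
  shows "decay m \<nu> w"
proof -
  obtain \<phi>' where \<phi>': "eventually (\<lambda>t. 0 < L m t powr - \<nu> \<and>
      ((\<lambda>t. L m t powr - \<nu>) has_real_derivative \<phi>' t) (at t)) at_top"
    "\<And>\<eta>. 0 < \<eta> \<Longrightarrow> eventually (\<lambda>t. - \<eta> * L m t powr - \<nu> \<le> \<phi>' t) at_top"
    using L_powr_slow[OF m, of \<nu>] by blast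
  obtain B where "eventually (\<lambda>s. norm (w s) \<le> B * L m s powr - \<nu>) at_top"
    using perturbed_stable_ode_decay[OF eig \<phi>' dw g] by blast
  then show ?thesis by (rule decayI)
qed

text \<open>Used for q_1, whose membership in the class yields a representation without information
  on the exponents at z_(-1). Differentiating the function in z_(-1) gives the operator divided by
  z_(-1), and the function is constant in that variable.\<close>

lemma opM_independent:
  assumes p: "p \<in> Phat_m m k \<mu>" and k: "-1 \<le> k" and z: "z \<in> posdom k" and \<zeta>: "0 < \<zeta>"
    and const: "\<And>s. 0 < s \<Longrightarrow> p (z(-1 := s)) \<zeta> = p z \<zeta>"
  shows "opM k (-1) p z \<zeta> = 0"
proof -
  obtain S \<xi> where rep: "power_rep k S \<xi> p" using p by (auto simp: Phat_power_rep)
  define a where "a = z (-1)"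
  have a: "0 < a" using posdomD[OF z, of "-1"] k by (simp add: a_def)
  have za [simp]: "z(-1 := a) = z" by (simp add: a_def)
  define d where "d j = (if j = -1 then 1 / a else 0)" for j :: int
  have pos: "eventually (\<lambda>s. s \<in> {0<..}) (nhds a)"
    using a by (intro eventually_nhds_in_open) auto
  have "((\<lambda>s. p (z(-1 := s)) \<zeta>) has_vector_derivative Revec (\<Sum>x\<in>S. (pterm k (z(-1 := a)) \<zeta> x *
    ((\<Sum>j\<in>{-1..k}. fst x j * of_real (d j)) + of_real (snd x * (0 / \<zeta>)))) *s \<xi> x)) (at a)"
  proof (rule power_rep_curve[OF rep])
    show "eventually (\<lambda>s. z(-1 := s) \<in> posdom k \<and> 0 < \<zeta>) (nhds a)"
      using pos by eventually_elim (use z \<zeta> in \<open>auto simp: posdom_def\<close>)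
    fix j assume "j \<in> {-1..k}"
    show "((\<lambda>s. ln ((z(-1 := s)) j)) has_real_derivative d j) (at a)"
      using a by (cases "j = -1") (auto simp: d_def intro!: derivative_eq_intros)
  qed simp
  moreover have "(\<Sum>j\<in>{-1..k}. fst x j * complex_of_real (d j)) = of_real (1 / a) * fst x (-1)" for x :: pexp
  proof -
    have "(\<Sum>j\<in>{-1..k}. fst x j * complex_of_real (d j))
        = (\<Sum>j\<in>{-1..k}. if j = -1 then of_real (1 / a) * fst x (-1) else 0)"
      by (rule sum.cong) (auto simp: d_def)
    also have "\<dots> = of_real (1 / a) * fst x (-1)" using k by simp
    finally show ?thesis .
  qed
  ultimately have D: "((\<lambda>s. p (z(-1 := s)) \<zeta>) has_vector_derivative
      Revec (\<Sum>x\<in>S. (pterm k z \<zeta> x * (of_real (1 / a) * fst x (-1))) *s \<xi> x)) (at a)"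
    by simp
  have eq: "Revec (\<Sum>x\<in>S. (pterm k z \<zeta> x * (of_real (1 / a) * fst x (-1))) *s \<xi> x)
      = (1 / a) *\<^sub>R opM k (-1) p z \<zeta>"
  proof -
    have "(\<Sum>x\<in>S. (pterm k z \<zeta> x * (of_real (1 / a) * fst x (-1))) *s \<xi> x)
        = of_real (1 / a) *s (\<Sum>x\<in>S. (pterm k z \<zeta> x * fst x (-1)) *s \<xi> x)"
      by (simp add: vec.scale_sum_right vector_smult_assoc mult_ac)
    then show ?thesis by (simp only: opM_eq[OF rep z \<zeta>] Revec_linear)
  qed
  have "((\<lambda>s. p (z(-1 := s)) \<zeta>) has_vector_derivative 0) (at a)"
    by (rule has_vector_derivative_transform_within_open[OF has_vector_derivative_const[of "p z \<zeta>"], of "{0<..}"])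
      (use a const in auto)
  with D eq have "(1 / a) *\<^sub>R opM k (-1) p z \<zeta> = 0"
    by (metis vector_derivative_at)
  with a show ?thesis by simp
qed

lemma P_plus_independent:
  assumes p0: "p0 \<in> P_plus m k" and z: "z \<in> posdom k" and s: "0 < s"
  shows "p0 (z(-1 := s)) = p0 z"
proof -
  obtain S \<xi> where rep: "power_rep k S \<xi> (lift1 p0)"
    and S: "\<And>s. s \<in> S \<Longrightarrow> fst s \<in> EC m k 0 \<and> fst s (-1) = 0 \<and> snd s = 0"
    using p0 by (elim P_plus_repE) blast
  have z': "z(-1 := s) \<in> posdom k" using z s by (auto simp: posdom_def)
  have "pterm k (z(-1 := s)) 1 x = pterm k z 1 x" if x: "x \<in> S" for x
  proof -
    have "zpow k (z(-1 := s)) (fst x) = zpow k z (fst x)"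
      unfolding zpow_def
    proof (rule prod.cong)
      fix j assume j: "j \<in> {-1..k}"
      have "0 < z j" using posdomD[OF z] j by auto
      then show "complex_of_real ((z(-1 := s)) j) powr fst x j = complex_of_real (z j) powr fst x j"
        using S[OF x] s by (cases "j = -1") auto
    qed simp
    then show ?thesis by (simp add: pterm_def)
  qed
  then have "cvec (lift1 p0 (z(-1 := s)) 1) = cvec (lift1 p0 z 1)"
    by (simp add: power_repD(5)[OF rep z'] power_repD(5)[OF rep z] power_sum_pterm)
  then have "lift1 p0 (z(-1 := s)) 1 = lift1 p0 z 1" by (simp only: cvec_inject)
  then show ?thesis by (simp add: lift1_def vec_eq_iff)
qed

text \<open>The common content of the two alternatives. With infinitely many terms, R is an initial
  segment reaching beyond B; with finitely many, R is all of I and the rate is arbitrary. In both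
  cases \<open>nt l\<close> is the depth at which the l-th term is given.\<close>

lemma forcing:
  assumes "f_f1 f m I \<gamma> n p \<or> f_f2 f m I \<gamma> n p"
  shows "1 \<in> I" "0 < \<gamma> 1" "strict_mono_on I \<gamma>" "\<And>l. l \<in> I \<Longrightarrow> {1..l} \<subseteq> I" "\<And>B. finite {k \<in> I. \<gamma> k \<le> B}"
    "\<And>k. 1 \<le> k \<Longrightarrow> m \<le> n k" "\<And>i j. 1 \<le> i \<Longrightarrow> i \<le> j \<Longrightarrow> n i \<le> n j" "\<And>l. l \<in> I \<Longrightarrow> 1 \<le> l"
    "\<exists>nt. (\<forall>l\<in>I. p l \<in> P_m (int m) (int (nt l)) (- \<gamma> l) \<and> m \<le> nt l \<and> nt l \<le> n l) \<and>
      (\<forall>B. \<exists>R. finite R \<and> R \<subseteq> I \<and> {l \<in> I. \<gamma> l \<le> B} \<subseteq> R \<and>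
        (\<exists>\<nu>>B. decay (int m) \<nu> (\<lambda>t. f t - (\<Sum>l\<in>R. p l (Lhat (int (nt l)) t)))))" (is ?expand)
proof -
  have "(1 \<in> I \<and> 0 < \<gamma> 1 \<and> strict_mono_on I \<gamma> \<and> (\<forall>l\<in>I. {1..l} \<subseteq> I) \<and> (\<forall>B. finite {k \<in> I. \<gamma> k \<le> B})
    \<and> (\<forall>k\<ge>1. m \<le> n k) \<and> (\<forall>i\<ge>1. \<forall>j\<ge>i. n i \<le> n j) \<and> (\<forall>l\<in>I. 1 \<le> l)) \<and> ?expand"
    using assms
  proof
    assume f1: "f_f1 f m I \<gamma> n p"
    then obtain nt :: "nat \<Rightarrow> nat" where I: "I = {1..}" and pos: "\<forall>k\<in>I. 0 < \<gamma> k"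
      and mono: "strict_mono_on I \<gamma>" and lim: "filterlim \<gamma> at_top sequentially"
      and nt: "\<forall>k\<in>I. 1 \<le> nt k \<and> m \<le> nt k \<and> p k \<in> P_m m (nt k) (- \<gamma> k)"
      and ex: "\<forall>N\<in>I. \<exists>\<mu>>\<gamma> N. (\<lambda>t. norm (f t - (\<Sum>k=1..N. p k (Lhat (nt k) t)))) \<in> O(\<lambda>t. L m t powr - \<mu>)"
      and n: "\<forall>k\<in>I. n k = Max (nt ` {1..k})"
      unfolding f_f1_def by blast
    have large: "\<exists>N\<in>I. B < \<gamma> N" for B
    proof -
      from lim have "eventually (\<lambda>n. B < \<gamma> n) sequentially" by (simp add: filterlim_at_top_dense)
      then obtain N where N: "\<And>n. N \<le> n \<Longrightarrow> B < \<gamma> n" by (auto simp: eventually_sequentially)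
      have "max N 1 \<in> I" "B < \<gamma> (max N 1)" using N by (auto simp: I)
      then show ?thesis by blast
    qed
    have below: "{l \<in> I. \<gamma> l \<le> B} \<subseteq> {1..N}" if N: "N \<in> I" "B < \<gamma> N" for B N
    proof
      fix l assume l: "l \<in> {l \<in> I. \<gamma> l \<le> B}"
      have "\<not> N < l" using strict_mono_onD[OF mono N(1), of l] l N(2) by auto
      with l show "l \<in> {1..N}" by (auto simp: I)
    qed
    have n_ge: "nt i \<le> n k" if "1 \<le> i" "i \<le> k" for i k
    proof -
      have "nt i \<le> Max (nt ` {1..k})" using that by (intro Max_ge) auto
      with n that show ?thesis by (simp add: I)
    qed
    show ?thesis
    proof (intro conjI ballI allI impI)
      show "1 \<in> I" "0 < \<gamma> 1" "strict_mono_on I \<gamma>" using I pos mono by auto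
      show "finite {k \<in> I. \<gamma> k \<le> B}" for B
        using large[of B] below finite_subset by (metis finite_atLeastAtMost)
      show "m \<le> n k" if "1 \<le> k" for k
        using n_ge[OF order.refl that] nt by (auto simp: I intro: order_trans[of m "nt 1"])
      show "n i \<le> n j" if "1 \<le> i" "i \<le> j" for i j
        using n that by (auto simp: I intro!: Max_mono)
      show ?expand
      proof (intro exI[of _ nt] conjI ballI allI)
        fix l assume l: "l \<in> I"
        show "p l \<in> P_m (int m) (int (nt l)) (- \<gamma> l)" "m \<le> nt l" using nt l by auto
        show "nt l \<le> n l" using n_ge l by (simp add: I)
      next
        fix B
        obtain N where N: "N \<in> I" "B < \<gamma> N" using large by blast
        obtain \<nu> where "\<gamma> N < \<nu>" "decay (int m) \<nu> (\<lambda>t. f t - (\<Sum>k=1..N. p k (Lhat (nt k) t)))"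
          using ex N(1) by (auto simp: decay_def)
        with N show "\<exists>R. finite R \<and> R \<subseteq> I \<and> {l \<in> I. \<gamma> l \<le> B} \<subseteq> R \<and>
          (\<exists>\<nu>>B. decay (int m) \<nu> (\<lambda>t. f t - (\<Sum>l\<in>R. p l (Lhat (int (nt l)) t))))"
          by (intro exI[of _ "{1..N}"] conjI below exI[of _ \<nu>]) (auto simp: I)
      qed
    qed (auto simp: I)
  next
    assume f2: "f_f2 f m I \<gamma> n p"
    then obtain K ns :: nat where K: "1 \<le> K" and I: "I = {1..K}" and pos: "\<forall>k\<in>I. 0 < \<gamma> k"
      and mono: "strict_mono_on I \<gamma>" and ns: "1 \<le> ns" "m \<le> ns" "\<forall>k\<in>I. p k \<in> P_m m ns (- \<gamma> k)"
      and ex: "\<forall>\<mu>>\<gamma> K. (\<lambda>t. norm (f t - (\<Sum>k=1..K. p k (Lhat ns t)))) \<in> O(\<lambda>t. L m t powr - \<mu>)"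
      and n: "\<forall>k\<ge>1. n k = ns"
      unfolding f_f2_def by blast
    show ?thesis
    proof (intro conjI ballI allI impI)
      show ?expand
      proof (intro exI[of _ "\<lambda>_. ns"] conjI ballI allI)
        fix B
        have "decay (int m) (max B (\<gamma> K) + 1) (\<lambda>t. f t - (\<Sum>k=1..K. p k (Lhat ns t)))"
          unfolding decay_def by (rule ex[rule_format]) linarith
        then show "\<exists>R. finite R \<and> R \<subseteq> I \<and> {l \<in> I. \<gamma> l \<le> B} \<subseteq> R \<and>
          (\<exists>\<nu>>B. decay (int m) \<nu> (\<lambda>t. f t - (\<Sum>l\<in>R. p l (Lhat (int ns) t))))"
          by (intro exI[of _ "{1..K}"] conjI exI[of _ "max B (\<gamma> K) + 1"]) (auto simp: I)
      qed (use ns n I in auto)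
    qed (use K pos mono ns n in \<open>auto simp: I\<close>)
  qed
  then show "1 \<in> I" "0 < \<gamma> 1" "strict_mono_on I \<gamma>" "\<And>l. l \<in> I \<Longrightarrow> {1..l} \<subseteq> I" "\<And>B. finite {k \<in> I. \<gamma> k \<le> B}"
    "\<And>k. 1 \<le> k \<Longrightarrow> m \<le> n k" "\<And>i j. 1 \<le> i \<Longrightarrow> i \<le> j \<Longrightarrow> n i \<le> n j"
    "\<And>l. l \<in> I \<Longrightarrow> 1 \<le> l" ?expand
    by blast+
qed

section \<open>The construction\<close>

text \<open>Here P is the forcing after re-indexing, so that all hypotheses refer to \<mu>, and it
  is evaluated along the untruncated tuple.\<close>

locale expansion = exponents m J \<beta> I \<gamma>
  for m :: nat and J :: "nat set" and \<beta> :: "nat \<Rightarrow> real" and I :: "nat set" and \<gamma> :: "nat \<Rightarrow> real" +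
  fixes A :: "real^'n^'n" and F :: "real^'n \<Rightarrow> real^'n" and Fs :: "nat \<Rightarrow> real^'n \<Rightarrow> real^'n"
    and f :: "real \<Rightarrow> real^'n" and n :: "nat \<Rightarrow> nat" and P :: "nat \<Rightarrow> (int \<Rightarrow> real) \<Rightarrow> real^'n"
    and p0 :: "(int \<Rightarrow> real) \<Rightarrow> real" and \<xi>0 :: "real^'n"
  assumes eig: "\<forall>c. complex_eigenvalue A c \<longrightarrow> 0 < Re c"
    and F_H: "F_H1 F J \<beta> Fs \<or> F_H2 F J \<beta> Fs" and F0: "F 0 = 0"
    and n_ge: "\<And>k. 1 \<le> k \<Longrightarrow> m \<le> n k" and n_mono: "\<And>i j. 1 \<le> i \<Longrightarrow> i \<le> j \<Longrightarrow> n i \<le> n j"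
    and P_class: "\<And>k. 1 \<le> k \<Longrightarrow> (\<lambda>z \<zeta>. P k z) \<in> Phat_m m (n k) (- mu m J \<beta> I \<gamma> k)"
    and P_1: "\<And>z. z \<in> posdom (n 1) \<Longrightarrow> P 1 z = (p0 z * z (int m) powr (- mu m J \<beta> I \<gamma> 1)) *\<^sub>R \<xi>0"
    and f_expansion: "\<And>N. 1 \<le> N \<Longrightarrow>
      decay_beyond m (mu m J \<beta> I \<gamma> N) (\<lambda>t. f t - (\<Sum>k=1..N. P k (logs t)))"
    and p0: "p0 \<in> P_plus m (n 1)" and xi0: "\<xi>0 \<noteq> 0"
begin

definition \<xi>s :: "real^'n" where "\<xi>s = matrix_inv A *v \<xi>0"

definition q :: "nat \<Rightarrow> (int \<Rightarrow> real) \<Rightarrow> real \<Rightarrow> real^'n"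
  where "q = qfun A m n \<mu> J \<beta> Fs P p0 \<xi>0"

text \<open>\<open>D l\<close> is the derivative of \<open>q\<^sub>l\<close> along the iterated logarithms and \<open>\<zeta>\<^sub>*\<close>, without the contribution
  of \<open>z\<^sub>-\<^sub>1\<close>; \<open>X k\<close> is \<open>\<chi>\<^sub>k\<close>, the sum having at most one nonzero term.\<close>

definition D :: "nat \<Rightarrow> (int \<Rightarrow> real) \<Rightarrow> real \<Rightarrow> real^'n"
  where "D l z \<zeta> = opR (n l) (q l) z \<zeta> +
    (opR (n 1) (lift1 p0) z \<zeta> $ 1) *\<^sub>R vector_derivative (\<lambda>s. q l z s) (at \<zeta>)"

definition Qterm :: "nat \<times> nat list \<Rightarrow> (int \<Rightarrow> real) \<Rightarrow> real \<Rightarrow> real^'n"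
  where "Qterm x z \<zeta> = ((z (int m) powr (- \<mu> 1) * \<zeta>) powr (\<beta> (fst x) - real (length (snd x)))) *\<^sub>R
    calF (Fs (fst x)) \<xi>s (map (\<lambda>j. q j z \<zeta>) (snd x))"

definition Q :: "nat \<Rightarrow> (int \<Rightarrow> real) \<Rightarrow> real \<Rightarrow> real^'n"
  where "Q k z \<zeta> = (\<Sum>x\<in>Qset k. Qterm x z \<zeta>)"

definition X :: "nat \<Rightarrow> (int \<Rightarrow> real) \<Rightarrow> real \<Rightarrow> real^'n"
  where "X k z \<zeta> = (\<Sum>l=1..<k. if m = 0 \<and> \<mu> l + 1 = \<mu> k then D l z \<zeta> else 0)"

lemma A_inverse: "A *v \<xi>s = \<xi>0" and xis_nonzero: "\<xi>s \<noteq> 0"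
proof -
  have "x = 0" if "A *v x = 0" for x
  proof (rule ccontr)
    assume "x \<noteq> 0"
    then have "cvec x \<noteq> 0" using norm_cvec[of x] by (metis norm_eq_zero)
    moreover have "cmat A *v cvec x = 0 *s cvec x"
      using that by (simp add: cmat_mult_cvec linear_0[OF bounded_linear.linear[OF cvec_linear]])
    ultimately show False using eig unfolding complex_eigenvalue_def by (metis less_irrefl zero_complex.sel(1))
  qed
  then have "invertible A"
    unfolding invertible_left_inverse matrix_left_invertible_ker by blast
  then have "A ** matrix_inv A = mat 1 \<and> matrix_inv A ** A = mat 1"
    unfolding invertible_def matrix_inv_def by (rule someI_ex)
  then show *: "A *v \<xi>s = \<xi>0" by (simp add: \<xi>s_def matrix_vector_mul_assoc)
  then show "\<xi>s \<noteq> 0" using xi0 by auto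
qed

lemma q_1: "q 1 z \<zeta> = (p0 z * z (int m) powr (- \<mu> 1)) *\<^sub>R \<xi>s"
  unfolding q_def by (subst qfun.simps) (simp add: \<xi>s_def)

lemma chi_eq_X:
  assumes "2 \<le> k" and "\<And>j. j < k \<Longrightarrow> q' j = q j"
  shows "chi m n \<mu> p0 q' k z \<zeta> = X k z \<zeta>"
proof (cases "m = 0 \<and> (\<exists>l\<in>{1..k-1}. \<mu> l + 1 = \<mu> k)")
  case True
  then obtain l where l: "l \<in> {1..k-1}" "\<mu> l + 1 = \<mu> k" by blast
  have uniq: "l' = l" if "1 \<le> l'" "\<mu> l' + 1 = \<mu> k" for l'
    using mu_inj[of l' l] that l by auto
  then have the: "(THE l. l \<in> {1..k-1} \<and> \<mu> l + 1 = \<mu> k) = l"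
    using l by (intro the_equality) auto
  have "X k z \<zeta> = (\<Sum>l'=1..<k. if l' = l then D l z \<zeta> else 0)"
    unfolding X_def by (rule sum.cong) (use True uniq l in auto)
  also have "\<dots> = D l z \<zeta>"
  proof -
    have "l \<in> {1..<k}" using l assms(1) by auto
    then show ?thesis by simp
  qed
  finally have XD: "X k z \<zeta> = D l z \<zeta>" .
  have ql: "q' l = q l" using l assms by auto
  show ?thesis
    unfolding chi_def if_P[OF True] the Let_def XD D_def ql by (rule refl)
next
  case False
  have "(if m = 0 \<and> \<mu> l + 1 = \<mu> k then D l z \<zeta> else 0) = 0" if "l \<in> {1..<k}" for l
    using False that by auto
  then have "X k z \<zeta> = 0" unfolding X_def by (intro sum.neutral) blast
  with False show ?thesis by (auto simp: chi_def)
qed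

lemma calQ_eq_Q:
  assumes "1 \<le> k" and "\<And>j. j < k \<Longrightarrow> q' j = q j"
  shows "calQ m \<mu> J \<beta> Fs \<xi>s q' k z \<zeta> = Q k z \<zeta>"
proof -
  have "((z (int m) powr (- \<mu> 1) * \<zeta>) powr (\<beta> r - real (length ks))) *\<^sub>R
      calF (Fs r) \<xi>s (map (\<lambda>j. q' j z \<zeta>) ks) = Qterm (r, ks) z \<zeta>" if "(r, ks) \<in> Qset k" for r ks
  proof -
    have "map (\<lambda>j. q' j z \<zeta>) ks = map (\<lambda>j. q j z \<zeta>) ks"
      using Qset_bounds(5)[OF that assms(1)] assms(2) by simp
    then show ?thesis by (simp only: Qterm_def fst_conv snd_conv)
  qed
  then show ?thesis
    unfolding calQ_def Q_def Qset_def[symmetric]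
    by (intro sum.cong) (simp_all add: case_prod_beta)
qed

lemma q_rec:
  assumes "2 \<le> k"
  shows "q k = opZ A (n k) (\<lambda>z \<zeta>. Q k z \<zeta> + P k z - X k z \<zeta>)"
proof -
  let ?q = "\<lambda>j. if j < k then qfun A m n \<mu> J \<beta> Fs P p0 \<xi>0 j else (\<lambda>z \<zeta>. 0)"
  have "q k = opZ A (n k) (\<lambda>z \<zeta>. calQ m \<mu> J \<beta> Fs (matrix_inv A *v \<xi>0) ?q k z \<zeta> + P k z - chi m n \<mu> p0 ?q k z \<zeta>)"
    unfolding q_def by (subst qfun.simps) (use assms in \<open>simp add: Let_def\<close>)
  also have "\<dots> = opZ A (n k) (\<lambda>z \<zeta>. Q k z \<zeta> + P k z - X k z \<zeta>)"
    unfolding \<xi>s_def[symmetric]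
    by (subst calQ_eq_Q, use assms in \<open>simp_all add: q_def\<close>) (subst chi_eq_X, use assms in \<open>simp_all add: q_def\<close>)
  finally show ?thesis .
qed

lemma Fs_smooth: "r \<in> J \<Longrightarrow> smooth_on (UNIV - {0}) (Fs r)"
  using F_index_set(3)[OF F_H] by (simp add: F_term_def)

lemma rho_scalar_sum:
  assumes "m \<le> K"
  shows "scalar_sum m K (- (e * \<mu> 1)) (\<lambda>z \<zeta>. of_real ((z (int m) powr (- \<mu> 1) * \<zeta>) powr e))"
proof -
  have "scalar_sum m K (- (e * \<mu> 1) + 0) (\<lambda>z \<zeta>. of_real (z (int m) powr (- (e * \<mu> 1))) * of_real (\<zeta> powr e))"
    using assms by (intro scalar_sum_mult scalar_sum_monomial scalar_sum_zeta) auto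
  then show ?thesis
    unfolding add_0_right
  proof (rule scalar_sum_cong)
    fix z :: "int \<Rightarrow> real" and \<zeta> :: real assume z: "z \<in> posdom K" and \<zeta>: "0 < \<zeta>"
    have "0 < z (int m)" using posdomD[OF z] assms by auto
    then show "complex_of_real ((z (int m) powr (- \<mu> 1) * \<zeta>) powr e)
        = of_real (z (int m) powr (- (e * \<mu> 1))) * of_real (\<zeta> powr e)"
      using \<zeta> by (simp add: powr_mult powr_powr mult.commute)
  qed
qed

lemma Qterm_Phat:
  assumes "fst x \<in> J" "m \<le> K" and q: "\<And>j. j \<in> set (snd x) \<Longrightarrow> q j \<in> Phat_m m K (- \<mu> j)"
  shows "Qterm x \<in> Phat_m m K (- (sum_list (map \<mu> (snd x)) + (\<beta> (fst x) - real (length (snd x))) * \<mu> 1))"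
proof -
  have "(\<lambda>z \<zeta>. Dm (Fs (fst x)) ([] @ map (\<lambda>j. q j z \<zeta>) (snd x)) \<xi>s) \<in> Phat_m m K (sum_list (map (\<lambda>j. - \<mu> j) (snd x)))"
    by (rule Phat_Dm[OF Fs_smooth[OF assms(1)]]) (use q xis_nonzero in auto)
  then have "(\<lambda>z \<zeta>. (1 / fact (length (snd x))) *\<^sub>R Dm (Fs (fst x)) (map (\<lambda>j. q j z \<zeta>) (snd x)) \<xi>s)
      \<in> Phat_m m K (0 + sum_list (map (\<lambda>j. - \<mu> j) (snd x)))"
    by (intro Phat_scale scalar_sum_const) simp
  then have "(\<lambda>z \<zeta>. ((z (int m) powr (- \<mu> 1) * \<zeta>) powr (\<beta> (fst x) - real (length (snd x)))) *\<^sub>R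
      calF (Fs (fst x)) \<xi>s (map (\<lambda>j. q j z \<zeta>) (snd x)))
      \<in> Phat_m m K (- ((\<beta> (fst x) - real (length (snd x))) * \<mu> 1) + (0 + sum_list (map (\<lambda>j. - \<mu> j) (snd x))))"
    unfolding calF_def length_map by (rule Phat_scale[OF rho_scalar_sum[OF assms(2)]])
  moreover have "- ((\<beta> (fst x) - real (length (snd x))) * \<mu> 1) + (0 + sum_list (map (\<lambda>j. - \<mu> j) (snd x)))
      = - (sum_list (map \<mu> (snd x)) + (\<beta> (fst x) - real (length (snd x))) * \<mu> 1)"
    using uminus_sum_list_map[of \<mu> "snd x"] by (simp add: o_def)
  ultimately show ?thesis by (simp only: Qterm_def[abs_def])
qed

text \<open>For \<open>m > 0\<close> the factors \<open>z\<^sub>0\<close> have purely imaginary exponents.\<close>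

definition shallow :: "nat \<Rightarrow> real" where "shallow l = (if m = 0 then \<mu> l else 0)"

lemma Phat_shallow: "p \<in> Phat_m m k (- \<mu> l) \<Longrightarrow> p \<in> Phat_m 0 k (- shallow l)"
  by (rule Phat_subset) (auto simp: shallow_def EC_def)

text \<open>R lowers the exponent of z_0 by one, whether it acts on q_l or on \<zeta>_*, and
  differentiation in \<zeta> leaves that exponent unchanged.\<close>

lemma D_Phat:
  assumes l: "1 \<le> l" and q: "q l \<in> Phat_m m (n l) (- \<mu> l)"
  shows "D l \<in> Phat_m 0 (n l) (- (shallow l + 1))"
proof -
  have n1: "int (n 1) \<le> int (n l)" using n_mono[OF order.refl l] by simp
  have "opR (n l) (q l) \<in> Phat_m 0 (n l) (- shallow l - 1)"
    by (rule opR_Phat[OF Phat_shallow[OF q]])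
  then have 1: "opR (n l) (q l) \<in> Phat_m 0 (n l) (- (shallow l + 1))" by simp
  have "lift1 p0 \<in> Phat_m 0 (n 1) 0"
    by (rule Phat_subset[OF P_plus_Phat[OF p0]]) (cases "m = 0"; auto simp: EC_def)
  from opR_Phat[OF this] have "scalar_sum 0 (n 1) (0 - 1) (\<lambda>z \<zeta>. of_real (opR (n 1) (lift1 p0) z \<zeta> $ 1))"
    by (simp add: Phat_iff_scalar_sum)
  from Phat_scale[OF scalar_sum_deeper[OF this n1] Phat_dzeta(1)[OF Phat_shallow[OF q]]]
  have 2: "(\<lambda>z \<zeta>. (opR (n 1) (lift1 p0) z \<zeta> $ 1) *\<^sub>R vector_derivative (\<lambda>s. q l z s) (at \<zeta>))
      \<in> Phat_m 0 (n l) (- (shallow l + 1))"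
    by (simp add: algebra_simps)
  have "D l = (\<lambda>z \<zeta>. opR (n l) (q l) z \<zeta> +
      (opR (n 1) (lift1 p0) z \<zeta> $ 1) *\<^sub>R vector_derivative (\<lambda>s. q l z s) (at \<zeta>))"
    by (intro ext) (rule D_def)
  then show ?thesis by (simp only: Phat_add[OF 1 2])
qed

lemma source_Phat:
  assumes k: "1 \<le> k" and q: "\<And>j. 1 \<le> j \<Longrightarrow> j < k \<Longrightarrow> q j \<in> Phat_m m (n j) (- \<mu> j)"
  shows "(\<lambda>z \<zeta>. Q k z \<zeta> + P k z - X k z \<zeta>) \<in> Phat_m m (n k) (- \<mu> k)"
proof (intro Phat_add Phat_diff P_class k)
  have "Qterm x \<in> Phat_m m (n k) (- \<mu> k)" if x: "x \<in> Qset k" for x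
  proof -
    obtain r ks where rks: "x = (r, ks)" by (cases x)
    note B = Qset_bounds[OF x[unfolded rks]]
    have "q j \<in> Phat_m m (n k) (- \<mu> j)" if "j \<in> set (snd x)" for j
    proof -
      have j: "1 \<le> j" "j < k" using B(3) B(5)[OF k] that by (auto simp: rks)
      then have "int (n j) \<le> int (n k)" using n_mono[of j k] by simp
      with q[OF j] show ?thesis by (rule Phat_deeper)
    qed
    moreover have "fst x \<in> J" using B(1) by (simp only: rks fst_conv)
    moreover have "m \<le> n k" by (rule n_ge[OF k])
    ultimately have "Qterm x \<in> Phat_m m (n k)
        (- (sum_list (map \<mu> (snd x)) + (\<beta> (fst x) - real (length (snd x))) * \<mu> 1))"
      by (intro Qterm_Phat)
    moreover have "sum_list (map \<mu> (snd x)) + (\<beta> (fst x) - real (length (snd x))) * \<mu> 1 = \<mu> k"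
      using x by (auto simp: Qset_def rks)
    ultimately show ?thesis by (simp only:)
  qed
  then show "Q k \<in> Phat_m m (n k) (- \<mu> k)"
    unfolding Q_def[abs_def] by (rule Phat_sum)
  have "(\<lambda>z \<zeta>. if m = 0 \<and> \<mu> l + 1 = \<mu> k then D l z \<zeta> else 0) \<in> Phat_m m (n k) (- \<mu> k)"
    if l: "l \<in> {1..<k}" for l
  proof (cases "m = 0 \<and> \<mu> l + 1 = \<mu> k")
    case True
    have "D l \<in> Phat_m 0 (n l) (- (shallow l + 1))" using l by (intro D_Phat q) auto
    then have "D l \<in> Phat_m 0 (n k) (- (shallow l + 1))"
      by (rule Phat_deeper) (use l n_mono[of l k] in auto)
    moreover have "shallow l + 1 = \<mu> k" unfolding shallow_def using True by metis
    moreover have "int m = 0" using True by simp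
    ultimately have "D l \<in> Phat_m m (n k) (- \<mu> k)" by (simp only:)
    then show ?thesis unfolding if_P[OF True] .
  next
    case False
    show ?thesis unfolding if_not_P[OF False] by (rule Phat_zero)
  qed
  then show "X k \<in> Phat_m m (n k) (- \<mu> k)"
    unfolding X_def[abs_def] by (rule Phat_sum)
qed

theorem q_Phat: "1 \<le> k \<Longrightarrow> q k \<in> Phat_m m (n k) (- \<mu> k)"
proof (induction k rule: less_induct)
  case (less k)
  show ?case
  proof (cases "k = 1")
    case True
    have "scalar_sum m (n 1) (- \<mu> 1) (\<lambda>z \<zeta>. complex_of_real (z (int m) powr (- \<mu> 1)))"
      using n_ge[of 1] by (intro scalar_sum_monomial) auto
    from scalar_sum_mult[OF P_plus_scalar_sum[OF p0] this]
    have "scalar_sum m (n 1) (- \<mu> 1) (\<lambda>z \<zeta>. of_real (p0 z * z (int m) powr (- \<mu> 1)))" by simp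
    from Phat_scale[OF this, of "\<lambda>_ _. \<xi>s" 0]
    have "(\<lambda>z \<zeta>. (p0 z * z (int m) powr (- \<mu> 1)) *\<^sub>R \<xi>s) \<in> Phat_m m (n 1) (- \<mu> 1)"
      by (simp add: Phat_iff_scalar_sum scalar_sum_const)
    moreover have "q 1 = (\<lambda>z \<zeta>. (p0 z * z (int m) powr (- \<mu> 1)) *\<^sub>R \<xi>s)" by (intro ext q_1)
    ultimately show ?thesis by (simp only: True)
  next
    case False
    with less.prems have k: "2 \<le> k" by simp
    show ?thesis
      unfolding q_rec[OF k] by (rule opZ_Phat(1)[OF eig]) (use source_Phat less in auto)
  qed
qed

lemma Qset_1: "Qset 1 = {}"
proof -
  have False if "x \<in> Qset 1" for x
  proof -
    obtain r ks where x: "x = (r, ks)" by (cases x)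
    have "\<beta> r * \<mu> 1 \<le> \<mu> 1" "1 < \<beta> r" using Qset_bounds(1,2)[OF that[unfolded x]] beta_gt by auto
    then show False using mu_pos[of 1] by simp
  qed
  then show ?thesis by blast
qed

text \<open>For \<open>k = 1\<close> both \<open>Q\<close> and \<open>X\<close> vanish.\<close>

lemma q_equation:
  assumes k: "1 \<le> k" and z: "z \<in> posdom (n k)" and \<zeta>: "0 < \<zeta>"
  shows "A *v q k z \<zeta> + opM (n k) (-1) (q k) z \<zeta> = Q k z \<zeta> + P k z - X k z \<zeta>"
proof (cases "k = 1")
  case False
  with k have k2: "2 \<le> k" by simp
  show ?thesis unfolding q_rec[OF k2]
    by (rule opZ_Phat(2)[OF eig _ source_Phat z \<zeta>]) (use k q_Phat in auto)
next
  case True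
  have "opM (n 1) (-1) (q 1) z \<zeta> = 0"
    by (rule opM_independent[OF q_Phat[OF order.refl]])
      (use z \<zeta> True P_plus_independent[OF p0] in \<open>auto simp del: One_nat_def simp: q_1\<close>)
  moreover have "A *v q 1 z \<zeta> = P 1 z"
    using z by (simp del: One_nat_def add: True q_1 P_1 matrix_vector_mult_scaleR A_inverse)
  moreover have "Q 1 z \<zeta> = 0" "X 1 z \<zeta> = 0" by (simp_all only: Q_def X_def Qset_1) simp_all
  ultimately show ?thesis by (simp only: True) simp
qed

end

section \<open>The asymptotic expansion\<close>

context expansion
begin

definition ze :: "real \<Rightarrow> real" where "ze t = p0 (logs t)"

definition h :: "nat \<Rightarrow> real \<Rightarrow> real^'n" where "h k t = q k (logs t) (ze t)"

lemma ze_subpower: "subpower m ze"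
  unfolding ze_def using P_plus_subpower[OF p0] n_ge[of 1] by simp

lemmas ze_pos = subpower_pos[OF ze_subpower]

lemma h_decay: "1 \<le> k \<Longrightarrow> decay_upto m (\<mu> k) (h k)"
  unfolding h_def by (rule Phat_decay[OF q_Phat _ _ ze_subpower]) (use n_ge in auto)

text \<open>For m = 0 the order is \<mu>_l + 1. For m > 0 the factor 1/t alone gives decay beyond
  every s, which is why the hypothesis on s is conditional.\<close>

lemma D_decay:
  assumes l: "1 \<le> l" and s: "m = 0 \<Longrightarrow> s < \<mu> l + 1"
  shows "decay_beyond m s (\<lambda>t. D l (logs t) (ze t))"
proof -
  have "subpower 0 ze" by (rule subpower_shallower[OF ze_subpower]) auto
  then have *: "decay_upto 0 (shallow l + 1) (\<lambda>t. D l (logs t) (ze t))"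
    by (intro Phat_decay[OF D_Phat[OF l q_Phat[OF l]]]) auto
  show ?thesis
  proof (cases "m = 0")
    case True
    have "decay_beyond 0 s (\<lambda>t. D l (logs t) (ze t))"
      by (rule decay_upto_imp_beyond[OF *]) (unfold shallow_def if_P[OF True], rule s[OF True])
    moreover have "int m = 0" using True by simp
    ultimately show ?thesis by (simp only:)
  next
    case False
    then have "shallow l = 0" by (simp add: shallow_def)
    \<comment> \<open>Any positive rate below 1 would do; a power of t beats all powers of
      L_m.\<close>
    with * have half: "decay 0 (1 / 2) (\<lambda>t. D l (logs t) (ze t))" by (simp add: decay_upto_def)
    have "decay m (s + 1) (\<lambda>t. D l (logs t) (ze t))"
      by (rule decay_0_imp[OF _ half]) (use False in auto)
    then show ?thesis unfolding decay_beyond_def by (intro exI[of _ "s + 1"]) auto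
  qed
qed

text \<open>The time derivative of h_k consists of the z_(-1) part and D_k. The recursion for q_k
  was made to express the former by A h_k and the source terms, so D_k is the only part left
  uncompensated at this index.\<close>

lemma h_ode:
  assumes k: "1 \<le> k"
  shows "eventually (\<lambda>t. (h k has_vector_derivative (Q k (logs t) (ze t) + P k (logs t)
    - X k (logs t) (ze t) + D k (logs t) (ze t) - A *v h k t)) (at t)) at_top"
  using eventually_logs_posdom[of "n k"] ze_pos
proof eventually_elim
  case (elim t)
  have t1: "logs t \<in> posdom (n 1)"
    using n_mono[OF order.refl k] by (intro posdom_mono[OF _ elim(1)]) simp
  have dze: "(ze has_real_derivative opR (n 1) (lift1 p0) (logs t) (ze t) $ 1) (at t)"
    using P_plus_derivative[OF p0 _ t1 elim(2)] by (simp add: ze_def[abs_def])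
  have pos: "eventually (\<lambda>s. 0 < ze s) (nhds t)"
    using DERIV_isCont[OF dze] elim(2)
    by (simp add: eventually_nhds_conv_at isCont_def order_tendstoD(1))
  have "(h k has_vector_derivative (opM (n k) (-1) (q k) (logs t) (ze t) + D k (logs t) (ze t))) (at t)"
    using Phat_logs_derivative[OF q_Phat[OF k] _ elim(1) pos dze]
    by (simp add: h_def[abs_def] D_def add.assoc)
  moreover have "opM (n k) (-1) (q k) (logs t) (ze t)
      = Q k (logs t) (ze t) + P k (logs t) - X k (logs t) (ze t) - A *v h k t"
    using q_equation[OF k elim] by (simp add: h_def algebra_simps)
  ultimately show ?case by (simp add: algebra_simps)
qed

text \<open>For m = 0, X_k equals D_l for the l with \<mu>_l + 1 = \<mu>_k. Summed up to N, this
  cancels every D_l for which \<mu>_l + 1 is among the first N exponents, recorded by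
  \<open>hit\<close>. Otherwise \<mu>_l + 1 is still some exponent, hence a later one, and D_l
  decays beyond \<mu>_N. For m > 0 all X_k vanish and each D_k is negligible.\<close>

lemma X_D_decay:
  assumes N: "1 \<le> N"
  shows "decay_beyond m (\<mu> N) (\<lambda>t. \<Sum>k=1..N. X k (logs t) (ze t) - D k (logs t) (ze t))"
proof (cases "m = 0")
  case False
  then have "X k z \<zeta> = 0" for k z \<zeta> by (simp add: X_def)
  then show ?thesis
    using False by (auto intro!: decay_beyond_sum decay_beyond_uminus D_decay)
next
  case True
  define hit where "hit l \<longleftrightarrow> (\<exists>k\<in>{1..N}. \<mu> l + 1 = \<mu> k)" for l
  have X: "X k z \<zeta> = (\<Sum>l=1..N. if \<mu> l + 1 = \<mu> k then D l z \<zeta> else 0)" if k: "k \<in> {1..N}" for k z \<zeta>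
  proof -
    have "X k z \<zeta> = (\<Sum>l=1..<k. if \<mu> l + 1 = \<mu> k then D l z \<zeta> else 0)"
      unfolding X_def by (rule sum.cong) (use True in auto)
    also have "\<dots> = (\<Sum>l=1..N. if \<mu> l + 1 = \<mu> k then D l z \<zeta> else 0)"
    proof (rule sum.mono_neutral_left)
      show "\<forall>l\<in>{1..N} - {1..<k}. (if \<mu> l + 1 = \<mu> k then D l z \<zeta> else 0) = 0"
      proof
        fix l assume l: "l \<in> {1..N} - {1..<k}"
        then have "\<mu> k \<le> \<mu> l" using k by (subst mu_le_iff) auto
        then show "(if \<mu> l + 1 = \<mu> k then D l z \<zeta> else 0) = 0" by simp
      qed
    qed (use k in auto)
    finally show ?thesis .
  qed
  have fiber: "(\<Sum>k=1..N. if \<mu> l + 1 = \<mu> k then D l z \<zeta> else 0) = (if hit l then D l z \<zeta> else 0)" for l z \<zeta>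
  proof (cases "hit l")
    case True
    then obtain k where k: "k \<in> {1..N}" "\<mu> l + 1 = \<mu> k" by (auto simp: hit_def)
    have "(\<Sum>k'=1..N. if \<mu> l + 1 = \<mu> k' then D l z \<zeta> else 0) = (\<Sum>k'=1..N. if k' = k then D l z \<zeta> else 0)"
      by (rule sum.cong) (use k mu_inj in auto)
    with k True show ?thesis by simp
  next
    case False
    have "(\<Sum>k'=1..N. if \<mu> l + 1 = \<mu> k' then D l z \<zeta> else 0) = 0"
      by (rule sum.neutral) (use False in \<open>auto simp: hit_def\<close>)
    with False show ?thesis by simp
  qed
  have eq: "(\<Sum>k=1..N. X k z \<zeta> - D k z \<zeta>) = (\<Sum>l=1..N. if hit l then 0 else - D l z \<zeta>)" for z \<zeta>
  proof -
    have "(\<Sum>k=1..N. X k z \<zeta>) = (\<Sum>k=1..N. \<Sum>l=1..N. if \<mu> l + 1 = \<mu> k then D l z \<zeta> else 0)"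
      by (rule sum.cong) (simp_all only: X)
    also have "\<dots> = (\<Sum>l=1..N. if hit l then D l z \<zeta> else 0)"
      by (subst sum.swap) (simp only: fiber)
    finally have "(\<Sum>k=1..N. X k z \<zeta> - D k z \<zeta>) = (\<Sum>l=1..N. (if hit l then D l z \<zeta> else 0) - D l z \<zeta>)"
      by (simp only: sum_subtractf)
    also have "\<dots> = (\<Sum>l=1..N. if hit l then 0 else - D l z \<zeta>)"
      by (rule sum.cong) auto
    finally show ?thesis .
  qed
  have "decay_beyond m (\<mu> N) (\<lambda>t. if hit l then 0 else - D l (logs t) (ze t))" if l: "l \<in> {1..N}" for l
  proof (cases "hit l")
    case False
    obtain k where k: "1 \<le> k" "\<mu> k = \<mu> l + 1" using mu_plus_one[OF True, of l] l by auto
    have "k \<notin> {1..N}" using False k(2)[symmetric] unfolding hit_def by blast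
    with k N have "\<mu> N < \<mu> k" by (subst mu_less_iff) auto
    with k have "decay_beyond m (\<mu> N) (\<lambda>t. - D l (logs t) (ze t))"
      using l by (intro decay_beyond_uminus D_decay) auto
    with False show ?thesis by simp
  qed (simp add: decay_beyond_zero)
  then show ?thesis unfolding eq by (intro decay_beyond_sum) auto
qed

section \<open>The expansion of a decaying solution\<close>

context
  fixes y :: "real \<Rightarrow> real^'n"
  assumes sol: "eventually (\<lambda>t. (y has_vector_derivative (F (y t) + f t - A *v y t)) (at t)) at_top"
    and lim: "(y \<longlongrightarrow> 0) at_top"
begin

text \<open>The forcing g of the difference is the sum of three errors: of the nonlinearity, of the
  external forcing and of the derivatives. All are beyond \<mu>_N, and the linear equation hands
  their common rate on to the difference.\<close>

lemma linear_step:
  assumes N: "1 \<le> N"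
    and F: "decay_beyond m (\<mu> N) (\<lambda>t. F (y t) - (\<Sum>k=1..N. Q k (logs t) (ze t)))"
  shows "decay_beyond m (\<mu> N) (\<lambda>t. y t - (\<Sum>k=1..N. h k t))"
proof -
  define g where "g t = (F (y t) - (\<Sum>k=1..N. Q k (logs t) (ze t))) + (f t - (\<Sum>k=1..N. P k (logs t)))
    + (\<Sum>k=1..N. X k (logs t) (ze t) - D k (logs t) (ze t))" for t
  have "decay_beyond m (\<mu> N) g"
    unfolding g_def by (intro decay_beyond_add F f_expansion N X_D_decay) auto
  then obtain \<nu> where \<nu>: "\<mu> N < \<nu>" "decay m \<nu> g" by (auto simp: decay_beyond_def)
  obtain K where K: "eventually (\<lambda>t. norm (g t) \<le> K * L m t powr - \<nu>) at_top"
    using \<nu>(2) by (rule decayE)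
  let ?w = "\<lambda>t. y t - (\<Sum>k=1..N. h k t)"
  have "decay m \<nu> ?w"
  proof (rule ode_decay[OF eig])
    have "eventually (\<lambda>t. \<forall>k\<in>{1..N}. (h k has_vector_derivative (Q k (logs t) (ze t) + P k (logs t)
      - X k (logs t) (ze t) + D k (logs t) (ze t) - A *v h k t)) (at t)) at_top"
      by (intro eventually_ball_finite) (auto intro: h_ode)
    with sol show "eventually (\<lambda>t. (?w has_vector_derivative (g t - A *v ?w t)) (at t)) at_top"
    proof eventually_elim
      case (elim t)
      have "(?w has_vector_derivative (F (y t) + f t - A *v y t - (\<Sum>k=1..N. Q k (logs t) (ze t) + P k (logs t)
          - X k (logs t) (ze t) + D k (logs t) (ze t) - A *v h k t))) (at t)"
        using elim by (intro has_vector_derivative_diff has_vector_derivative_sum) auto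
      moreover have "F (y t) + f t - A *v y t - (\<Sum>k=1..N. Q k (logs t) (ze t) + P k (logs t)
          - X k (logs t) (ze t) + D k (logs t) (ze t) - A *v h k t) = g t - A *v ?w t"
        by (simp add: g_def sum.distrib sum_subtractf matrix_vector_mult_diff_distrib
            linear_sum[OF Finite_Cartesian_Product.matrix_vector_mul_linear] algebra_simps)
      ultimately show ?case by simp
    qed
    fix \<epsilon> :: real assume e: "0 < \<epsilon>"
    show "eventually (\<lambda>s. norm (g s) \<le> \<epsilon> * norm (?w s) + K * L m s powr - \<nu>) at_top"
      using K by eventually_elim (use e in \<open>simp add: add.commute add_increasing2\<close>)
  qed simp
  with \<nu>(1) show ?thesis by (auto simp: decay_beyond_def)
qed

lemma F_small: "0 < \<epsilon> \<Longrightarrow> eventually (\<lambda>t. norm (F (y t)) \<le> \<epsilon> * norm (y t)) at_top"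
proof -
  assume e: "0 < \<epsilon>"
  obtain C b \<delta> where C: "0 \<le> C" "1 < b" "0 < \<delta>" "\<And>x. norm x < \<delta> \<Longrightarrow> norm (F x) \<le> C * norm x powr b"
    using F_superlinear[OF F_H F0] by blast
  have lim0: "((\<lambda>t. norm (y t)) \<longlongrightarrow> 0) at_top" using lim by (rule tendsto_norm_zero)
  have "((\<lambda>t. C * norm (y t) powr (b - 1)) \<longlongrightarrow> C * 0 powr (b - 1)) at_top"
    by (intro tendsto_intros tendsto_powr' lim0) (use C in auto)
  then have "eventually (\<lambda>t. C * norm (y t) powr (b - 1) < \<epsilon>) at_top"
    using e by (intro order_tendstoD(2)[where a=\<epsilon>]) auto
  moreover have "eventually (\<lambda>t. norm (y t) < \<delta>) at_top" using order_tendstoD(2)[OF lim0 C(3)] .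
  ultimately show ?thesis
  proof eventually_elim
    case (elim t)
    have "norm (F (y t)) \<le> C * norm (y t) powr b" using C(4) elim by simp
    also have "\<dots> = (C * norm (y t) powr (b - 1)) * norm (y t)"
      by (cases "y t = 0") (simp_all add: powr_diff)
    also have "\<dots> \<le> \<epsilon> * norm (y t)" using elim by (intro mult_right_mono) auto
    finally show ?case .
  qed
qed

text \<open>As y tends to 0, F(y) is o(|y|) and is absorbed into the linear bound. So the rate is
  that of f, which is as good as that of its leading term.\<close>

lemma y_decay: "decay_upto m (\<mu> 1) y"
  unfolding decay_upto_def
proof (intro allI impI)
  fix \<nu> assume \<nu>: "\<nu> < \<mu> 1"
  have "decay_upto m (\<mu> 1) (\<lambda>t. (f t - (\<Sum>k=1..1. P k (logs t))) + P 1 (logs t))"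
    by (intro decay_upto_add decay_beyond_imp_upto f_expansion Phat_decay[OF P_class _ _ ze_subpower])
      (use n_ge[of 1] in auto)
  then have "decay m \<nu> f" using \<nu> by (simp add: decay_upto_def)
  then obtain K where K: "eventually (\<lambda>t. norm (f t) \<le> K * L m t powr - \<nu>) at_top" by (rule decayE)
  show "decay m \<nu> y"
  proof (rule ode_decay[OF eig _ sol])
    fix \<epsilon> :: real assume "0 < \<epsilon>"
    from F_small[OF this] K
    show "eventually (\<lambda>s. norm (F (y s) + f s) \<le> \<epsilon> * norm (y s) + K * L m s powr - \<nu>) at_top"
      by eventually_elim (rule order_trans[OF norm_triangle_ineq add_mono])
  qed simp
qed

lemma y_lt: "0 < \<delta> \<Longrightarrow> eventually (\<lambda>t. norm (y t) < \<delta>) at_top"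
  using order_tendstoD(2)[OF tendsto_norm_zero[OF lim]] .

lemma F_base: "decay_beyond m (\<mu> 1) (\<lambda>t. F (y t))"
proof -
  obtain C b \<delta> where C: "0 \<le> C" "1 < b" "0 < \<delta>" "\<And>x. norm x < \<delta> \<Longrightarrow> norm (F x) \<le> C * norm x powr b"
    using F_superlinear[OF F_H F0] by blast
  \<comment> \<open>Only rates below \<mu>_1 are known for y; since b > 1, a rate \<nu> close to
    \<mu>_1 still gives b \<nu> > \<mu>_1.\<close>
  have "\<mu> 1 / b < \<mu> 1" using C(2) mu_pos[of 1] by (simp add: divide_less_eq)
  then obtain \<nu> where \<nu>: "\<mu> 1 / b < \<nu>" "\<nu> < \<mu> 1" using dense by blast
  have "decay m (b * \<nu>) (\<lambda>t. F (y t))"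
  proof (rule decay_powr)
    show "decay m \<nu> y" using y_decay \<nu>(2) by (simp add: decay_upto_def)
    show "eventually (\<lambda>t. norm (F (y t)) \<le> C * norm (y t) powr b) at_top"
      using y_lt[OF C(3)] by eventually_elim (rule C(4))
  qed (use C in auto)
  moreover have "\<mu> 1 < b * \<nu>" using \<nu>(1) C(2) by (simp add: divide_less_eq mult.commute)
  ultimately show ?thesis by (auto simp: decay_beyond_def)
qed

definition rho :: "real \<Rightarrow> real" where "rho t = L m t powr (- \<mu> 1) * ze t"

lemma rho_pos: "eventually (\<lambda>t. 0 < rho t) at_top"
  using ze_pos eventually_L_gt[of m 0] by (auto simp: rho_def elim: eventually_elim2)

text \<open>The exponent e may be negative: dividing by \<rho> costs \<mu>_1 and an arbitrarily
  small amount more, although \<zeta>_* is neither bounded nor bounded away from zero in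
  general.\<close>

lemma rho_decay: "decay_upto m (e * \<mu> 1) (\<lambda>t. rho t powr e)"
  unfolding decay_upto_def
proof (intro allI impI)
  fix \<nu> assume "\<nu> < e * \<mu> 1"
  then have "decay m \<nu> (\<lambda>t. complex_of_real ((logs t (int m) powr (- \<mu> 1) * ze t) powr e))"
    by (intro scalar_sum_decay[OF rho_scalar_sum _ _ ze_subpower, of m]) auto
  then show "decay m \<nu> (\<lambda>t. rho t powr e)"
    by (simp add: decay_def rho_def logs_def)
qed

lemma h_1: "h 1 t = rho t *\<^sub>R \<xi>s"
  unfolding h_def q_1 by (simp add: rho_def ze_def logs_def mult.commute)

text \<open>The normalized correction \<open>\<eta>\<close> in \<open>y = \<rho> (\<xi>\<^sub>* + \<eta>)\<close>, up to order \<open>N\<close>.\<close>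

definition eta :: "nat \<Rightarrow> real \<Rightarrow> real^'n"
  where "eta N t = (\<Sum>k=2..N. inverse (rho t) *\<^sub>R h k t)"

lemma inverse_rho_mult_decay:
  assumes "decay_upto m s g"
  shows "decay_upto m (s - \<mu> 1) (\<lambda>t. inverse (rho t) *\<^sub>R g t)"
  unfolding decay_upto_def
proof (intro allI impI)
  fix \<nu> assume \<nu>: "\<nu> < s - \<mu> 1"
  define d where "d = (s - \<mu> 1 - \<nu>) / 2"
  have d: "0 < d" "\<nu> = (- 1 * \<mu> 1 - d) + (s - d)" using \<nu> by (simp_all add: d_def field_simps)
  show "decay m \<nu> (\<lambda>t. inverse (rho t) *\<^sub>R g t)"
    unfolding d(2)
  proof (rule decay_mult)
    show "decay m (- 1 * \<mu> 1 - d) (\<lambda>t. rho t powr - 1)"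
      using rho_decay[of "-1"] d(1) unfolding decay_upto_def by simp
    show "decay m (s - d) g" using assms d(1) by (simp add: decay_upto_def)
    show "eventually (\<lambda>t. norm (inverse (rho t) *\<^sub>R g t) \<le> 1 * (norm (rho t powr - 1) * norm (g t))) at_top"
      using rho_pos by eventually_elim (simp add: powr_minus)
  qed simp
qed

text \<open>Half of the gap, so as to lie strictly below every \<mu>_k - \<mu>_1 with k \<ge> 2;
  only rates below those numbers are available for the summands of \<eta>.\<close>

definition \<delta> :: real where "\<delta> = (\<mu> 2 - \<mu> 1) / 2"

lemma delta_pos: "0 < \<delta>"
  using mu_less[of 1 2] by (simp add: \<delta>_def)

lemma eta_decay: "decay m \<delta> (eta N)"
  unfolding eta_def[abs_def]
proof (rule decay_sum)
  fix k assume k: "k \<in> {2..N}"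
  have "\<mu> 2 \<le> \<mu> k" using k by (subst mu_le_iff) auto
  then have "\<delta> < \<mu> k - \<mu> 1" using mu_less[of 1 2] by (simp add: \<delta>_def)
  moreover have "decay_upto m (\<mu> k - \<mu> 1) (\<lambda>t. inverse (rho t) *\<^sub>R h k t)"
    using k by (intro inverse_rho_mult_decay h_decay) auto
  ultimately show "decay m \<delta> (\<lambda>t. inverse (rho t) *\<^sub>R h k t)" by (simp add: decay_upto_def)
qed

lemma Qterm_decay:
  assumes x: "fst x \<in> J" "\<forall>j\<in>set (snd x). 1 \<le> j \<and> j \<le> N" and N: "1 \<le> N"
  shows "decay_upto m (sum_list (map \<mu> (snd x)) + (\<beta> (fst x) - real (length (snd x))) * \<mu> 1)
    (\<lambda>t. Qterm x (logs t) (ze t))"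
proof (rule Phat_decay[OF Qterm_Phat _ _ ze_subpower])
  show "m \<le> n N" "int m \<le> int (n N)" using n_ge[OF N] by simp_all
  fix j assume "j \<in> set (snd x)"
  with x(2) have j: "1 \<le> j" "j \<le> N" by auto
  show "q j \<in> Phat_m m (n N) (- \<mu> j)"
    by (rule Phat_deeper[OF q_Phat[OF j(1)]]) (use n_mono[OF j] in simp)
qed (use x in auto)

text \<open>Multilinearity turns the Taylor polynomial at \<eta> into a sum over lists. A list of
  length i carries \<rho> to the power - i from its entries, which combines with the homogeneity
  factor to the exponent \<beta>_r - i of the construction.\<close>

lemma taylor_expand:
  assumes r: "r \<in> J" and rho: "0 < rho t"
  shows "(\<Sum>i<M. rho t powr \<beta> r *\<^sub>R (1 / fact i) *\<^sub>R Dm (Fs r) (replicate i (eta N t)) \<xi>s)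
    = (\<Sum>ks\<in>{ks. set ks \<subseteq> {2..N} \<and> length ks < M}. Qterm (r, ks) (logs t) (ze t))"
proof -
  let ?B = "\<lambda>i. {ks. set ks \<subseteq> {2..N} \<and> length ks = i}"
  have xis: "\<xi>s \<in> UNIV - {0}" using xis_nonzero by simp
  have step: "rho t powr \<beta> r *\<^sub>R (1 / fact i) *\<^sub>R Dm (Fs r) (replicate i (eta N t)) \<xi>s
      = (\<Sum>ks\<in>?B i. Qterm (r, ks) (logs t) (ze t))" for i
  proof -
    have "Dm (Fs r) (replicate i (eta N t)) \<xi>s
        = (\<Sum>ks\<in>?B i. Dm (Fs r) ([] @ map (\<lambda>k. inverse (rho t) *\<^sub>R h k t) ks) \<xi>s)"
      unfolding eta_def
      using Dm_replicate_sum[OF Fs_smooth[OF r] _ xis, of "{2..N}" "[]" i "\<lambda>k. inverse (rho t) *\<^sub>R h k t"]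
      by (simp add: open_delete)
    also have "\<dots> = (\<Sum>ks\<in>?B i. inverse (rho t) ^ length ks *\<^sub>R Dm (Fs r) ([] @ map (\<lambda>k. h k t) ks) \<xi>s)"
      by (subst Dm_scale_all[OF Fs_smooth[OF r] _ xis]) (simp_all add: open_delete)
    finally have eq: "Dm (Fs r) (replicate i (eta N t)) \<xi>s
        = (\<Sum>ks\<in>?B i. inverse (rho t) ^ length ks *\<^sub>R Dm (Fs r) (map (\<lambda>k. h k t) ks) \<xi>s)" by simp
    have "rho t powr (\<beta> r - real i) = rho t powr \<beta> r * inverse (rho t) ^ i" for i
      using rho by (simp add: powr_diff powr_realpow field_simps)
    note powr = this
    have lm: "logs t (int m) = L m t" by (simp add: logs_def)
    have "Qterm (r, ks) (logs t) (ze t) = (rho t powr \<beta> r * inverse (rho t) ^ length ks) *\<^sub>R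
        (1 / fact (length ks)) *\<^sub>R Dm (Fs r) (map (\<lambda>k. h k t) ks) \<xi>s" for ks
      unfolding powr[symmetric]
      by (simp only: Qterm_def calF_def fst_conv snd_conv length_map h_def rho_def lm)
    then show ?thesis
      unfolding eq scaleR_sum_right by (intro sum.cong) (auto simp: mult_ac)
  qed
  have "{ks. set ks \<subseteq> {2..N} \<and> length ks < M} = (\<Union>i<M. ?B i)" by auto
  moreover have "(\<Sum>ks\<in>(\<Union>i<M. ?B i). Qterm (r, ks) (logs t) (ze t))
      = (\<Sum>i<M. \<Sum>ks\<in>?B i. Qterm (r, ks) (logs t) (ze t))"
    by (rule sum.UNION_disjoint) (auto intro: finite_lists_length_eq)
  ultimately show ?thesis by (simp only: step)
qed

text \<open>With y = \<rho> (\<open>\<xi>s\<close> + \<eta> + v), where v is the normalized error of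
  order N, the error splits into e1, the effect of dropping v, and e2, the Taylor remainder. The
  gain over \<mu>_N comes from e1: the factor \<rho> to the power \<beta>_r contributes \<beta>_r
  \<mu>_1, while normalizing v costs only \<mu>_1.\<close>

lemma Fs_taylor_error:
  assumes r: "r \<in> J" and N: "1 \<le> N" and M: "\<mu> (Suc N) \<le> real M * \<delta>" "0 < M"
    and w: "decay_beyond m (\<mu> N) (\<lambda>t. y t - (\<Sum>k=1..N. h k t))"
  shows "decay_beyond m (\<mu> (Suc N)) (\<lambda>t. Fs r (y t)
    - (\<Sum>i<M. rho t powr \<beta> r *\<^sub>R (1 / fact i) *\<^sub>R Dm (Fs r) (replicate i (eta N t)) \<xi>s))"
proof -
  define v where "v t = inverse (rho t) *\<^sub>R (y t - (\<Sum>k=1..N. h k t))" for t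
  \<comment> \<open>The ball of this radius avoids the origin, where smoothness may fail. Keeping
    \<eta> and v each below R / 2 leaves both base points and their sum inside.\<close>
  define R where "R = norm \<xi>s / 2"
  have R: "0 < R" using xis_nonzero by (simp add: R_def)
  have "cball \<xi>s R \<subseteq> UNIV - {0}" using xis_nonzero by (auto simp: R_def dist_norm)
  note T = taylor_bound[OF Fs_smooth[OF r] _ this]
  obtain C1 where C1: "0 \<le> C1" "\<And>x h. x \<in> cball \<xi>s R \<Longrightarrow> x + h \<in> cball \<xi>s R \<Longrightarrow>
      norm (Fs r (x + h) - Fs r x) \<le> C1 * norm h"
    using T[of 1] by (auto simp: open_delete)
  obtain C2 where C2: "0 \<le> C2" "\<And>x h. x \<in> cball \<xi>s R \<Longrightarrow> x + h \<in> cball \<xi>s R \<Longrightarrow>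
      norm (Fs r (x + h) - (\<Sum>i<M. (1 / fact i) *\<^sub>R Dm (Fs r) (replicate i h) x)) \<le> C2 * norm h ^ M"
    using T[of M] M(2) by (auto simp: open_delete)
  have beyond_v: "decay_beyond m (- \<mu> 1 + \<mu> N) v"
  proof -
    have "decay_beyond m (- 1 * \<mu> 1 + \<mu> N) v"
    proof (rule decay_upto_beyond_mult[OF _ rho_decay w])
      show "eventually (\<lambda>t. norm (v t) \<le> 1 * (norm (rho t powr - 1) * norm (y t - (\<Sum>k=1..N. h k t)))) at_top"
        using rho_pos by eventually_elim (simp add: v_def powr_minus)
    qed simp
    then show ?thesis by simp
  qed
  have "0 \<le> - \<mu> 1 + \<mu> N" using mu_le_iff[of 1 N] N by auto
  moreover obtain \<nu> where \<nu>: "- \<mu> 1 + \<mu> N < \<nu>" "decay m \<nu> v"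
    using beyond_v unfolding decay_beyond_def by blast
  ultimately have "0 < \<nu>" by linarith
  with \<nu>(2) have lim_v: "(v \<longlongrightarrow> 0) at_top" by (intro decay_tendsto_0[of m]) auto
  have lim_eta: "(eta N \<longlongrightarrow> 0) at_top" by (rule decay_tendsto_0[OF _ eta_decay delta_pos]) simp
  have ev: "eventually (\<lambda>t. norm (v t) < R / 2) at_top" "eventually (\<lambda>t. norm (eta N t) < R / 2) at_top"
    using order_tendstoD(2)[OF tendsto_norm_zero[OF lim_v], of "R / 2"]
      order_tendstoD(2)[OF tendsto_norm_zero[OF lim_eta], of "R / 2"] R by auto
  define e1 where "e1 t = rho t powr \<beta> r *\<^sub>R (Fs r ((\<xi>s + eta N t) + v t) - Fs r (\<xi>s + eta N t))" for t
  define e2 where "e2 t = rho t powr \<beta> r *\<^sub>R (Fs r (\<xi>s + eta N t)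
    - (\<Sum>i<M. (1 / fact i) *\<^sub>R Dm (Fs r) (replicate i (eta N t)) \<xi>s))" for t
  have "decay_beyond m (\<beta> r * \<mu> 1 + (- \<mu> 1 + \<mu> N)) e1"
  proof (rule decay_upto_beyond_mult[OF _ rho_decay beyond_v])
    show "eventually (\<lambda>t. norm (e1 t) \<le> C1 * (norm (rho t powr \<beta> r) * norm (v t))) at_top"
      using ev
    proof eventually_elim
      case (elim t)
      have "norm (eta N t + v t) \<le> R" using elim norm_triangle_ineq[of "eta N t" "v t"] by linarith
      then have "norm (Fs r ((\<xi>s + eta N t) + v t) - Fs r (\<xi>s + eta N t)) \<le> C1 * norm (v t)"
        using elim R norm_minus_cancel[of "eta N t"] norm_minus_cancel[of "eta N t + v t"]
        by (intro C1(2)) (simp_all add: dist_norm algebra_simps norm_minus_commute)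
      from mult_left_mono[OF this, of "rho t powr \<beta> r"] show ?case
        by (simp add: e1_def mult.left_commute)
    qed
  qed simp
  \<comment> \<open>The improved order is itself an exponent above \<mu>_N, hence at least
    \<mu>_(N+1); no closer estimate of the gain is required.\<close>
  moreover obtain k where k: "1 \<le> k" "\<mu> k = \<mu> N + (\<beta> r - 1) * \<mu> 1" using mu_plus_beta[OF r N] by auto
  have "\<mu> N < \<mu> k" using k(2) beta_gt[OF r] mu_pos[of 1] by simp
  then have "\<mu> (Suc N) \<le> \<mu> k" using mu_less_iff[OF N k(1)] mu_le_iff[of "Suc N" k] k(1) by simp
  ultimately have b1: "decay_beyond m (\<mu> (Suc N)) e1"
    by (elim decay_beyond_mono) (simp only: k(2), simp add: algebra_simps)
  \<comment> \<open>The power of \<eta> already reaches \<mu>_(N+1) by the choice of M; any positive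
    part of the rate of \<rho> to the power \<beta>_r makes this strict.\<close>
  have "decay m (\<beta> r * \<mu> 1 / 2 + real M * \<delta>) e2"
  proof (rule decay_mult)
    have "0 < \<beta> r * \<mu> 1" using beta_gt[OF r] mu_pos[of 1] by simp
    then show "decay m (\<beta> r * \<mu> 1 / 2) (\<lambda>t. rho t powr \<beta> r)"
      using rho_decay[of "\<beta> r"] by (simp add: decay_upto_def)
    show "decay m (real M * \<delta>) (\<lambda>t. norm (eta N t) ^ M)"
      by (rule decay_powr[OF _ eta_decay, where C=1])
        (use M(2) in \<open>auto intro!: always_eventually simp: powr_realpow'\<close>)
    show "eventually (\<lambda>t. norm (e2 t) \<le> C2 * (norm (rho t powr \<beta> r) * norm (norm (eta N t) ^ M))) at_top"
      using ev
    proof eventually_elim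
      case (elim t)
      have "norm (Fs r (\<xi>s + eta N t) - (\<Sum>i<M. (1 / fact i) *\<^sub>R Dm (Fs r) (replicate i (eta N t)) \<xi>s))
          \<le> C2 * norm (eta N t) ^ M"
        using elim R by (intro C2(2)) (simp_all add: dist_norm)
      from mult_left_mono[OF this, of "rho t powr \<beta> r"] show ?case
        by (simp add: e2_def mult.left_commute)
    qed
  qed simp
  moreover have "\<mu> (Suc N) < \<beta> r * \<mu> 1 / 2 + real M * \<delta>"
    using M(1) beta_gt[OF r] mu_pos[of 1] by (simp add: add_pos_nonneg add_strict_increasing)
  ultimately have b2: "decay_beyond m (\<mu> (Suc N)) e2" by (auto simp: decay_beyond_def)
  show ?thesis
  proof (rule decay_beyond_cong[OF decay_beyond_add[OF _ b1 b2]])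
    show "eventually (\<lambda>t. Fs r (y t) - (\<Sum>i<M. rho t powr \<beta> r *\<^sub>R (1 / fact i) *\<^sub>R Dm (Fs r) (replicate i (eta N t)) \<xi>s)
        = e1 t + e2 t) at_top"
      using rho_pos
    proof eventually_elim
      case (elim t)
      have "{1..N} = insert 1 {2..N}" using N by auto
      then have "(\<Sum>k=1..N. h k t) = h 1 t + (\<Sum>k=2..N. h k t)" by simp
      then have y: "y t = rho t *\<^sub>R ((\<xi>s + eta N t) + v t)"
        using elim by (simp del: One_nat_def add: v_def eta_def h_1 scaleR_add_right scaleR_sum_right)
      have "pos_homogeneous (\<beta> r) (Fs r)" using F_index_set(3)[OF F_H r] by (simp add: F_term_def)
      then have "Fs r (y t) = rho t powr \<beta> r *\<^sub>R Fs r ((\<xi>s + eta N t) + v t)"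
        using elim unfolding y pos_homogeneous_def by blast
      then show ?case by (simp add: e1_def e2_def scaleR_diff_right scaleR_sum_right)
    qed
  qed simp
qed

text \<open>F is cut at degree B and each term kept is expanded up to Taylor order M, both so large
  that all terms of Q_1, ..., Q_(N+1) occur. These involve only indices below N + 1, so the
  expansion of y up to N determines the expansion of F(y) up to N + 1.\<close>

lemma nonlinear_step:
  assumes N: "1 \<le> N" and w: "decay_beyond m (\<mu> N) (\<lambda>t. y t - (\<Sum>k=1..N. h k t))"
  shows "decay_beyond m (\<mu> (Suc N)) (\<lambda>t. F (y t) - (\<Sum>k=1..Suc N. Q k (logs t) (ze t)))"
proof -
  define s where "s = \<mu> (Suc N)"
  have s0: "0 < s" using mu_pos[of "Suc N"] by (simp add: s_def)
  \<comment> \<open>Half of \<mu>_1 is a rate certainly available for y, and B times it is s + 1, so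
    the remainder of F falls beyond s.\<close>
  define B where "B = 2 * (s + 1) / \<mu> 1"
  have m1: "0 < \<mu> 1" using mu_pos[of 1] by simp
  have B0: "0 \<le> B" using s0 m1 by (simp add: B_def)
  obtain R C d where R: "finite R" "R \<subseteq> J" "{r \<in> J. \<beta> r \<le> B} \<subseteq> R" "0 < d"
    "\<And>x. norm x < d \<Longrightarrow> norm (F x - (\<Sum>r\<in>R. Fs r x)) \<le> C * norm x powr B"
    using F_expansion[OF F_H F0, of B] by blast
  \<comment> \<open>M \<delta> exceeds s, which serves both the Taylor remainder and the bound on
    the length of the lists occurring in Q_k.\<close>
  define M where "M = nat \<lceil>s / \<delta>\<rceil> + 1"
  have sM: "s / \<delta> < real M" by (simp add: M_def) linarith
  have M: "\<mu> (Suc N) \<le> real M * \<delta>" "0 < M"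
    using sM delta_pos by (simp_all add: s_def pos_divide_less_eq) (simp add: M_def)
  define Y where "Y = R \<times> {ks. set ks \<subseteq> {2..N} \<and> length ks < M}"
  have finL: "finite {ks. set ks \<subseteq> {2..N} \<and> length ks < M}"
    by (rule finite_subset[OF _ finite_lists_length_le[of "{2..N}" M]]) auto
  have finY: "finite Y" using R(1) finL by (simp add: Y_def)
  have Q_sub: "Qset k \<subseteq> Y" if k: "k \<in> {1..Suc N}" for k
  proof
    fix x assume x: "x \<in> Qset k"
    obtain r ks where rks: "x = (r, ks)" by (cases x)
    note Qb = Qset_bounds[OF x[unfolded rks]]
    have ks: "\<mu> k \<le> s" unfolding s_def using k by (subst mu_le_iff) auto
    have "\<beta> r * \<mu> 1 \<le> B * \<mu> 1" using Qb(2) ks s0 m1 by (simp add: B_def)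
    then have "\<beta> r \<le> B" using m1 by simp
    then have "r \<in> R" using R(3) Qb(1) by auto
    moreover have "length ks < M"
    proof -
      have "2 * \<delta> = \<mu> 2 - \<mu> 1" by (simp add: \<delta>_def)
      then have "real (length ks) * (2 * \<delta>) \<le> s" using Qb(4) ks by (simp only:)
      then have "real (length ks) * \<delta> \<le> s / 2" by simp
      then have "real (length ks) \<le> s / 2 / \<delta>" using delta_pos by (simp add: pos_le_divide_eq)
      also have "\<dots> \<le> s / \<delta>" using s0 delta_pos by (simp add: field_simps)
      finally have "real (length ks) < real M" using sM by linarith
      then show ?thesis by simp
    qed
    moreover have "set ks \<subseteq> {2..N}" using Qb(3) Qb(5) k by force
    ultimately show "x \<in> Y" by (simp add: Y_def rks)
  qed
  define W where "W = (\<Union>k\<in>{1..Suc N}. Qset k)"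
  have W: "W \<subseteq> Y" unfolding W_def using Q_sub by blast
  \<comment> \<open>The index sets are disjoint for different k, because an index determines its
    order and the exponents are distinct.\<close>
  have sumQ: "(\<Sum>k=1..Suc N. Q k z \<zeta>) = (\<Sum>x\<in>W. Qterm x z \<zeta>)" for z \<zeta>
    unfolding W_def Q_def
  proof (rule sum.UNION_disjoint[symmetric])
    show "\<forall>i\<in>{1..Suc N}. finite (Qset i)" using Qset_finite by auto
    show "\<forall>i\<in>{1..Suc N}. \<forall>j\<in>{1..Suc N}. i \<noteq> j \<longrightarrow> Qset i \<inter> Qset j = {}"
    proof (intro ballI impI)
      fix i j assume ij: "i \<in> {1..Suc N}" "j \<in> {1..Suc N}" "i \<noteq> j"
      then have "\<mu> i \<noteq> \<mu> j" using mu_inj[of i j] by auto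
      then show "Qset i \<inter> Qset j = {}" by (auto simp: Qset_def)
    qed
  qed simp
  \<comment> \<open>The order of a leftover term is again an exponent. It is none of the first N +
    1, so it is larger than s and the strict decay follows.\<close>
  have rest: "decay_beyond m s (\<lambda>t. \<Sum>x\<in>Y - W. Qterm x (logs t) (ze t))"
  proof (rule decay_beyond_sum)
    fix x assume x: "x \<in> Y - W"
    obtain r ks where rks: "x = (r, ks)" by (cases x)
    have r: "r \<in> J" and ks: "set ks \<subseteq> {2..N}" using x R(2) by (auto simp: Y_def rks)
    have ge: "\<forall>i\<in>set ks. 1 \<le> i" "\<forall>j\<in>set ks. 2 \<le> j" using ks by force+
    obtain k where k: "1 \<le> k" "\<mu> k = sum_list (map \<mu> ks) + (\<beta> r - real (length ks)) * \<mu> 1"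
      using mu_product[OF r ge(1)] by blast
    then have "x \<in> Qset k" using r ge by (simp add: Qset_def rks)
    with x k(1) have "Suc N < k" by (force simp: W_def not_less[symmetric])
    then have "s < \<mu> k" unfolding s_def by (rule mu_less[rotated]) simp
    moreover have "decay_upto m (\<mu> k) (\<lambda>t. Qterm x (logs t) (ze t))"
      unfolding k(2) using Qterm_decay[of x N] r ks N by (force simp: rks)
    ultimately show "decay_beyond m s (\<lambda>t. Qterm x (logs t) (ze t))" by (intro decay_upto_imp_beyond)
  qed simp
  have err: "decay_beyond m s (\<lambda>t. \<Sum>r\<in>R. Fs r (y t)
      - (\<Sum>i<M. rho t powr \<beta> r *\<^sub>R (1 / fact i) *\<^sub>R Dm (Fs r) (replicate i (eta N t)) \<xi>s))"
    unfolding s_def using R(2) by (intro decay_beyond_sum Fs_taylor_error N M w) auto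
  have F: "decay_beyond m s (\<lambda>t. F (y t) - (\<Sum>r\<in>R. Fs r (y t)))"
  proof -
    have "decay m (B * (\<mu> 1 / 2)) (\<lambda>t. F (y t) - (\<Sum>r\<in>R. Fs r (y t)))"
    proof (rule decay_powr)
      show "decay m (\<mu> 1 / 2) y" using y_decay m1 by (simp add: decay_upto_def)
      show "eventually (\<lambda>t. norm (F (y t) - (\<Sum>r\<in>R. Fs r (y t))) \<le> C * norm (y t) powr B) at_top"
        using y_lt[OF R(4)] by eventually_elim (rule R(5))
    qed (use B0 in auto)
    moreover have "s < B * (\<mu> 1 / 2)" using m1 by (simp add: B_def)
    ultimately show ?thesis unfolding decay_beyond_def by blast
  qed
  show ?thesis unfolding s_def[symmetric]
  proof (rule decay_beyond_cong[OF decay_beyond_add[OF _ decay_beyond_add[OF _ F err] rest]])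
    show "eventually (\<lambda>t. F (y t) - (\<Sum>k=1..Suc N. Q k (logs t) (ze t))
        = F (y t) - (\<Sum>r\<in>R. Fs r (y t)) + (\<Sum>r\<in>R. Fs r (y t)
          - (\<Sum>i<M. rho t powr \<beta> r *\<^sub>R (1 / fact i) *\<^sub>R Dm (Fs r) (replicate i (eta N t)) \<xi>s))
          + (\<Sum>x\<in>Y - W. Qterm x (logs t) (ze t))) at_top"
      using rho_pos
    proof eventually_elim
      case (elim t)
      have "(\<Sum>r\<in>R. \<Sum>i<M. rho t powr \<beta> r *\<^sub>R (1 / fact i) *\<^sub>R Dm (Fs r) (replicate i (eta N t)) \<xi>s)
          = (\<Sum>r\<in>R. \<Sum>ks\<in>{ks. set ks \<subseteq> {2..N} \<and> length ks < M}. Qterm (r, ks) (logs t) (ze t))"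
        by (rule sum.cong) (use R(2) taylor_expand[OF _ elim] in auto)
      also have "\<dots> = (\<Sum>x\<in>Y. Qterm x (logs t) (ze t))"
        by (simp add: sum.cartesian_product Y_def case_prod_beta')
      also have "\<dots> = (\<Sum>x\<in>Y - W. Qterm x (logs t) (ze t)) + (\<Sum>k=1..Suc N. Q k (logs t) (ze t))"
        unfolding sumQ by (rule sum.subset_diff[OF W finY])
      finally show ?case by (simp add: sum_subtractf)
    qed
  qed auto
qed

theorem y_expansion: "1 \<le> N \<Longrightarrow> decay_beyond m (\<mu> N) (\<lambda>t. y t - (\<Sum>k=1..N. h k t))"
proof (induction N rule: dec_induct)
  case base
  have "(\<Sum>k=1..1. Q k z \<zeta>) = 0" for z \<zeta> by (simp del: One_nat_def add: Q_def Qset_1)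
  then show ?case using F_base by (intro linear_step) simp_all
next
  case (step N)
  show ?case by (rule linear_step[OF _ nonlinear_step[OF step.hyps(1) step.IH]]) simp
qed

end

lemma h_Xi: "1 \<le> k \<Longrightarrow> eventually (\<lambda>t. case_prod (q k) (Xi n p0 (n k) t) = h k t) at_top"
proof -
  assume k: "1 \<le> k"
  have "eventually (\<lambda>t. lift1 p0 (Lhat (n 1) t) 1 = lift1 p0 (logs t) 1) at_top"
    by (rule Phat_Lhat[OF P_plus_Phat[OF p0] order.refl]) simp
  with Phat_Lhat[OF q_Phat[OF k] order.refl ze_pos] show ?thesis
    by eventually_elim (simp add: Xi_def h_def ze_def lift1_def vec_eq_iff)
qed

end

lemma C1_solution_derivative:
  assumes "C1_solution A F f T0 y"
  shows "eventually (\<lambda>t. (y has_vector_derivative (F (y t) + f t - A *v y t)) (at t)) at_top"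
proof -
  obtain y' where y': "\<And>t. T0 \<le> t \<Longrightarrow> (y has_vector_derivative y' t) (at t within {T0..})"
    "\<And>t. T0 < t \<Longrightarrow> y' t + A *v y t = F (y t) + f t"
    using assms by (auto simp: C1_solution_def)
  show ?thesis
    using eventually_gt_at_top[of T0]
  proof eventually_elim
    case (elim t)
    then have "(y has_vector_derivative y' t) (at t within {T0<..})"
      by (intro has_vector_derivative_within_subset[OF y'(1)]) auto
    moreover have "at t within {T0<..} = at t" using elim by (intro at_within_open) auto
    moreover have "y' t = F (y t) + f t - A *v y t" using y'(2)[OF elim] by (simp add: eq_diff_eq)
    ultimately show ?case by simp
  qed
qed

section \<open>Re-indexing of the forcing and conclusion\<close>

context exponents
begin

lemma reindex_eq:
  assumes "l \<in> I" "\<mu> k = \<gamma> l"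
  shows "reindex I \<gamma> \<mu> p k = p l"
proof -
  have "(THE l. l \<in> I \<and> \<mu> k = \<gamma> l) = l"
    using assms gamma_inj by (intro the_equality) (auto simp: inj_on_def)
  then show ?thesis using assms by (auto simp: reindex_def)
qed

lemma reindex_sum:
  fixes p :: "nat \<Rightarrow> (int \<Rightarrow> real) \<Rightarrow> real^'n"
  assumes N: "1 \<le> N"
  shows "(\<Sum>k=1..N. reindex I \<gamma> \<mu> p k z) = (\<Sum>l\<in>{l \<in> I. \<gamma> l \<le> \<mu> N}. p l z)"
proof -
  let ?R = "{l \<in> I. \<gamma> l \<le> \<mu> N}"
  have fin: "finite ?R" by (rule gamma_fin)
  have "reindex I \<gamma> \<mu> p k z = (\<Sum>l\<in>?R. if \<mu> k = \<gamma> l then p l z else 0)" if k: "k \<in> {1..N}" for k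
  proof (cases "\<exists>l\<in>I. \<mu> k = \<gamma> l")
    case True
    then obtain l where l: "l \<in> I" "\<mu> k = \<gamma> l" by blast
    have "\<mu> k \<le> \<mu> N" using k by (subst mu_le_iff) auto
    then have lR: "l \<in> ?R" using l by auto
    have "(\<Sum>l'\<in>?R. if \<mu> k = \<gamma> l' then p l' z else 0) = (\<Sum>l'\<in>?R. if l' = l then p l z else 0)"
      by (rule sum.cong) (use l gamma_inj in \<open>auto simp: inj_on_def\<close>)
    also have "\<dots> = p l z" using lR fin by simp
    finally show ?thesis by (simp add: reindex_eq[OF l])
  next
    case False
    then have "(\<Sum>l\<in>?R. if \<mu> k = \<gamma> l then p l z else 0) = 0" by (intro sum.neutral) auto
    with False show ?thesis by (simp add: reindex_def)
  qed
  then have "(\<Sum>k=1..N. reindex I \<gamma> \<mu> p k z) = (\<Sum>k=1..N. \<Sum>l\<in>?R. if \<mu> k = \<gamma> l then p l z else 0)"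
    by (intro sum.cong) auto
  also have "\<dots> = (\<Sum>l\<in>?R. \<Sum>k=1..N. if \<mu> k = \<gamma> l then p l z else 0)" by (rule sum.swap)
  also have "\<dots> = (\<Sum>l\<in>?R. p l z)"
  proof (rule sum.cong)
    fix l assume l: "l \<in> ?R"
    then obtain k where k: "1 \<le> k" "\<mu> k = \<gamma> l" using mu_gamma[of l] by blast
    with l N have kN: "k \<in> {1..N}" using mu_le_iff[of k N] by auto
    have "(\<Sum>k'=1..N. if \<mu> k' = \<gamma> l then p l z else 0) = (\<Sum>k'=1..N. if k' = k then p l z else 0)"
      by (rule sum.cong) (use k mu_inj[of _ k] in auto)
    with kN show "(\<Sum>k'=1..N. if \<mu> k' = \<gamma> l then p l z else 0) = p l z" by simp
  qed simp
  finally show ?thesis .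
qed

text \<open>The values \<gamma>_1, ..., \<gamma>_l all occur among \<mu>_1, ..., \<mu>_k, so l is at
  most k by counting. Hence a forcing term moved from position l to k has depth at most n_k, as the
  class of P_k demands.\<close>

lemma gamma_index_le:
  assumes mono: "strict_mono_on I \<gamma>" and l: "l \<in> I" "{1..l} \<subseteq> I" and k: "1 \<le> k" "\<mu> k = \<gamma> l"
  shows "l \<le> k"
proof -
  have "\<forall>i\<in>{1..l}. \<exists>j\<ge>1. \<mu> j = \<gamma> i" using mu_gamma l(2) by blast
  then obtain \<kappa> where \<kappa>: "\<And>i. i \<in> {1..l} \<Longrightarrow> 1 \<le> \<kappa> i \<and> \<mu> (\<kappa> i) = \<gamma> i" by metis
  have "\<kappa> ` {1..l} \<subseteq> {1..k}"
  proof
    fix j assume "j \<in> \<kappa> ` {1..l}"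
    then obtain i where i: "i \<in> {1..l}" "j = \<kappa> i" by blast
    have "\<gamma> i \<le> \<gamma> l" using strict_mono_on_leD[OF mono, of i l] i l by auto
    then have "\<mu> j \<le> \<mu> k" using \<kappa>[OF i(1)] i(2) k(2) by simp
    then show "j \<in> {1..k}" using \<kappa>[OF i(1)] i(2) k(1) mu_le_iff[of j k] by auto
  qed
  moreover have "inj_on \<kappa> {1..l}"
  proof (rule inj_onI)
    fix i j assume ij: "i \<in> {1..l}" "j \<in> {1..l}" "\<kappa> i = \<kappa> j"
    then have "\<gamma> i = \<gamma> j" using \<kappa> by metis
    moreover have "i \<in> I" "j \<in> I" using ij l(2) by auto
    ultimately show "i = j" by (rule inj_onD[OF gamma_inj])
  qed
  ultimately have "card {1..l} \<le> card {1..k}" by (intro card_inj_on_le) auto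
  then show ?thesis by simp
qed

end

lemma P_m_Phat: "p \<in> P_m m k \<mu> \<Longrightarrow> (\<lambda>z \<zeta>. p z) \<in> Phat_m m k \<mu>"
  by (fastforce simp: P_m_def Phat_m_def)

theorem theorem5p6:
  fixes A :: "real^'n^'n"
    and F :: "real^'n \<Rightarrow> real^'n" and J :: "nat set" and \<beta> :: "nat \<Rightarrow> real"
    and Fs :: "nat \<Rightarrow> real^'n \<Rightarrow> real^'n"
    and f :: "real \<Rightarrow> real^'n" and T :: real and m :: nat
    and I :: "nat set" and \<gamma> :: "nat \<Rightarrow> real" and n :: "nat \<Rightarrow> nat"
    and p :: "nat \<Rightarrow> (int \<Rightarrow> real) \<Rightarrow> real^'n"
    and p0 :: "(int \<Rightarrow> real) \<Rightarrow> real" and \<xi>0 :: "real^'n"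
    and \<mu> :: "nat \<Rightarrow> real" and q :: "nat \<Rightarrow> (int \<Rightarrow> real) \<Rightarrow> real \<Rightarrow> real^'n"
  assumes "\<And>c. complex_eigenvalue A c \<Longrightarrow> 0 < Re c"
    and "locally_lipschitz F" and "F 0 = 0"
    and "F_H1 F J \<beta> Fs \<or> F_H2 F J \<beta> Fs"
    and "0 \<le> T" and "continuous_on {T..} f"
    and "f_f1 f m I \<gamma> n p \<or> f_f2 f m I \<gamma> n p"
    and "p0 \<in> P_plus m (n 1)" and "\<xi>0 \<noteq> 0"
    and "\<And>z. z \<in> posdom (n 1) \<Longrightarrow> p 1 z = (p0 z * z (int m) powr (- \<gamma> 1)) *\<^sub>R \<xi>0"
    and "\<mu> = mu m J \<beta> I \<gamma>"
    and "q = qfun A m n \<mu> J \<beta> Fs (reindex I \<gamma> \<mu> p) p0 \<xi>0"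
  shows "(\<forall>k\<ge>1. q k \<in> Phat_m m (n k) (- \<mu> k)) \<and>
    (\<forall>T0 y. 0 < T0 \<and> T \<le> T0 \<and> C1_solution A F f T0 y \<and> (y \<longlongrightarrow> 0) at_top \<longrightarrow>
      (\<forall>N\<ge>1. \<exists>\<nu>>\<mu> N.
        (\<lambda>t. norm (y t - (\<Sum>k=1..N. case_prod (q k) (Xi n p0 (n k) t))))
          \<in> O(\<lambda>t. L m t powr - \<nu>)))"
proof -
  note f = forcing[OF assms(7)] and F = F_index_set[OF assms(4)]
  interpret ex: exponents m J \<beta> I \<gamma>
  proof
    show "\<gamma> 1 < \<gamma> k" if "k \<in> I" "k \<noteq> 1" for k
      using strict_mono_onD[OF f(3) f(1) that(1)] f(8)[OF that(1)] that(2) by simp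
    show "inj_on \<gamma> I" by (rule strict_mono_on_imp_inj_on[OF f(3)])
  qed (fact f(1,2,5) F)+
  obtain nt where nt: "\<And>l. l \<in> I \<Longrightarrow> p l \<in> P_m (int m) (int (nt l)) (- \<gamma> l) \<and> m \<le> nt l \<and> nt l \<le> n l"
    and expand: "\<And>B. \<exists>R. finite R \<and> R \<subseteq> I \<and> {l \<in> I. \<gamma> l \<le> B} \<subseteq> R \<and>
        (\<exists>\<nu>>B. decay (int m) \<nu> (\<lambda>t. f t - (\<Sum>l\<in>R. p l (Lhat (int (nt l)) t))))"
    using f(9) by blast
  let ?P = "reindex I \<gamma> \<mu> p"
  interpret expansion m J \<beta> I \<gamma> A F Fs f n ?P p0 \<xi>0
    unfolding assms(11)
  proof
    show "\<forall>c. complex_eigenvalue A c \<longrightarrow> 0 < Re c" using assms(1) by blast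
    show "m \<le> n k" if "1 \<le> k" for k by (rule f(6)[OF that])
    show "n i \<le> n j" if "1 \<le> i" "i \<le> j" for i j by (rule f(7)[OF that])
    show "(\<lambda>z \<zeta>. reindex I \<gamma> ex.\<mu> p k z) \<in> Phat_m m (n k) (- ex.\<mu> k)" if k: "1 \<le> k" for k
    proof (cases "\<exists>l\<in>I. ex.\<mu> k = \<gamma> l")
      case True
      then obtain l where l: "l \<in> I" "ex.\<mu> k = \<gamma> l" by blast
      have "l \<le> k" by (rule ex.gamma_index_le[OF f(3) l(1) f(4)[OF l(1)] k l(2)])
      then have "int (nt l) \<le> int (n k)" using nt[OF l(1)] f(7)[OF f(8)[OF l(1)]] by fastforce
      then show ?thesis
        unfolding ex.reindex_eq[OF l] l(2) using nt[OF l(1)] by (intro Phat_deeper[OF P_m_Phat]) auto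
    next
      case False
      then show ?thesis by (simp add: reindex_def Phat_zero)
    qed
    show "reindex I \<gamma> ex.\<mu> p 1 z = (p0 z * z (int m) powr - ex.\<mu> 1) *\<^sub>R \<xi>0" if "z \<in> posdom (n 1)" for z
      unfolding ex.reindex_eq[OF f(1) ex.mu_1] ex.mu_1 by (rule assms(10)[OF that])
    show "decay_beyond m (ex.\<mu> N) (\<lambda>t. f t - (\<Sum>k=1..N. reindex I \<gamma> ex.\<mu> p k (logs t)))" if N: "1 \<le> N" for N
    proof -
      \<comment> \<open>R may reach beyond \<mu>_N. The partial sum of the re-indexed forcing runs
        over the indices with \<gamma>_l \<le> \<mu>_N, and the remaining terms of R are of higher
        order and join the error.\<close>
      obtain R \<nu> where R: "finite R" "R \<subseteq> I" "{l \<in> I. \<gamma> l \<le> ex.\<mu> N} \<subseteq> R"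
        and \<nu>: "ex.\<mu> N < \<nu>" "decay m \<nu> (\<lambda>t. f t - (\<Sum>l\<in>R. p l (Lhat (nt l) t)))"
        using expand[of "ex.\<mu> N"] by blast
      have "eventually (\<lambda>t. \<forall>l\<in>R. p l (Lhat (nt l) t) = p l (logs t)) at_top"
      proof (intro eventually_ball_finite R ballI)
        fix l assume "l \<in> R"
        then have "p l \<in> P_m m (nt l) (- \<gamma> l)" using R nt by blast
        from Phat_Lhat[OF P_m_Phat[OF this] order.refl, of "\<lambda>_. 1"]
        show "eventually (\<lambda>t. p l (Lhat (nt l) t) = p l (logs t)) at_top" by simp
      qed
      then have ev: "eventually (\<lambda>t. f t - (\<Sum>k=1..N. reindex I \<gamma> ex.\<mu> p k (logs t))
          = f t - (\<Sum>l\<in>R. p l (Lhat (nt l) t)) + (\<Sum>l\<in>R - {l \<in> I. \<gamma> l \<le> ex.\<mu> N}. p l (logs t))) at_top"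
      proof eventually_elim
        case (elim t)
        have "(\<Sum>l\<in>R. p l (Lhat (nt l) t)) = (\<Sum>l\<in>R. p l (logs t))"
          by (rule sum.cong) (use elim in auto)
        also have "\<dots> = (\<Sum>l\<in>R - {l \<in> I. \<gamma> l \<le> ex.\<mu> N}. p l (logs t))
            + (\<Sum>k=1..N. reindex I \<gamma> ex.\<mu> p k (logs t))"
          unfolding ex.reindex_sum[OF N] by (rule sum.subset_diff[OF R(3,1)])
        finally show ?case by simp
      qed
      have "subpower m (\<lambda>t. p0 (logs t))"
        using P_plus_subpower[OF assms(8)] f(6)[of 1] by simp
      then have "decay_beyond m (ex.\<mu> N) (\<lambda>t. p l (logs t))" if l: "l \<in> R - {l \<in> I. \<gamma> l \<le> ex.\<mu> N}" for l
      proof (intro decay_upto_imp_beyond[of _ "\<gamma> l"])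
        have "l \<in> I" using l R by auto
        from Phat_decay[OF P_m_Phat[OF conjunct1[OF nt[OF this]]]]
        show "decay_upto m (\<gamma> l) (\<lambda>t. p l (logs t))"
          using \<open>subpower m (\<lambda>t. p0 (logs t))\<close> nt[OF \<open>l \<in> I\<close>] by auto
        show "ex.\<mu> N < \<gamma> l" using l R by auto
      qed
      then have rest: "decay_beyond m (ex.\<mu> N) (\<lambda>t. \<Sum>l\<in>R - {l \<in> I. \<gamma> l \<le> ex.\<mu> N}. p l (logs t))"
        by (intro decay_beyond_sum) auto
      have "decay_beyond m (ex.\<mu> N) (\<lambda>t. f t - (\<Sum>l\<in>R. p l (Lhat (nt l) t)))"
        using \<nu> by (auto simp: decay_beyond_def)
      from decay_beyond_cong[OF decay_beyond_add[OF _ this rest] ev] show ?thesis by simp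
    qed
  qed (fact assms)+
  have q: "local.q = q" unfolding local.q_def assms(12) by (simp only: assms(11))
  show ?thesis
  proof (intro conjI allI impI)
    show "q k \<in> Phat_m m (n k) (- \<mu> k)" if "1 \<le> k" for k
    proof -
      have "q k \<in> Phat_m m (n k) (- ex.\<mu> k)" using q_Phat[OF that] unfolding q .
      then show ?thesis by (simp only: assms(11))
    qed
    fix T0 :: real and y :: "real \<Rightarrow> real^'n" and N :: nat
    assume y: "0 < T0 \<and> T \<le> T0 \<and> C1_solution A F f T0 y \<and> (y \<longlongrightarrow> 0) at_top" and N: "1 \<le> N"
    have "decay_beyond m (ex.\<mu> N) (\<lambda>t. y t - (\<Sum>k=1..N. h k t))"
      by (rule y_expansion[OF C1_solution_derivative _ N]) (use y in auto)
    moreover have "eventually (\<lambda>t. \<forall>k\<in>{1..N}. case_prod (q k) (Xi n p0 (n k) t) = h k t) at_top"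
      using h_Xi unfolding q by (intro eventually_ball_finite) auto
    then have "eventually (\<lambda>t. y t - (\<Sum>k=1..N. case_prod (q k) (Xi n p0 (n k) t))
        = y t - (\<Sum>k=1..N. h k t)) at_top"
      by eventually_elim simp
    ultimately have "decay_beyond m (ex.\<mu> N) (\<lambda>t. y t - (\<Sum>k=1..N. case_prod (q k) (Xi n p0 (n k) t)))"
      by (rule decay_beyond_cong)
    then have "decay_beyond m (\<mu> N) (\<lambda>t. y t - (\<Sum>k=1..N. case_prod (q k) (Xi n p0 (n k) t)))"
      by (simp only: assms(11))
    then show "\<exists>\<nu>>\<mu> N. (\<lambda>t. norm (y t - (\<Sum>k=1..N. case_prod (q k) (Xi n p0 (n k) t))))
        \<in> O(\<lambda>t. L m t powr - \<nu>)"
      by (auto simp: decay_beyond_def decay_def)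
  qed
qed

end
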